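(* Let $p$ be an odd prime, $n\ge1$, and $L/K$ a cyclic Galois extension of degree $p^n$ with group $G=\langle\sigma\rangle$. For $0\le i\le n$ let $K_i$ be the unique intermediate field $K\subseteq K_i\subseteq L$ with $[K_i:K]=p^i$. Then for $0\le r,s<p^{n-1}$ and $0\le i\le n$, $K_i\otimes_K H_r\cong K_i\otimes_K H_s$ as $K_i$-Hopf algebras if and only if $r\equiv s\pmod{p^{n-1-i}}$, where for $i=n$ this congruence is understood to hold for all $r,s$.
   Context: Let $N=\langle\eta\rangle$ be cyclic of order $p^n$ and $\delta\in\mathrm{Aut}(N)$ the $(p-1)$-th power of a generator of the cyclic group $\mathrm{Aut}(N)$. Let $\rho(\eta)\in\mathrm{Perm}(N)$ be $x\mapsto x\eta^{-1}$ and $\lambda_N(\nu)(x)=\nu x$. For $0\le s<p^{n-1}$ let $\beta_s:G\to\mathrm{Perm}(N)$ be the homomorphism with $\beta_s(\sigma)=\rho(\eta)\circ\delta^{s}$. Let $b_s:G\to N$, $b_s(g)=\beta_s(g)(1_N)$ (a bijection), and $\alpha_s:N\to\mathrm{Perm}(G)$, $\alpha_s(\nu)=b_s^{-1}\circ\lambda_N(\nu)\circ b_s$. Then $\alpha_s(N)$ is a regular subgroup of $\mathrm{Perm}(G)$ normalized by the left regular representation $\lambda(G)$, and $H_s=L[\alpha_s(N)]^G$, where $G$ acts on $L$ as Galois automorphisms and on $\alpha_s(N)$ by $g\ast\nu=\lambda(g)\nu\lambda(g)^{-1}$. *)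

theory Defs
  imports "HOL-Algebra.Algebra" "HOL-Number_Theory.Cong"
begin

section \<open>Tensor products of modules\<close>

text \<open>The ring multiplication and unit that a \<open>module\<close> record carries are irrelevant for plain
  modules and are left undefined in this section.\<close>

definition free_module :: "('r, 'x) ring_scheme \<Rightarrow> 's set \<Rightarrow> ('r, 's \<Rightarrow> 'r) module" where
  "free_module R S =
    \<lparr>carrier = {f. (\<forall>z. f z \<in> carrier R) \<and> (\<forall>z. z \<notin> S \<longrightarrow> f z = \<zero>\<^bsub>R\<^esub>) \<and> finite {z. f z \<noteq> \<zero>\<^bsub>R\<^esub>}},
     monoid.mult = undefined,
     one = undefined,
     ring.zero = (\<lambda>z. \<zero>\<^bsub>R\<^esub>),
     add = (\<lambda>f g z. f z \<oplus>\<^bsub>R\<^esub> g z),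
     module.smult = (\<lambda>c f z. c \<otimes>\<^bsub>R\<^esub> f z)\<rparr>"

definition free_basis :: "('r, 'x) ring_scheme \<Rightarrow> 's \<Rightarrow> 's \<Rightarrow> 'r" where
  "free_basis R z = (\<lambda>w. if w = z then \<one>\<^bsub>R\<^esub> else \<zero>\<^bsub>R\<^esub>)"

definition tensor_gens ::
  "('r, 'x) ring_scheme \<Rightarrow> ('r, 'a, 'y) module_scheme \<Rightarrow> ('r, 'b, 'z) module_scheme
    \<Rightarrow> ('a \<times> 'b \<Rightarrow> 'r) set" where
  "tensor_gens R M N =
    (let F = free_module R (carrier M \<times> carrier N); e = free_basis R in
      {e (a \<oplus>\<^bsub>M\<^esub> a', b) \<ominus>\<^bsub>F\<^esub> (e (a, b) \<oplus>\<^bsub>F\<^esub> e (a', b)) | a a' b.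
         a \<in> carrier M \<and> a' \<in> carrier M \<and> b \<in> carrier N}
    \<union> {e (a, b \<oplus>\<^bsub>N\<^esub> b') \<ominus>\<^bsub>F\<^esub> (e (a, b) \<oplus>\<^bsub>F\<^esub> e (a, b')) | a b b'.
         a \<in> carrier M \<and> b \<in> carrier N \<and> b' \<in> carrier N}
    \<union> {e (c \<odot>\<^bsub>M\<^esub> a, b) \<ominus>\<^bsub>F\<^esub> (c \<odot>\<^bsub>F\<^esub> e (a, b)) | c a b.
         c \<in> carrier R \<and> a \<in> carrier M \<and> b \<in> carrier N}
    \<union> {e (a, c \<odot>\<^bsub>N\<^esub> b) \<ominus>\<^bsub>F\<^esub> (c \<odot>\<^bsub>F\<^esub> e (a, b)) | c a b.
         c \<in> carrier R \<and> a \<in> carrier M \<and> b \<in> carrier N})"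

definition tensor_rel ::
  "('r, 'x) ring_scheme \<Rightarrow> ('r, 'a, 'y) module_scheme \<Rightarrow> ('r, 'b, 'z) module_scheme
    \<Rightarrow> ('a \<times> 'b \<Rightarrow> 'r) set" where
  "tensor_rel R M N =
    \<Inter> {U. submodule U R (free_module R (carrier M \<times> carrier N)) \<and> tensor_gens R M N \<subseteq> U}"

definition tensor ::
  "('r, 'x) ring_scheme \<Rightarrow> ('r, 'a, 'y) module_scheme \<Rightarrow> ('r, 'b, 'z) module_scheme
    \<Rightarrow> ('r, ('a \<times> 'b \<Rightarrow> 'r) set) module" where
  "tensor R M N =
    (let F = free_module R (carrier M \<times> carrier N); U = tensor_rel R M N in
      \<lparr>carrier = a_rcosets\<^bsub>F\<^esub> U,
       monoid.mult = undefined,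
       one = undefined,
       ring.zero = U,
       add = (\<lambda>t u. t <+>\<^bsub>F\<^esub> u),
       module.smult = (\<lambda>c t. \<Union>f\<in>t. U +>\<^bsub>F\<^esub> (c \<odot>\<^bsub>F\<^esub> f))\<rparr>)"

definition pure_tensor ::
  "('r, 'x) ring_scheme \<Rightarrow> ('r, 'a, 'y) module_scheme \<Rightarrow> ('r, 'b, 'z) module_scheme
    \<Rightarrow> 'a \<Rightarrow> 'b \<Rightarrow> ('a \<times> 'b \<Rightarrow> 'r) set" where
  "pure_tensor R M N a b =
    tensor_rel R M N +>\<^bsub>free_module R (carrier M \<times> carrier N)\<^esub> free_basis R (a, b)"

text \<open>The linear map \<open>M \<otimes>\<^sub>R N \<rightarrow> P\<close> induced by an \<open>R\<close>-bilinear map \<open>\<beta>\<close>. All representatives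
  \<open>f\<close> of the class \<open>t\<close> give the same value precisely because \<open>\<beta>\<close> is bilinear. Only the scalars
  in \<open>R\<close> are applied, so \<open>P\<close> may also be a module over an overring of \<open>R\<close>.\<close>

definition tensor_lift ::
  "('r, 'x) ring_scheme \<Rightarrow> ('r, 'p, 'w) module_scheme \<Rightarrow> ('a \<Rightarrow> 'b \<Rightarrow> 'p)
    \<Rightarrow> ('a \<times> 'b \<Rightarrow> 'r) set \<Rightarrow> 'p" where
  "tensor_lift R P \<beta> t =
    the_elem ((\<lambda>f. \<Oplus>\<^bsub>P\<^esub>z\<in>{z. f z \<noteq> \<zero>\<^bsub>R\<^esub>}. f z \<odot>\<^bsub>P\<^esub> \<beta> (fst z) (snd z)) ` t)"


section \<open>Hopf algebras\<close>

text \<open>For a Hopf algebra \<open>A\<close> over \<open>R\<close>, \<open>comult A\<close> takes values in \<open>carrier (tensor R A A)\<close> and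
  \<open>counit A\<close> in \<open>carrier R\<close>.\<close>

record ('r, 'a) hopf_alg = "('r, 'a) module" +
  comult :: "'a \<Rightarrow> ('a \<times> 'a \<Rightarrow> 'r) set"
  counit :: "'a \<Rightarrow> 'r"
  antipode :: "'a \<Rightarrow> 'a"

definition hopf_iso ::
  "('r, 'x) ring_scheme \<Rightarrow> ('r, 'a) hopf_alg \<Rightarrow> ('r, 'b) hopf_alg \<Rightarrow> ('a \<Rightarrow> 'b) set" where
  "hopf_iso R A B =
    {\<phi> \<in> ring_iso A B.
      (\<forall>c\<in>carrier R. \<forall>a\<in>carrier A. \<phi> (c \<odot>\<^bsub>A\<^esub> a) = c \<odot>\<^bsub>B\<^esub> \<phi> a) \<and>
      (\<forall>a\<in>carrier A.
        comult B (\<phi> a) =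
          tensor_lift R (tensor R B B) (\<lambda>x y. pure_tensor R B B (\<phi> x) (\<phi> y)) (comult A a)) \<and>
      (\<forall>a\<in>carrier A. counit B (\<phi> a) = counit A a) \<and>
      (\<forall>a\<in>carrier A. antipode B (\<phi> a) = \<phi> (antipode A a))}"

definition hopf_isomorphic ::
  "('r, 'x) ring_scheme \<Rightarrow> ('r, 'a) hopf_alg \<Rightarrow> ('r, 'b) hopf_alg \<Rightarrow> bool" where
  "hopf_isomorphic R A B \<longleftrightarrow> hopf_iso R A B \<noteq> {}"


subsection \<open>Base change\<close>

definition self_module :: "('r, 'x) ring_scheme \<Rightarrow> ('r, 'r) module" where
  "self_module S =
    \<lparr>carrier = carrier S, monoid.mult = monoid.mult S, one = \<one>\<^bsub>S\<^esub>, ring.zero = \<zero>\<^bsub>S\<^esub>, add = add S,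
     module.smult = monoid.mult S\<rparr>"

text \<open>\<open>S \<otimes>\<^sub>R M\<close> as an \<open>S\<close>-module, where \<open>R\<close> is a subring of the commutative ring \<open>S\<close>.\<close>

definition base_change_module ::
  "('r, 'x) ring_scheme \<Rightarrow> ('r, 'y) ring_scheme \<Rightarrow> ('r, 'a, 'z) module_scheme
    \<Rightarrow> ('r, ('r \<times> 'a \<Rightarrow> 'r) set) module" where
  "base_change_module R S M =
    (let T = tensor R (self_module S) M in
      T\<lparr>module.smult := \<lambda>c. tensor_lift R T (\<lambda>a x. pure_tensor R (self_module S) M (c \<otimes>\<^bsub>S\<^esub> a) x)\<rparr>)"

text \<open>The \<open>S\<close>-Hopf algebra \<open>S \<otimes>\<^sub>R A\<close>. Its comultiplication is \<open>id \<otimes> \<Delta>\<^sub>A\<close> followed by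
  \<open>S \<otimes>\<^sub>R (A \<otimes>\<^sub>R A) \<cong> (S \<otimes>\<^sub>R A) \<otimes>\<^sub>S (S \<otimes>\<^sub>R A)\<close>, \<open>a \<otimes> (h \<otimes> k) \<mapsto> a ((1 \<otimes> h) \<otimes> (1 \<otimes> k))\<close>.\<close>

definition base_change ::
  "('r, 'x) ring_scheme \<Rightarrow> ('r, 'y) ring_scheme \<Rightarrow> ('r, 'a) hopf_alg
    \<Rightarrow> ('r, ('r \<times> 'a \<Rightarrow> 'r) set) hopf_alg" where
  "base_change R S A =
    (let B = base_change_module R S A;
         BB = tensor S B B;
         p = pure_tensor R (self_module S) A
     in
      \<lparr>carrier = carrier B,
       monoid.mult = (\<lambda>t u. tensor_lift R B
                 (\<lambda>a h. tensor_lift R B (\<lambda>b k. p (a \<otimes>\<^bsub>S\<^esub> b) (h \<otimes>\<^bsub>A\<^esub> k)) u) t),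
       one = p \<one>\<^bsub>S\<^esub> \<one>\<^bsub>A\<^esub>,
       ring.zero = \<zero>\<^bsub>B\<^esub>,
       add = add B,
       module.smult = module.smult B,
       comult = tensor_lift R BB
                  (\<lambda>a h. a \<odot>\<^bsub>BB\<^esub>
                     tensor_lift R BB (\<lambda>h1 h2. pure_tensor S B B (p \<one>\<^bsub>S\<^esub> h1) (p \<one>\<^bsub>S\<^esub> h2))
                       (comult A h)),
       counit = tensor_lift R (self_module S) (\<lambda>a h. a \<otimes>\<^bsub>S\<^esub> counit A h),
       antipode = tensor_lift R B (\<lambda>a h. p a (antipode A h))\<rparr>)"


subsection \<open>Group algebras of finite groups\<close>

definition group_algebra_alg ::
  "('r, 'x) ring_scheme \<Rightarrow> ('g, 'y) monoid_scheme \<Rightarrow> ('r, 'g \<Rightarrow> 'r) module" where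
  "group_algebra_alg R M =
    \<lparr>carrier = carrier M \<rightarrow>\<^sub>E carrier R,
     monoid.mult = (\<lambda>f g. \<lambda>x\<in>carrier M. \<Oplus>\<^bsub>R\<^esub>y\<in>carrier M. f y \<otimes>\<^bsub>R\<^esub> g (inv\<^bsub>M\<^esub> y \<otimes>\<^bsub>M\<^esub> x)),
     one = (\<lambda>x\<in>carrier M. free_basis R \<one>\<^bsub>M\<^esub> x),
     ring.zero = (\<lambda>x\<in>carrier M. \<zero>\<^bsub>R\<^esub>),
     add = (\<lambda>f g. \<lambda>x\<in>carrier M. f x \<oplus>\<^bsub>R\<^esub> g x),
     module.smult = (\<lambda>c f. \<lambda>x\<in>carrier M. c \<otimes>\<^bsub>R\<^esub> f x)\<rparr>"

definition group_algebra ::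
  "('r, 'x) ring_scheme \<Rightarrow> ('g, 'y) monoid_scheme \<Rightarrow> ('r, 'g \<Rightarrow> 'r) hopf_alg" where
  "group_algebra R M =
    (let A = group_algebra_alg R M;
         AA = tensor R A A;
         e = (\<lambda>x. restrict (free_basis R x) (carrier M))
     in module.extend A
      \<lparr>comult = (\<lambda>f. \<Oplus>\<^bsub>AA\<^esub>x\<in>carrier M. f x \<odot>\<^bsub>AA\<^esub> pure_tensor R A A (e x) (e x)),
       counit = (\<lambda>f. \<Oplus>\<^bsub>R\<^esub>x\<in>carrier M. f x),
       antipode = (\<lambda>f. \<lambda>x\<in>carrier M. f (inv\<^bsub>M\<^esub> x))\<rparr>)"


section \<open>Galois extensions and descent\<close>

definition galois_group :: "('l, 'x) ring_scheme \<Rightarrow> 'l set \<Rightarrow> ('l \<Rightarrow> 'l) monoid" where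
  "galois_group L K =
    (BijGroup (carrier L))
      \<lparr>carrier := {g \<in> Bij (carrier L). g \<in> ring_hom L L \<and> (\<forall>x\<in>K. g x = x)}\<rparr>"

definition galois_extension :: "('l, 'x) ring_scheme \<Rightarrow> 'l set \<Rightarrow> bool" where
  "galois_extension L K \<longleftrightarrow>
    field L \<and> subfield K L \<and> ring.finite_dimension L K (carrier L) \<and>
    {x \<in> carrier L. \<forall>g\<in>carrier (galois_group L K). g x = x} = K"

definition left_regular :: "('g, 'x) monoid_scheme \<Rightarrow> 'g \<Rightarrow> 'g \<Rightarrow> 'g" where
  "left_regular G g = (\<lambda>x\<in>carrier G. g \<otimes>\<^bsub>G\<^esub> x)"

definition conj_action :: "('g, 'x) monoid_scheme \<Rightarrow> 'g \<Rightarrow> ('g \<Rightarrow> 'g) \<Rightarrow> 'g \<Rightarrow> 'g" where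
  "conj_action G g \<nu> =
    (let P = BijGroup (carrier G)
     in left_regular G g \<otimes>\<^bsub>P\<^esub> \<nu> \<otimes>\<^bsub>P\<^esub> inv\<^bsub>P\<^esub> (left_regular G g))"

text \<open>The action of \<open>G = Gal(L/K)\<close> on \<open>L[M]\<close>, for \<open>M \<subseteq> Perm(G)\<close> normalized by \<open>\<lambda>(G)\<close>:
  \<open>g\<close> sends \<open>\<Sum>\<^sub>\<nu> f(\<nu>) \<nu>\<close> to \<open>\<Sum>\<^sub>\<nu> g(f(\<nu>)) (g \<ast> \<nu>)\<close>, whose coefficient at \<open>\<nu>\<close> is
  \<open>g(f(g\<^sup>-\<^sup>1 \<ast> \<nu>))\<close>.\<close>

definition galois_action ::
  "('l, 'x) ring_scheme \<Rightarrow> 'l set \<Rightarrow> (('l \<Rightarrow> 'l) \<Rightarrow> 'l \<Rightarrow> 'l) set \<Rightarrow> ('l \<Rightarrow> 'l)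
    \<Rightarrow> ((('l \<Rightarrow> 'l) \<Rightarrow> 'l \<Rightarrow> 'l) \<Rightarrow> 'l) \<Rightarrow> (('l \<Rightarrow> 'l) \<Rightarrow> 'l \<Rightarrow> 'l) \<Rightarrow> 'l" where
  "galois_action L K M g f =
    (let G = galois_group L K in (\<lambda>\<nu>\<in>M. g (f (conj_action G (inv\<^bsub>G\<^esub> g) \<nu>))))"

text \<open>The \<open>K\<close>-Hopf algebra \<open>H = L[M]\<^sup>G\<close>. All operations are restrictions of those of \<open>L[M]\<close>; the
  comultiplication of \<open>h\<close> is the element of \<open>H \<otimes>\<^sub>K H\<close> which the (injective) canonical map
  \<open>H \<otimes>\<^sub>K H \<rightarrow> L[M] \<otimes>\<^sub>L L[M]\<close> sends to the comultiplication of \<open>h\<close> in \<open>L[M]\<close>.\<close>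

definition descended_hopf ::
  "('l, 'x) ring_scheme \<Rightarrow> 'l set \<Rightarrow> (('l \<Rightarrow> 'l) \<Rightarrow> 'l \<Rightarrow> 'l) set
    \<Rightarrow> ('l, (('l \<Rightarrow> 'l) \<Rightarrow> 'l \<Rightarrow> 'l) \<Rightarrow> 'l) hopf_alg" where
  "descended_hopf L K M =
    (let G = galois_group L K;
         A = group_algebra L ((BijGroup (carrier G))\<lparr>carrier := M\<rparr>);
         H = A\<lparr>carrier := {f \<in> carrier A. \<forall>g\<in>carrier G. galois_action L K M g f = f}\<rparr>
     in H\<lparr>comult := \<lambda>h. THE t.
            t \<in> carrier (tensor (L\<lparr>carrier := K\<rparr>) H H) \<and>
            tensor_lift (L\<lparr>carrier := K\<rparr>) (tensor L A A) (pure_tensor L A A) t = comult A h\<rparr>)"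


section \<open>The regular subgroups and the Hopf algebras attached to them\<close>

definition right_translation :: "('n, 'y) monoid_scheme \<Rightarrow> 'n \<Rightarrow> 'n \<Rightarrow> 'n" where
  "right_translation N \<eta> = (\<lambda>x\<in>carrier N. x \<otimes>\<^bsub>N\<^esub> inv\<^bsub>N\<^esub> \<eta>)"

text \<open>Extensionality only pins down the irrelevant values outside \<open>carrier G\<close>.\<close>

definition beta_hom ::
  "('g, 'x) monoid_scheme \<Rightarrow> 'g \<Rightarrow> ('n, 'y) monoid_scheme \<Rightarrow> 'n \<Rightarrow> ('n \<Rightarrow> 'n) \<Rightarrow> nat
    \<Rightarrow> 'g \<Rightarrow> 'n \<Rightarrow> 'n" where
  "beta_hom G \<sigma> N \<eta> \<delta> s =
    (let P = BijGroup (carrier N) in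
      THE \<beta>. \<beta> \<in> hom G P \<and> \<beta> \<in> extensional (carrier G) \<and>
          \<beta> \<sigma> = right_translation N \<eta> \<otimes>\<^bsub>P\<^esub> (\<delta> [^]\<^bsub>P\<^esub> s))"

definition b_map :: "('n, 'y) monoid_scheme \<Rightarrow> ('g \<Rightarrow> 'n \<Rightarrow> 'n) \<Rightarrow> 'g \<Rightarrow> 'n" where
  "b_map N \<beta> g = \<beta> g \<one>\<^bsub>N\<^esub>"

definition alpha_map ::
  "('g, 'x) monoid_scheme \<Rightarrow> ('n, 'y) monoid_scheme \<Rightarrow> ('g \<Rightarrow> 'n \<Rightarrow> 'n) \<Rightarrow> 'n \<Rightarrow> 'g \<Rightarrow> 'g" where
  "alpha_map G N \<beta> \<nu> =
    (\<lambda>g\<in>carrier G. inv_into (carrier G) (b_map N \<beta>) (left_regular N \<nu> (b_map N \<beta> g)))"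

definition H_alg ::
  "('l, 'x) ring_scheme \<Rightarrow> 'l set \<Rightarrow> ('l \<Rightarrow> 'l) \<Rightarrow> ('n, 'y) monoid_scheme \<Rightarrow> 'n \<Rightarrow> ('n \<Rightarrow> 'n) \<Rightarrow> nat
    \<Rightarrow> ('l, (('l \<Rightarrow> 'l) \<Rightarrow> 'l \<Rightarrow> 'l) \<Rightarrow> 'l) hopf_alg" where
  "H_alg L K \<sigma> N \<eta> \<delta> s =
    (let G = galois_group L K in
      descended_hopf L K (alpha_map G N (beta_hom G \<sigma> N \<eta> \<delta> s) ` carrier N))"

end

theory Submission
  imports Defs "HOL-Number_Theory.Totient" "HOL-Number_Theory.Residues"
begin

text \<open>Conjugation by \<open>\<lambda>(\<sigma>)\<close> acts on \<open>\<alpha>\<^sub>s(N) \<cong> N\<close> as \<open>\<delta>\<^sup>s\<close>, so \<open>H\<^sub>s\<close> consists of the functions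
  \<open>f : N \<rightarrow> L\<close> with \<open>f \<circ> \<delta>\<^sup>s = \<sigma> \<circ> f\<close>. By Galois descent, \<open>K\<^sub>i \<otimes>\<^sub>K H\<^sub>s\<close> consists of the functions with
  \<open>f \<circ> \<delta>\<^bsup>sp^i\<^esup> = \<sigma>\<^bsup>p^i\<^esup> \<circ> f\<close>. A Hopf algebra isomorphism between two such forms of \<open>L[N]\<close> is given by a
  matrix over \<open>L\<close>; since it respects the group-like elements, it is the permutation matrix of an
  automorphism of \<open>N\<close> that intertwines \<open>\<delta>\<^bsup>rp^i\<^esup>\<close> and \<open>\<delta>\<^bsup>sp^i\<^esup>\<close>. As \<open>Aut(N)\<close> is commutative, these two
  powers coincide, and \<open>\<delta>\<close> has order \<open>p\<^bsup>n-1\<^esup>\<close>.\<close>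

text \<open>The obstacle is that all Hopf algebras here live in quotients of free modules: elements
  of the base change and of its tensor square are cosets, and the comultiplication of
  \<open>H_s\<close> is only given by a definite description. Instead of choosing bases, each module
  is read as a space of twisted functions \<open>Z \<rightarrow> L\<close> by a map
  \<open>kappa\<close>, and its tensor square as a space of functions of two variables by
  \<open>kappa2\<close>. Both maps are injective, so an identity of tensors becomes an identity of
  values in \<open>L\<close>. Behind this stands a dual pair of families v_j, w_j of twisted
  functions with sum_j v_j(x) w_j(y) = 1 for x = y and 0 otherwise, built from the separation of the
  powers of \<sigma> and an element of trace 1. The same families show that an
  \<open>L\<close>-valued functional is determined by its values on the form, so a map of forms is a
  matrix over \<open>L\<close> in which the Hopf axioms can be compared entrywise. The oddness of
  \<open>p\<close> enters through the sum 1 + a + ... + a^(k-1): for a = 1 modulo p it is divisible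
  by the same powers of p as k, and this makes \<open>b_s\<close> bijective.\<close>

lemma additive_zero:
  assumes "abelian_group A" "abelian_group B" "f \<in> carrier A \<rightarrow> carrier B"
    "\<And>x y. \<lbrakk>x \<in> carrier A; y \<in> carrier A\<rbrakk> \<Longrightarrow> f (x \<oplus>\<^bsub>A\<^esub> y) = f x \<oplus>\<^bsub>B\<^esub> f y"
  shows "f \<zero>\<^bsub>A\<^esub> = \<zero>\<^bsub>B\<^esub>"
proof -
  interpret A: abelian_group A by fact
  interpret B: abelian_group B by fact
  have "f \<zero>\<^bsub>A\<^esub> \<oplus>\<^bsub>B\<^esub> f \<zero>\<^bsub>A\<^esub> = f \<zero>\<^bsub>A\<^esub>"
    using assms(4)[of "\<zero>\<^bsub>A\<^esub>" "\<zero>\<^bsub>A\<^esub>"] by simp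
  moreover have "f \<zero>\<^bsub>A\<^esub> \<in> carrier B" using assms(3) by auto
  ultimately show ?thesis by (metis B.add.r_cancel_one')
qed

lemma additive_finsum:
  assumes "abelian_group A" "abelian_group B" "f \<in> carrier A \<rightarrow> carrier B"
    "\<And>x y. \<lbrakk>x \<in> carrier A; y \<in> carrier A\<rbrakk> \<Longrightarrow> f (x \<oplus>\<^bsub>A\<^esub> y) = f x \<oplus>\<^bsub>B\<^esub> f y"
    and g: "g \<in> I \<rightarrow> carrier A"
  shows "f (\<Oplus>\<^bsub>A\<^esub>i\<in>I. g i) = (\<Oplus>\<^bsub>B\<^esub>i\<in>I. f (g i))"
proof -
  interpret A: abelian_group A by fact
  interpret B: abelian_group B by fact
  have z: "f \<zero>\<^bsub>A\<^esub> = \<zero>\<^bsub>B\<^esub>" using additive_zero[OF assms(1-4)] by blast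
  show ?thesis using g
  proof (induction I rule: infinite_finite_induct)
    case (insert x I)
    have "g x \<in> carrier A" "g \<in> I \<rightarrow> carrier A" using insert.prems by auto
    moreover have "f (g x) \<in> carrier B" "(\<lambda>i. f (g i)) \<in> I \<rightarrow> carrier B"
      using insert.prems assms(3) by auto
    ultimately show ?case using insert assms(4) by simp
  qed (simp_all add: z)
qed

section \<open>Universal property of the tensor product\<close>

lemma free_module_sel [simp]:
  "carrier (free_module R S) =
    {f. (\<forall>z. f z \<in> carrier R) \<and> (\<forall>z. z \<notin> S \<longrightarrow> f z = \<zero>\<^bsub>R\<^esub>) \<and> finite {z. f z \<noteq> \<zero>\<^bsub>R\<^esub>}}"
  "\<zero>\<^bsub>free_module R S\<^esub> = (\<lambda>z. \<zero>\<^bsub>R\<^esub>)"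
  "f \<oplus>\<^bsub>free_module R S\<^esub> g = (\<lambda>z. f z \<oplus>\<^bsub>R\<^esub> g z)"
  "c \<odot>\<^bsub>free_module R S\<^esub> f = (\<lambda>z. c \<otimes>\<^bsub>R\<^esub> f z)"
  by (simp_all add: free_module_def)

lemma (in cring) module_free_module: "module R (free_module R S)"
proof (rule moduleI)
  show "cring R" by (rule is_cring)
  have fin: "finite {z. f z \<oplus> g z \<noteq> \<zero>}"
    if "finite {z. f z \<noteq> \<zero>}" "finite {z. g z \<noteq> \<zero>}" for f g :: "'s \<Rightarrow> 'a"
    by (rule finite_subset[of _ "{z. f z \<noteq> \<zero>} \<union> {z. g z \<noteq> \<zero>}"]) (use that in auto)
  show "abelian_group (free_module R S)"
  proof (rule abelian_groupI)
    fix f assume f: "f \<in> carrier (free_module R S)"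
    have "{z. \<ominus> f z \<noteq> \<zero>} = {z. f z \<noteq> \<zero>}" using f by auto
    then show "\<exists>g\<in>carrier (free_module R S). g \<oplus>\<^bsub>free_module R S\<^esub> f = \<zero>\<^bsub>free_module R S\<^esub>"
      using f by (intro bexI[of _ "\<lambda>z. \<ominus> f z"]) (auto simp: l_neg)
  qed (use fin in \<open>auto simp: a_ac\<close>)
next
  fix c f assume *: "c \<in> carrier R" "f \<in> carrier (free_module R S)"
  have "finite {z. c \<otimes> f z \<noteq> \<zero>}"
    by (rule finite_subset[of _ "{z. f z \<noteq> \<zero>}"]) (use * in auto)
  then show "c \<odot>\<^bsub>free_module R S\<^esub> f \<in> carrier (free_module R S)"
    using * by auto
qed (auto simp: l_distr r_distr m_assoc)

definition bilinear_map ::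
  "('r, 'x) ring_scheme \<Rightarrow> ('r, 'a, 'y) module_scheme \<Rightarrow> ('r, 'b, 'z) module_scheme
    \<Rightarrow> ('r, 'p, 'w) module_scheme \<Rightarrow> ('a \<Rightarrow> 'b \<Rightarrow> 'p) \<Rightarrow> bool" where
  "bilinear_map R M N P \<beta> \<longleftrightarrow>
    (\<forall>a\<in>carrier M. \<forall>b\<in>carrier N. \<beta> a b \<in> carrier P) \<and>
    (\<forall>a\<in>carrier M. \<forall>a'\<in>carrier M. \<forall>b\<in>carrier N. \<beta> (a \<oplus>\<^bsub>M\<^esub> a') b = \<beta> a b \<oplus>\<^bsub>P\<^esub> \<beta> a' b) \<and>
    (\<forall>a\<in>carrier M. \<forall>b\<in>carrier N. \<forall>b'\<in>carrier N. \<beta> a (b \<oplus>\<^bsub>N\<^esub> b') = \<beta> a b \<oplus>\<^bsub>P\<^esub> \<beta> a b') \<and>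
    (\<forall>c\<in>carrier R. \<forall>a\<in>carrier M. \<forall>b\<in>carrier N. \<beta> (c \<odot>\<^bsub>M\<^esub> a) b = c \<odot>\<^bsub>P\<^esub> \<beta> a b) \<and>
    (\<forall>c\<in>carrier R. \<forall>a\<in>carrier M. \<forall>b\<in>carrier N. \<beta> a (c \<odot>\<^bsub>N\<^esub> b) = c \<odot>\<^bsub>P\<^esub> \<beta> a b)"

section \<open>The tensor product as a module, and induction over its pure tensors\<close>

locale module_pair =
  fixes R (structure) and M N
  assumes module_fst: "module R M" and module_snd: "module R N"
begin

sublocale M: module R M by (rule module_fst)
sublocale N: module R N by (rule module_snd)

abbreviation "F \<equiv> free_module R (carrier M \<times> carrier N)"
abbreviation "U \<equiv> tensor_rel R M N"
abbreviation "T \<equiv> tensor R M N"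
abbreviation "pt \<equiv> pure_tensor R M N"
abbreviation "coset \<equiv> \<lambda>f. U +>\<^bsub>F\<^esub> f"

sublocale F: module R F by (rule M.module_free_module)

lemma free_value: "f \<in> carrier F \<Longrightarrow> f z \<in> carrier R"
  by (cases z) auto

lemma free_basis_closed:
  "a \<in> carrier M \<Longrightarrow> b \<in> carrier N \<Longrightarrow> free_basis R (a, b) \<in> carrier F"
  by (auto simp: free_basis_def)

lemma tensor_gens_closed: "tensor_gens R M N \<subseteq> carrier F"
  unfolding tensor_gens_def Let_def
  by (auto simp del: free_module_sel
      intro!: F.minus_closed F.add.m_closed F.smult_closed free_basis_closed)

lemma submodule_tensor_rel: "submodule U R F"
proof -
  \<comment> \<open>The family must be seen to be nonempty: an empty intersection would be the whole
    type and no submodule of \<open>F\<close>.\<close>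
  have ne: "carrier F \<in> {V. submodule V R F \<and> tensor_gens R M N \<subseteq> V}"
    using F.carrier_is_submodule tensor_gens_closed by blast
  show ?thesis
    unfolding tensor_rel_def
  proof (rule F.submoduleI, goal_cases)
    case 1 then show ?case using ne by blast
  next
    case 2 then show ?case
      using submodule.axioms(1) subgroup.one_closed by fastforce
  qed (auto intro: F.submoduleE(3,5) submodule.smult_closed simp del: free_module_sel)
qed

lemma tensor_gens_rel: "tensor_gens R M N \<subseteq> U"
  unfolding tensor_rel_def by blast

sublocale U: abelian_subgroup U F
  by (rule abelian_subgroupI3)
    (auto intro: additive_subgroupI submodule.axioms(1)[OF submodule_tensor_rel] F.M.abelian_group_axioms)

lemma tensor_sel:
  "carrier T = coset ` carrier F" "\<zero>\<^bsub>T\<^esub> = U" "t \<oplus>\<^bsub>T\<^esub> u = t <+>\<^bsub>F\<^esub> u"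
  "c \<odot>\<^bsub>T\<^esub> t = (\<Union>f\<in>t. coset (c \<odot>\<^bsub>F\<^esub> f))"
  by (auto simp: tensor_def Let_def A_RCOSETS_def' )

lemma coset_eqI:
  assumes "f \<in> carrier F" "g \<in> carrier F" "f \<ominus>\<^bsub>F\<^esub> g \<in> U"
  shows "coset f = coset g"
proof -
  have "f \<in> coset g"
    using U.a_rcos_module[OF assms(2,1)] assms(3) by (simp add: a_minus_def del: free_module_sel)
  then show ?thesis using F.a_repr_independence[OF _ assms(2) U.a_subgroup] by simp
qed

lemma coset_closed: "f \<in> carrier F \<Longrightarrow> coset f \<in> carrier T"
  by (simp add: tensor_sel del: free_module_sel)

lemma coset_add:
  "f \<in> carrier F \<Longrightarrow> g \<in> carrier F \<Longrightarrow> coset f \<oplus>\<^bsub>T\<^esub> coset g = coset (f \<oplus>\<^bsub>F\<^esub> g)"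
  by (simp add: tensor_sel U.a_rcos_sum del: free_module_sel)

text \<open>The scalar multiplication of the quotient is a union over all representatives of the
  coset; since they differ by elements of the submodule \<open>U\<close>, the union collapses to a
  single coset.\<close>

lemma coset_smult:
  assumes c: "c \<in> carrier R" and f: "f \<in> carrier F"
  shows "c \<odot>\<^bsub>T\<^esub> coset f = coset (c \<odot>\<^bsub>F\<^esub> f)"
proof -
  have "coset (c \<odot>\<^bsub>F\<^esub> g) = coset (c \<odot>\<^bsub>F\<^esub> f)" if g: "g \<in> coset f" for g
  proof -
    have gF: "g \<in> carrier F" using U.a_elemrcos_carrier[OF f g] .
    have "g \<oplus>\<^bsub>F\<^esub> \<ominus>\<^bsub>F\<^esub> f \<in> U" using U.a_rcos_module[OF f gF] g by simp
    then have "c \<odot>\<^bsub>F\<^esub> (g \<oplus>\<^bsub>F\<^esub> \<ominus>\<^bsub>F\<^esub> f) \<in> U"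
      using submodule.smult_closed[OF submodule_tensor_rel] c by blast
    then have "c \<odot>\<^bsub>F\<^esub> g \<ominus>\<^bsub>F\<^esub> c \<odot>\<^bsub>F\<^esub> f \<in> U"
      using f gF c by (simp add: a_minus_def F.smult_r_distr F.smult_r_minus del: free_module_sel)
    then show ?thesis using coset_eqI f gF c by (simp del: free_module_sel)
  qed
  moreover have "coset f \<noteq> {}" using U.a_rcos_self[OF f] by blast
  ultimately show ?thesis by (auto simp: tensor_sel simp del: free_module_sel)
qed

lemma coset_zero: "coset \<zero>\<^bsub>F\<^esub> = \<zero>\<^bsub>T\<^esub>"
  by (simp add: tensor_sel U.a_subset del: free_module_sel)

lemma tensorE:
  assumes "t \<in> carrier T"
  obtains f where "f \<in> carrier F" "t = coset f"
  using assms by (auto simp: tensor_sel simp del: free_module_sel)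

lemma module_tensor: "module R T"
proof (rule moduleI)
  show "abelian_group T"
  proof (rule abelian_groupI)
    fix t assume "t \<in> carrier T"
    then obtain f where f: "f \<in> carrier F" "t = coset f" by (rule tensorE)
    then show "\<exists>u\<in>carrier T. u \<oplus>\<^bsub>T\<^esub> t = \<zero>\<^bsub>T\<^esub>"
      by (intro bexI[of _ "coset (\<ominus>\<^bsub>F\<^esub> f)"])
        (simp_all add: coset_add coset_closed F.M.l_neg coset_zero del: free_module_sel)
    show "\<zero>\<^bsub>T\<^esub> \<oplus>\<^bsub>T\<^esub> t = t"
      using f by (simp add: coset_add flip: coset_zero del: free_module_sel)
  next
    show "\<zero>\<^bsub>T\<^esub> \<in> carrier T" by (simp add: coset_closed flip: coset_zero del: free_module_sel)
  qed (auto elim!: tensorE simp add: coset_add coset_closed F.M.a_ac simp del: free_module_sel)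
qed (auto elim!: tensorE simp add: coset_add coset_smult coset_closed F.smult_l_distr F.smult_r_distr
    F.smult_assoc1 M.is_cring simp del: free_module_sel)

sublocale T: module R T by (rule module_tensor)

lemma pure_closed: "a \<in> carrier M \<Longrightarrow> b \<in> carrier N \<Longrightarrow> pt a b \<in> carrier T"
  unfolding pure_tensor_def by (intro coset_closed free_basis_closed)

lemma pure_add_left:
  assumes "a \<in> carrier M" "a' \<in> carrier M" "b \<in> carrier N"
  shows "pt (a \<oplus>\<^bsub>M\<^esub> a') b = pt a b \<oplus>\<^bsub>T\<^esub> pt a' b"
proof -
  have "free_basis R (a \<oplus>\<^bsub>M\<^esub> a', b) \<ominus>\<^bsub>F\<^esub> (free_basis R (a, b) \<oplus>\<^bsub>F\<^esub> free_basis R (a', b)) \<in> U"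
    using tensor_gens_rel assms unfolding tensor_gens_def Let_def by blast
  then show ?thesis
    using assms unfolding pure_tensor_def
    by (subst coset_add) (simp_all add: coset_eqI free_basis_closed del: free_module_sel)
qed

lemma pure_add_right:
  assumes "a \<in> carrier M" "b \<in> carrier N" "b' \<in> carrier N"
  shows "pt a (b \<oplus>\<^bsub>N\<^esub> b') = pt a b \<oplus>\<^bsub>T\<^esub> pt a b'"
proof -
  have "free_basis R (a, b \<oplus>\<^bsub>N\<^esub> b') \<ominus>\<^bsub>F\<^esub> (free_basis R (a, b) \<oplus>\<^bsub>F\<^esub> free_basis R (a, b')) \<in> U"
    using tensor_gens_rel assms unfolding tensor_gens_def Let_def by blast
  then show ?thesis
    using assms unfolding pure_tensor_def
    by (subst coset_add) (simp_all add: coset_eqI free_basis_closed del: free_module_sel)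
qed

lemma pure_smult_left:
  assumes "c \<in> carrier R" "a \<in> carrier M" "b \<in> carrier N"
  shows "pt (c \<odot>\<^bsub>M\<^esub> a) b = c \<odot>\<^bsub>T\<^esub> pt a b"
proof -
  have "free_basis R (c \<odot>\<^bsub>M\<^esub> a, b) \<ominus>\<^bsub>F\<^esub> (c \<odot>\<^bsub>F\<^esub> free_basis R (a, b)) \<in> U"
    using tensor_gens_rel assms unfolding tensor_gens_def Let_def by blast
  then show ?thesis
    using assms unfolding pure_tensor_def
    by (subst coset_smult) (simp_all add: coset_eqI free_basis_closed del: free_module_sel)
qed

lemma pure_smult_right:
  assumes "c \<in> carrier R" "a \<in> carrier M" "b \<in> carrier N"
  shows "pt a (c \<odot>\<^bsub>N\<^esub> b) = c \<odot>\<^bsub>T\<^esub> pt a b"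
proof -
  have "free_basis R (a, c \<odot>\<^bsub>N\<^esub> b) \<ominus>\<^bsub>F\<^esub> (c \<odot>\<^bsub>F\<^esub> free_basis R (a, b)) \<in> U"
    using tensor_gens_rel assms unfolding tensor_gens_def Let_def by blast
  then show ?thesis
    using assms unfolding pure_tensor_def
    by (subst coset_smult) (simp_all add: coset_eqI free_basis_closed del: free_module_sel)
qed

lemma bilinear_map_pure: "bilinear_map R M N T pt"
  by (simp add: bilinear_map_def pure_closed pure_add_left pure_add_right pure_smult_left
      pure_smult_right)

text \<open>Induction on the size of the support of a representative. Removing one point splits off
  a term c (a \<otimes> b) = (c a) \<otimes> b, which is again pure; hence no case for scalar
  multiples.\<close>

lemma tensor_induct [consumes 1, case_names zero pure add]:
  assumes t: "t \<in> carrier T"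
    and zero: "P \<zero>\<^bsub>T\<^esub>"
    and pure: "\<And>a b. a \<in> carrier M \<Longrightarrow> b \<in> carrier N \<Longrightarrow> P (pt a b)"
    and add: "\<And>t u. t \<in> carrier T \<Longrightarrow> u \<in> carrier T \<Longrightarrow> P t \<Longrightarrow> P u \<Longrightarrow> P (t \<oplus>\<^bsub>T\<^esub> u)"
  shows "P t"
proof -
  have "P (coset f)" if "f \<in> carrier F" "card {z. f z \<noteq> \<zero>} = k" for f k
    using that
  proof (induction k arbitrary: f)
    case 0
    then have "f = \<zero>\<^bsub>F\<^esub>" by auto
    then show ?case using zero coset_zero by simp
  next
    case (Suc k)
    then obtain z where z: "f z \<noteq> \<zero>" by (metis (mono_tags, lifting) card.empty empty_Collect_eq nat.distinct(1))
    then obtain a b where ab: "z = (a, b)" "a \<in> carrier M" "b \<in> carrier N"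
      using Suc.prems(1) by (cases z) auto
    define g where "g = f(z := \<zero>)"
    have supp: "{w. g w \<noteq> \<zero>} = {w. f w \<noteq> \<zero>} - {z}" by (auto simp: g_def)
    then have g: "g \<in> carrier F" using Suc.prems(1) by (auto simp: g_def)
    have "card {w. g w \<noteq> \<zero>} = k" using supp Suc.prems z by simp
    then have Pg: "P (coset g)" using Suc.IH g by blast
    have fz: "f z \<in> carrier R" using Suc.prems(1) by (rule free_value)
    have "f = g \<oplus>\<^bsub>F\<^esub> f z \<odot>\<^bsub>F\<^esub> free_basis R z"
      using free_value[OF Suc.prems(1)] by (auto simp: g_def free_basis_def fun_eq_iff)
    moreover have "coset (g \<oplus>\<^bsub>F\<^esub> f z \<odot>\<^bsub>F\<^esub> free_basis R z) = coset g \<oplus>\<^bsub>T\<^esub> f z \<odot>\<^bsub>T\<^esub> pt a b"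
      unfolding pure_tensor_def using g fz ab free_basis_closed[OF ab(2,3)]
      by (simp add: coset_add coset_smult del: free_module_sel)
    moreover have "f z \<odot>\<^bsub>T\<^esub> pt a b = pt (f z \<odot>\<^bsub>M\<^esub> a) b"
      using pure_smult_left fz ab by simp
    ultimately show ?case
      using add[OF coset_closed[OF g] _ Pg pure] ab fz pure_closed by simp
  qed
  then show ?thesis using tensorE[OF t] by metis
qed

section \<open>Linear maps induced by bilinear maps\<close>

context
  fixes P :: "('a, 'p, 'w) module_scheme" and \<beta>
  assumes P: "module R P" and \<beta>: "bilinear_map R M N P \<beta>"
begin

interpretation P: module R P by (rule P)

private definition "lin f = (\<Oplus>\<^bsub>P\<^esub>z\<in>{z. f z \<noteq> \<zero>}. f z \<odot>\<^bsub>P\<^esub> \<beta> (fst z) (snd z))"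

private lemma term_closed:
  "z \<in> carrier M \<times> carrier N \<Longrightarrow> c \<in> carrier R \<Longrightarrow> c \<odot>\<^bsub>P\<^esub> \<beta> (fst z) (snd z) \<in> carrier P"
  using \<beta> by (auto simp: bilinear_map_def)

text \<open>The supports of \<open>f\<close>, \<open>g\<close> and their sum differ; a common finite
  index set makes their sums comparable.\<close>

private lemma lin_superset:
  assumes f: "f \<in> carrier F" and S: "finite S" "S \<subseteq> carrier M \<times> carrier N" "{z. f z \<noteq> \<zero>} \<subseteq> S"
  shows "lin f = (\<Oplus>\<^bsub>P\<^esub>z\<in>S. f z \<odot>\<^bsub>P\<^esub> \<beta> (fst z) (snd z))"
  unfolding lin_def
proof (rule P.add.finprod_mono_neutral_cong_left[OF S(1,3)])
  fix z assume "z \<in> S - {z. f z \<noteq> \<zero>}"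
  then have "f z = \<zero>" "z \<in> carrier M \<times> carrier N" using S by auto
  then show "f z \<odot>\<^bsub>P\<^esub> \<beta> (fst z) (snd z) = \<zero>\<^bsub>P\<^esub>"
    using \<beta> by (auto simp: bilinear_map_def)
qed (use S f in \<open>auto intro!: term_closed\<close>)

private lemma lin_closed: "f \<in> carrier F \<Longrightarrow> lin f \<in> carrier P"
  unfolding lin_def by (rule P.finsum_closed) (auto intro!: term_closed)

private lemma lin_add:
  assumes "f \<in> carrier F" "g \<in> carrier F"
  shows "lin (f \<oplus>\<^bsub>F\<^esub> g) = lin f \<oplus>\<^bsub>P\<^esub> lin g"
proof -
  let ?S = "{z. f z \<noteq> \<zero>} \<union> {z. g z \<noteq> \<zero>}"
  let ?t = "\<lambda>f z. f z \<odot>\<^bsub>P\<^esub> \<beta> (fst z) (snd z)"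
  have S: "finite ?S" "?S \<subseteq> carrier M \<times> carrier N" using assms by auto
  have "lin (f \<oplus>\<^bsub>F\<^esub> g) = finsum P (?t (f \<oplus>\<^bsub>F\<^esub> g)) ?S"
    using assms S F.a_closed[OF assms] by (intro lin_superset) auto
  also have "\<dots> = (\<Oplus>\<^bsub>P\<^esub>z\<in>?S. ?t f z \<oplus>\<^bsub>P\<^esub> ?t g z)"
  proof (rule P.finsum_cong')
    show "(\<lambda>z. ?t f z \<oplus>\<^bsub>P\<^esub> ?t g z) \<in> ?S \<rightarrow> carrier P"
      using assms S by (intro Pi_I P.a_closed term_closed) auto
    fix z assume "z \<in> ?S"
    then have "\<beta> (fst z) (snd z) \<in> carrier P" using S(2) \<beta> by (auto simp: bilinear_map_def)
    then show "?t (f \<oplus>\<^bsub>F\<^esub> g) z = ?t f z \<oplus>\<^bsub>P\<^esub> ?t g z"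
      using free_value[OF assms(1), of z] free_value[OF assms(2), of z] by (simp add: P.smult_l_distr)
  qed simp
  also have "\<dots> = finsum P (?t f) ?S \<oplus>\<^bsub>P\<^esub> finsum P (?t g) ?S"
    using assms S by (intro P.finsum_addf Pi_I term_closed) auto
  also have "\<dots> = lin f \<oplus>\<^bsub>P\<^esub> lin g"
    using assms S by (subst (1 2) lin_superset[of _ ?S]) auto
  finally show ?thesis .
qed

private lemma lin_smult:
  assumes "c \<in> carrier R" "f \<in> carrier F"
  shows "lin (c \<odot>\<^bsub>F\<^esub> f) = c \<odot>\<^bsub>P\<^esub> lin f"
proof -
  let ?S = "{z. f z \<noteq> \<zero>}"
  let ?t = "\<lambda>f z. f z \<odot>\<^bsub>P\<^esub> \<beta> (fst z) (snd z)"
  have S: "finite ?S" "?S \<subseteq> carrier M \<times> carrier N" using assms by auto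
  have "lin (c \<odot>\<^bsub>F\<^esub> f) = finsum P (?t (c \<odot>\<^bsub>F\<^esub> f)) ?S"
    using assms S F.smult_closed[OF assms] by (intro lin_superset) auto
  also have "\<dots> = (\<Oplus>\<^bsub>P\<^esub>z\<in>?S. c \<odot>\<^bsub>P\<^esub> ?t f z)"
  proof (rule P.finsum_cong')
    show "(\<lambda>z. c \<odot>\<^bsub>P\<^esub> ?t f z) \<in> ?S \<rightarrow> carrier P"
      using assms S by (intro Pi_I P.smult_closed term_closed) auto
    fix z assume "z \<in> ?S"
    then have "\<beta> (fst z) (snd z) \<in> carrier P" using S(2) \<beta> by (auto simp: bilinear_map_def)
    then show "?t (c \<odot>\<^bsub>F\<^esub> f) z = c \<odot>\<^bsub>P\<^esub> ?t f z"
      using assms free_value[of f z] by (simp add: P.smult_assoc1)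
  qed simp
  also have "\<dots> = c \<odot>\<^bsub>P\<^esub> lin f"
    unfolding lin_def using assms S
    by (intro P.finsum_smult_ldistr[symmetric] Pi_I term_closed) auto
  finally show ?thesis .
qed

private lemma lin_free_basis:
  assumes "a \<in> carrier M" "b \<in> carrier N"
  shows "lin (free_basis R (a, b)) = \<beta> a b"
proof -
  have "lin (free_basis R (a, b)) =
      (\<Oplus>\<^bsub>P\<^esub>z\<in>{(a, b)}. free_basis R (a, b) z \<odot>\<^bsub>P\<^esub> \<beta> (fst z) (snd z))"
    using assms free_basis_closed by (intro lin_superset) (auto simp: free_basis_def)
  also have "\<dots> = \<beta> a b"
    using assms \<beta> by (simp add: free_basis_def bilinear_map_def)
  finally show ?thesis .
qed

private lemma lin_minus:
  assumes "f \<in> carrier F" "g \<in> carrier F" "lin f = lin g"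
  shows "lin (f \<ominus>\<^bsub>F\<^esub> g) = \<zero>\<^bsub>P\<^esub>"
proof -
  have "lin (f \<ominus>\<^bsub>F\<^esub> g) \<oplus>\<^bsub>P\<^esub> lin g = lin g"
    using assms lin_add[of "f \<ominus>\<^bsub>F\<^esub> g" g]
    by (simp add: a_minus_def F.M.add.m_assoc F.M.l_neg del: free_module_sel)
  then have "lin (f \<ominus>\<^bsub>F\<^esub> g) \<oplus>\<^bsub>P\<^esub> lin g = \<zero>\<^bsub>P\<^esub> \<oplus>\<^bsub>P\<^esub> lin g"
    using lin_closed[OF assms(2)] by simp
  then show ?thesis
    using lin_closed[OF F.minus_closed[OF assms(1,2)]] lin_closed[OF assms(2)]
    by (simp del: free_module_sel P.l_zero)
qed

text \<open>The kernel of \<open>lin\<close> is a submodule containing the generators, by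
  bilinearity, and \<open>U\<close> is the least such submodule.\<close>

private lemma lin_rel: "f \<in> U \<Longrightarrow> lin f = \<zero>\<^bsub>P\<^esub>"
proof -
  let ?V = "{f \<in> carrier F. lin f = \<zero>\<^bsub>P\<^esub>}"
  have z: "lin \<zero>\<^bsub>F\<^esub> = \<zero>\<^bsub>P\<^esub>" by (simp add: lin_def)
  have "submodule ?V R F"
  proof (rule F.submoduleI)
    fix f assume "f \<in> ?V"
    then show "\<ominus>\<^bsub>F\<^esub> f \<in> ?V"
      using lin_minus[of "\<zero>\<^bsub>F\<^esub>" f] z by (simp add: a_minus_def del: free_module_sel)
  qed (use z in \<open>auto simp: lin_add lin_smult simp del: free_module_sel\<close>)
  moreover have "tensor_gens R M N \<subseteq> ?V"
    using \<beta> unfolding tensor_gens_def Let_def bilinear_map_def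
    by (auto intro!: lin_minus F.minus_closed free_basis_closed
        simp: lin_add lin_smult lin_free_basis free_basis_closed simp del: free_module_sel)
  ultimately show "f \<in> U \<Longrightarrow> lin f = \<zero>\<^bsub>P\<^esub>"
    unfolding tensor_rel_def by blast
qed

text \<open>Because \<open>lin\<close> vanishes on \<open>U\<close> it is constant on cosets, so the
  image in the definition of \<open>tensor_lift\<close> is a singleton and \<open>the_elem\<close>
  returns its element.\<close>

private lemma tensor_lift_coset:
  assumes f: "f \<in> carrier F"
  shows "tensor_lift R P \<beta> (coset f) = lin f"
proof -
  have "lin g = lin f" if g: "g \<in> coset f" for g
  proof -
    have gF: "g \<in> carrier F" using U.a_elemrcos_carrier[OF f g] .
    have u: "g \<oplus>\<^bsub>F\<^esub> \<ominus>\<^bsub>F\<^esub> f \<in> U" using U.a_rcos_module[OF f gF] g by simp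
    have "lin g = lin ((g \<oplus>\<^bsub>F\<^esub> \<ominus>\<^bsub>F\<^esub> f) \<oplus>\<^bsub>F\<^esub> f)"
      using f gF by (simp add: F.M.add.m_assoc F.M.l_neg del: free_module_sel)
    then show ?thesis
      using f gF lin_rel[OF u] lin_closed by (simp add: lin_add del: free_module_sel)
  qed
  then have "lin ` coset f = (\<lambda>_. lin f) ` coset f" by (intro image_cong refl)
  also have "\<dots> = {lin f}" using U.a_rcos_self[OF f] by (auto simp del: free_module_sel)
  finally show ?thesis by (simp add: tensor_lift_def lin_def[abs_def])
qed

lemma tensor_lift_closed: "t \<in> carrier T \<Longrightarrow> tensor_lift R P \<beta> t \<in> carrier P"
  by (elim tensorE) (simp add: tensor_lift_coset lin_closed del: free_module_sel)

lemma tensor_lift_add: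
  "t \<in> carrier T \<Longrightarrow> u \<in> carrier T \<Longrightarrow>
    tensor_lift R P \<beta> (t \<oplus>\<^bsub>T\<^esub> u) = tensor_lift R P \<beta> t \<oplus>\<^bsub>P\<^esub> tensor_lift R P \<beta> u"
  by (elim tensorE) (simp add: tensor_lift_coset coset_add lin_add del: free_module_sel)

lemma tensor_lift_smult:
  "c \<in> carrier R \<Longrightarrow> t \<in> carrier T \<Longrightarrow>
    tensor_lift R P \<beta> (c \<odot>\<^bsub>T\<^esub> t) = c \<odot>\<^bsub>P\<^esub> tensor_lift R P \<beta> t"
  by (elim tensorE) (simp add: tensor_lift_coset coset_smult lin_smult del: free_module_sel)

lemma tensor_lift_pure:
  "a \<in> carrier M \<Longrightarrow> b \<in> carrier N \<Longrightarrow> tensor_lift R P \<beta> (pt a b) = \<beta> a b"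
  unfolding pure_tensor_def
  by (simp add: tensor_lift_coset free_basis_closed lin_free_basis del: free_module_sel)

lemma tensor_lift_zero: "tensor_lift R P \<beta> \<zero>\<^bsub>T\<^esub> = \<zero>\<^bsub>P\<^esub>"
  by (rule additive_zero[OF T.M.abelian_group_axioms P.M.abelian_group_axioms])
    (auto intro: tensor_lift_closed tensor_lift_add)

lemma tensor_lift_finsum:
  "g \<in> I \<rightarrow> carrier T \<Longrightarrow>
    tensor_lift R P \<beta> (\<Oplus>\<^bsub>T\<^esub>i\<in>I. g i) = (\<Oplus>\<^bsub>P\<^esub>i\<in>I. tensor_lift R P \<beta> (g i))"
  by (rule additive_finsum[OF T.M.abelian_group_axioms P.M.abelian_group_axioms])
    (auto intro: tensor_lift_closed tensor_lift_add)

end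

end

section \<open>Finite sums\<close>

context abelian_monoid begin

lemma finsum_swap:
  assumes "finite A" "finite B" "\<And>i j. \<lbrakk>i \<in> A; j \<in> B\<rbrakk> \<Longrightarrow> f i j \<in> carrier G"
  shows "(\<Oplus>i\<in>A. \<Oplus>j\<in>B. f i j) = (\<Oplus>j\<in>B. \<Oplus>i\<in>A. f i j)"
  using assms(1,3)
proof (induction A rule: finite_induct)
  case empty
  then show ?case by simp
next
  case (insert x A)
  have "(\<Oplus>i\<in>insert x A. \<Oplus>j\<in>B. f i j) = (\<Oplus>j\<in>B. f x j) \<oplus> (\<Oplus>i\<in>A. \<Oplus>j\<in>B. f i j)"
    using insert by (intro finsum_insert) (auto intro!: finsum_closed)
  also have "\<dots> = (\<Oplus>j\<in>B. f x j) \<oplus> (\<Oplus>j\<in>B. \<Oplus>i\<in>A. f i j)"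
    using insert by simp
  also have "\<dots> = (\<Oplus>j\<in>B. f x j \<oplus> (\<Oplus>i\<in>A. f i j))"
    using insert by (intro finsum_addf[symmetric]) (auto intro!: finsum_closed)
  also have "\<dots> = (\<Oplus>j\<in>B. \<Oplus>i\<in>insert x A. f i j)"
    using insert by (intro finsum_cong') (auto intro!: finsum_closed)
  finally show ?case .
qed

lemma finsum_lessThan_Suc_shift:
  "f \<in> {..<Suc m} \<rightarrow> carrier G \<Longrightarrow> (\<Oplus>k\<in>{..<Suc m}. f k) = f 0 \<oplus> (\<Oplus>k\<in>{..<m}. f (Suc k))"
proof (induction m)
  case (Suc m)
  have c: "f i \<in> carrier G" if "i < Suc (Suc m)" for i using Suc.prems that by auto
  have "(\<Oplus>k\<in>{..<Suc (Suc m)}. f k) = f (Suc m) \<oplus> (\<Oplus>k\<in>{..<Suc m}. f k)"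
    using c by (subst lessThan_Suc) (auto intro!: finsum_insert simp del: lessThan_Suc)
  also have "\<dots> = f (Suc m) \<oplus> (f 0 \<oplus> (\<Oplus>k\<in>{..<m}. f (Suc k)))"
    using Suc.IH c by (auto simp: Pi_def simp del: lessThan_Suc)
  also have "\<dots> = f 0 \<oplus> (f (Suc m) \<oplus> (\<Oplus>k\<in>{..<m}. f (Suc k)))"
    using c by (intro a_lcomm) (auto intro!: finsum_closed)
  also have "f (Suc m) \<oplus> (\<Oplus>k\<in>{..<m}. f (Suc k)) = (\<Oplus>k\<in>{..<Suc m}. f (Suc k))"
    using c by (subst lessThan_Suc) (auto intro!: finsum_insert[symmetric] simp del: lessThan_Suc)
  finally show ?case .
qed (simp add: lessThan_Suc Pi_def)

end

text \<open>The source of all invariance below: applying the generator to a sum over a cyclic group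
  shifts the exponents by one, and the last term takes the place of the first.\<close>

lemma (in abelian_group) finsum_cyclic_shift:
  assumes "f \<in> {..m} \<rightarrow> carrier G" "f m = f 0"
  shows "(\<Oplus>k\<in>{..<m}. f (Suc k)) = (\<Oplus>k\<in>{..<m}. f k)"
proof -
  have c: "f i \<in> carrier G" if "i \<le> m" for i using assms that by auto
  have "f 0 \<oplus> (\<Oplus>k\<in>{..<m}. f (Suc k)) = (\<Oplus>k\<in>{..<Suc m}. f k)"
    using c by (intro finsum_lessThan_Suc_shift[symmetric]) auto
  also have "\<dots> = f m \<oplus> (\<Oplus>k\<in>{..<m}. f k)"
    using c by (subst lessThan_Suc) (auto intro!: finsum_insert simp del: lessThan_Suc)
  finally show ?thesis
    using assms(2) c by (subst (asm) add.l_cancel) (auto intro!: finsum_closed)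
qed

lemma (in abelian_monoid) finsum_delta:
  assumes "finite A" "a \<in> A" "f a \<in> carrier G"
  shows "(\<Oplus>i\<in>A. if i = a then f i else \<zero>) = f a"
proof -
  have "(\<Oplus>i\<in>A. if i = a then f i else \<zero>) = (\<Oplus>i\<in>A. if i = a then f a else \<zero>)"
    using assms by (intro finsum_cong') auto
  also have "\<dots> = f a"
    using add.finprod_singleton_swap[of a A "\<lambda>_. f a"] assms by auto
  finally show ?thesis .
qed

lemma (in ring) subring_finsum_closed:
  assumes "subring F R" "f \<in> A \<rightarrow> F"
  shows "finsum R f A \<in> F"
  using assms(2)
proof (induction A rule: infinite_finite_induct)
  case (insert x A)
  moreover have "f x \<in> carrier R" "f \<in> A \<rightarrow> carrier R"
    using insert subringE(1)[OF assms(1)] by auto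
  ultimately show ?case using subringE(7)[OF assms(1)] by simp
qed (use subringE(2)[OF assms(1)] in auto)

section \<open>Linear independence of automorphisms\<close>

text \<open>Gaussian elimination, one equation and one unknown at a time: if the last equation has a
  nonzero coefficient at \<open>z\<close>, subtracting multiples of \<open>v z\<close> from the
  other vectors kills their last coordinates. All divisions take place in \<open>F\<close>, so the
  solution stays in \<open>F\<close>.\<close>

lemma (in field) homogeneous_system_nontrivial_solution:
  assumes F: "subfield F R" and "finite I" "m < card I"
    and "\<And>i k. \<lbrakk>i \<in> I; k < m\<rbrakk> \<Longrightarrow> v i k \<in> F"
  shows "\<exists>c. (\<forall>i\<in>I. c i \<in> F) \<and> (\<exists>i\<in>I. c i \<noteq> \<zero>) \<and> (\<forall>k<m. (\<Oplus>i\<in>I. c i \<otimes> v i k) = \<zero>)"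
  using assms(2-)
proof (induction m arbitrary: I v)
  note Fs = subringE[OF subfieldE(1)[OF F]]
  {
    case 0
    then obtain i where "i \<in> I" by fastforce
    then show ?case using Fs(3) subfieldE(6)[OF F] by (intro exI[of _ "\<lambda>_. \<one>"]) auto
  next
    case (Suc m)
    note FL = subsetD[OF Fs(1)]
    have v: "v i k \<in> carrier R" if "i \<in> I" "k < Suc m" for i k using FL Suc.prems that by blast
    show ?case
    proof (cases "\<forall>i\<in>I. v i m = \<zero>")
      case True
      obtain c where c: "\<forall>i\<in>I. c i \<in> F" "\<exists>i\<in>I. c i \<noteq> \<zero>"
        "\<forall>k<m. (\<Oplus>i\<in>I. c i \<otimes> v i k) = \<zero>"
        using Suc.IH[of I v] Suc.prems by (auto simp: less_Suc_eq)
      have "(\<Oplus>i\<in>I. c i \<otimes> v i m) = \<zero>"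
        using True c FL by (intro add.finprod_one_eqI) auto
      then show ?thesis using c by (intro exI[of _ c]) (auto simp: less_Suc_eq)
    next
      case False
      then obtain z where z: "z \<in> I" "v z m \<noteq> \<zero>" by blast
      let ?J = "I - {z}"
      have vz: "inv (v z m) \<in> F" "inv (v z m) \<otimes> v z m = \<one>"
        using subfield_m_inv[OF F, of "v z m"] z Suc.prems by auto
      define w where "w i k = v i k \<ominus> v i m \<otimes> inv (v z m) \<otimes> v z k" for i k
      have q: "v i m \<otimes> inv (v z m) \<in> F" if "i \<in> I" for i
        using Fs(6) vz Suc.prems(3) that by blast
      have w: "w i k \<in> F" if "i \<in> ?J" "k < m" for i k
        using that z Suc.prems(3) q Fs unfolding w_def a_minus_def by auto
      have "m < card ?J" "finite ?J" using Suc.prems z by auto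
      from Suc.IH[OF this(2,1), of w] w obtain c where c: "\<forall>i\<in>?J. c i \<in> F" "\<exists>i\<in>?J. c i \<noteq> \<zero>"
        "\<forall>k<m. (\<Oplus>i\<in>?J. c i \<otimes> w i k) = \<zero>" by blast
      define s where "s = (\<Oplus>i\<in>?J. c i \<otimes> (v i m \<otimes> inv (v z m)))"
      have cL: "c i \<in> carrier R" if "i \<in> ?J" for i using c FL that by blast
      have qL: "v i m \<otimes> inv (v z m) \<in> carrier R" if "i \<in> ?J" for i using q FL that by blast
      have s: "s \<in> F"
        unfolding s_def using c Suc.prems(3) vz(1)
        by (intro subring_finsum_closed[OF subfieldE(1)[OF F]] Pi_I Fs(6)) auto
      \<comment> \<open>The coefficient at \<open>z\<close> cancels the multiples of
        \<open>v z\<close> that were subtracted when passing from \<open>v\<close> to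
        \<open>w\<close>.\<close>
      define d where "d i = (if i = z then \<ominus> s else c i)" for i
      have d: "\<forall>i\<in>I. d i \<in> F" using c s Fs(5) by (auto simp: d_def)
      have sum: "(\<Oplus>i\<in>I. d i \<otimes> v i k) = (\<Oplus>i\<in>?J. c i \<otimes> w i k)" if k: "k < Suc m" for k
      proof -
        have vzk: "v z k \<in> carrier R" using v z k by blast
        have "(\<Oplus>i\<in>I. d i \<otimes> v i k) = (\<Oplus>i\<in>insert z ?J. d i \<otimes> v i k)"
          using z by (simp add: insert_absorb)
        also have "\<dots> = \<ominus> s \<otimes> v z k \<oplus> (\<Oplus>i\<in>?J. d i \<otimes> v i k)"
          using Suc.prems(1) d v k z FL by (subst finsum_insert) (auto simp: d_def)
        also have "(\<Oplus>i\<in>?J. d i \<otimes> v i k) = (\<Oplus>i\<in>?J. c i \<otimes> v i k)"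
          using cL v k by (intro finsum_cong') (auto simp: d_def)
        also have "\<dots> = (\<Oplus>i\<in>?J. c i \<otimes> w i k \<oplus> c i \<otimes> (v i m \<otimes> inv (v z m)) \<otimes> v z k)"
        proof (intro finsum_cong')
          fix i assume i: "i \<in> ?J"
          have "v i k \<in> carrier R" using v i k by blast
          then have "v i k = w i k \<oplus> (v i m \<otimes> inv (v z m)) \<otimes> v z k"
            using qL[OF i] vzk unfolding w_def by (simp add: a_minus_def a_assoc l_neg)
          moreover have "w i k \<in> carrier R"
            using \<open>v i k \<in> carrier R\<close> qL[OF i] vzk unfolding w_def by simp
          ultimately show "c i \<otimes> v i k = c i \<otimes> w i k \<oplus> c i \<otimes> (v i m \<otimes> inv (v z m)) \<otimes> v z k"
            using cL[OF i] qL[OF i] vzk by (simp add: r_distr m_assoc)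
        next
          show "(\<lambda>i. c i \<otimes> w i k \<oplus> c i \<otimes> (v i m \<otimes> inv (v z m)) \<otimes> v z k) \<in> ?J \<rightarrow> carrier R"
            using cL qL vzk v k unfolding w_def by auto
        qed simp
        also have "\<dots> = (\<Oplus>i\<in>?J. c i \<otimes> w i k)
            \<oplus> (\<Oplus>i\<in>?J. c i \<otimes> (v i m \<otimes> inv (v z m)) \<otimes> v z k)"
          using cL qL vzk v k unfolding w_def by (intro finsum_addf) auto
        also have "(\<Oplus>i\<in>?J. c i \<otimes> (v i m \<otimes> inv (v z m)) \<otimes> v z k) = s \<otimes> v z k"
          unfolding s_def using Suc.prems(1) cL qL vzk by (intro finsum_ldistr[symmetric]) auto
        finally have eq: "(\<Oplus>i\<in>I. d i \<otimes> v i k) = \<ominus> s \<otimes> v z k \<oplus> ((\<Oplus>i\<in>?J. c i \<otimes> w i k) \<oplus> s \<otimes> v z k)" .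
        have "(\<Oplus>i\<in>?J. c i \<otimes> w i k) \<in> carrier R" "s \<in> carrier R"
          using cL qL vzk v k s FL unfolding w_def by (auto intro!: finsum_closed)
        then show ?thesis using eq vzk by (simp add: l_minus a_lcomm[of "\<ominus> (s \<otimes> v z k)"] l_neg)
      qed
      \<comment> \<open>The pivot makes every \<open>w i m\<close> vanish, so the last equation
        holds for any \<open>c\<close>.\<close>
      have "(\<Oplus>i\<in>?J. c i \<otimes> w i m) = \<zero>"
      proof (intro add.finprod_one_eqI)
        fix i assume i: "i \<in> ?J"
        have "w i m = \<zero>"
          using v[of i m] v[of z m] i z vz FL[OF vz(1)] by (simp add: w_def m_assoc)
        then show "c i \<otimes> w i m = \<zero>" using cL[OF i] by simp
      qed
      then show ?thesis
        using d c(2,3) sum z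
        by (intro exI[of _ d]) (auto simp: less_Suc_eq d_def)
    qed
  }
qed


section \<open>Powers of a field endomorphism and their fixed fields\<close>

locale field_endo = field L for L (structure) +
  fixes \<sigma>
  assumes hom: "\<sigma> \<in> ring_hom L L"
begin

lemma pow_hom: "(\<sigma> ^^ k) \<in> ring_hom L L"
proof (induction k)
  case 0 then show ?case by (auto intro: ring_hom_memI)
next
  case (Suc k)
  then have "\<sigma> \<circ> (\<sigma> ^^ k) \<in> ring_hom L L" using hom ring_hom_trans by blast
  then show ?case by (simp add: comp_def)
qed

lemma pow_closed [simp]: "x \<in> carrier L \<Longrightarrow> (\<sigma> ^^ k) x \<in> carrier L"
  using ring_hom_closed[OF pow_hom] .

lemma pow_add: "x \<in> carrier L \<Longrightarrow> y \<in> carrier L \<Longrightarrow> (\<sigma> ^^ k) (x \<oplus> y) = (\<sigma> ^^ k) x \<oplus> (\<sigma> ^^ k) y"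
  using ring_hom_add[OF pow_hom] .

lemma pow_mult: "x \<in> carrier L \<Longrightarrow> y \<in> carrier L \<Longrightarrow> (\<sigma> ^^ k) (x \<otimes> y) = (\<sigma> ^^ k) x \<otimes> (\<sigma> ^^ k) y"
  using ring_hom_mult[OF pow_hom] .

lemma pow_one [simp]: "(\<sigma> ^^ k) \<one> = \<one>"
  using ring_hom_one[OF pow_hom] .

lemma pow_finsum:
  "f \<in> I \<rightarrow> carrier L \<Longrightarrow> (\<sigma> ^^ k) (\<Oplus>i\<in>I. f i) = (\<Oplus>i\<in>I. (\<sigma> ^^ k) (f i))"
  by (rule additive_finsum[OF abelian_group_axioms abelian_group_axioms]) (auto simp: pow_add)

lemma pow_zero [simp]: "(\<sigma> ^^ k) \<zero> = \<zero>"
  by (rule additive_zero[OF abelian_group_axioms abelian_group_axioms]) (auto simp: pow_add)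

lemma pow_minus: "x \<in> carrier L \<Longrightarrow> (\<sigma> ^^ k) (\<ominus> x) = \<ominus> (\<sigma> ^^ k) x"
  using pow_add[of "\<ominus> x" x k] by (simp add: l_neg minus_equality[symmetric])

text \<open>A nonzero difference is a unit, and a ring homomorphism sends no unit of a field to
  zero.\<close>

lemma pow_inj:
  assumes "x \<in> carrier L" "y \<in> carrier L" "(\<sigma> ^^ k) x = (\<sigma> ^^ k) y"
  shows "x = y"
proof (rule ccontr)
  assume "x \<noteq> y"
  then have d: "x \<ominus> y \<in> carrier L - {\<zero>}" using assms by auto
  have "(\<sigma> ^^ k) (x \<ominus> y) = \<zero>"
    using assms by (simp add: a_minus_def pow_add pow_minus r_neg)
  moreover have "(\<sigma> ^^ k) (x \<ominus> y) \<otimes> (\<sigma> ^^ k) (inv (x \<ominus> y)) = \<one>"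
    using d field_Units by (simp flip: pow_mult)
  ultimately show False using d field_Units by simp
qed

lemma pow_inv:
  assumes "x \<in> carrier L" "x \<noteq> \<zero>"
  shows "(\<sigma> ^^ k) (inv x) = inv ((\<sigma> ^^ k) x)"
proof -
  have u: "x \<in> Units L" using assms field_Units by blast
  have "(\<sigma> ^^ k) x \<otimes> (\<sigma> ^^ k) (inv x) = \<one>"
    using u assms by (simp flip: pow_mult)
  then show ?thesis using assms u by (metis comm_inv_char Units_inv_closed pow_closed)
qed

definition fixed :: "nat \<Rightarrow> 'a set" where
  "fixed k = {x \<in> carrier L. (\<sigma> ^^ k) x = x}"

lemma subfield_fixed: "subfield (fixed k) L"
proof (rule subfieldI')
  show "subring (fixed k) L"
    by (rule subringI) (auto simp: fixed_def pow_add pow_mult pow_minus)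
  fix x assume "x \<in> fixed k - {\<zero>}"
  then show "inv x \<in> fixed k"
    using field_Units by (auto simp: fixed_def pow_inv)
qed

lemma pow_fixed: "x \<in> fixed k \<Longrightarrow> (\<sigma> ^^ j) x \<in> fixed k"
  by (auto simp: fixed_def) (metis comp_apply funpow_add add.commute)

end

text \<open>The functions \<open>h \<mapsto> \<Sum>\<^sub>j a\<^sub>j h(b\<^sub>j)\<close> on ring homomorphisms are closed under products, and for
  \<open>h\<^sub>k(y) \<noteq> g(y)\<close> the function \<open>h \<mapsto> (h(y) - h\<^sub>k(y)) / (g(y) - h\<^sub>k(y))\<close> separates \<open>g\<close> from \<open>h\<^sub>k\<close>.\<close>

lemma (in field) separating_combination:
  assumes A: "subfield A R" and F: "subring F R" and FA: "F \<subseteq> A"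
    and g: "g \<in> ring_hom R R" "g ` F \<subseteq> A"
    and "finite I"
    and "\<And>k. k \<in> I \<Longrightarrow> h k \<in> ring_hom R R" "\<And>k. k \<in> I \<Longrightarrow> h k ` F \<subseteq> A"
    and "\<And>k. k \<in> I \<Longrightarrow> \<exists>y\<in>F. h k y \<noteq> g y"
  shows "\<exists>q a b. (\<forall>j<q. a j \<in> A \<and> b j \<in> F) \<and> (\<Oplus>j\<in>{..<q::nat}. a j \<otimes> g (b j)) = \<one> \<and>
    (\<forall>k\<in>I. (\<Oplus>j\<in>{..<q}. a j \<otimes> h k (b j)) = \<zero>)"
proof -
  \<comment> \<open>A list of pairs (a, b) encodes the function sending f to the sum of the a f(b).
    Concatenation adds such functions; multiplying all pairs by (c, d) multiplies the function by c
    f(d).\<close>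
  define ev where "ev f xs = foldr (\<lambda>(a, b) s. a \<otimes> f b \<oplus> s) xs \<zero>" for f and xs :: "('a \<times> 'a) list"
  note As = subringE[OF subfieldE(1)[OF A]] and Fs = subringE[OF F]
  have AL: "x \<in> carrier R" if "x \<in> A" for x using As(1) that by blast
  have FL: "x \<in> carrier R" if "x \<in> F" for x using Fs(1) that by blast
  have ev_closed: "ev f xs \<in> carrier R" if "f \<in> ring_hom R R" "set xs \<subseteq> A \<times> F" for f xs
    using that(2) AL FL ring_hom_closed[OF that(1)] by (induction xs) (auto simp: ev_def)
  have ev_append: "ev f (xs @ ys) = ev f xs \<oplus> ev f ys"
    if "f \<in> ring_hom R R" "set xs \<subseteq> A \<times> F" "set ys \<subseteq> A \<times> F" for f xs ys
    using that(2)
  proof (induction xs)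
    case Nil then show ?case using ev_closed[OF that(1,3)] by (simp add: ev_def)
  next
    case (Cons z xs)
    moreover have "fst z \<otimes> f (snd z) \<in> carrier R"
      using Cons AL FL ring_hom_closed[OF that(1)] by (cases z) auto
    ultimately show ?case using ev_closed[OF that(1)] that(3)
      by (cases z) (auto simp: ev_def a_assoc)
  qed
  have ev_scale: "ev f (map (\<lambda>(a, b). (a \<otimes> c, b \<otimes> d)) xs) = ev f xs \<otimes> (c \<otimes> f d)"
    if "f \<in> ring_hom R R" "set xs \<subseteq> A \<times> F" "c \<in> A" "d \<in> F" for f xs c d
    using that(2)
  proof (induction xs)
    case Nil
    then show ?case using ring_hom_closed[OF that(1)] AL FL that by (simp add: ev_def)
  next
    case (Cons z xs)
    obtain a b where z: "z = (a, b)" by (cases z)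
    have cl: "a \<in> carrier R" "b \<in> carrier R" "c \<in> carrier R" "d \<in> carrier R"
      "f b \<in> carrier R" "f d \<in> carrier R" "ev f xs \<in> carrier R"
      using Cons AL FL ring_hom_closed[OF that(1)] that ev_closed[OF that(1)] z by auto
    have "ev f (map (\<lambda>(a, b). (a \<otimes> c, b \<otimes> d)) (z # xs)) =
        (a \<otimes> c) \<otimes> (f b \<otimes> f d) \<oplus> ev f xs \<otimes> (c \<otimes> f d)"
      using Cons z ring_hom_mult[OF that(1)] cl by (simp add: ev_def)
    also have "\<dots> = (a \<otimes> f b \<oplus> ev f xs) \<otimes> (c \<otimes> f d)"
    proof -
      have "(a \<otimes> c) \<otimes> (f b \<otimes> f d) = (a \<otimes> f b) \<otimes> (c \<otimes> f d)" using cl by (simp add: m_ac)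
      then show ?thesis using cl by (simp add: l_distr)
    qed
    finally show ?case by (simp add: ev_def z)
  qed
  have ev_sum: "ev f xs = (\<Oplus>j\<in>{..<length xs}. fst (xs ! j) \<otimes> f (snd (xs ! j)))"
    if f: "f \<in> ring_hom R R" and "set xs \<subseteq> A \<times> F" for f xs
    using that(2)
  proof (induction xs rule: rev_induct)
    case Nil then show ?case by (simp add: ev_def)
  next
    case (snoc z xs)
    have z: "fst z \<otimes> f (snd z) \<in> carrier R"
      using snoc AL FL ring_hom_closed[OF f] by (cases z) auto
    have xs: "fst (xs ! j) \<otimes> f (snd (xs ! j)) \<in> carrier R" if "j < length xs" for j
      using snoc.prems nth_mem[OF that] AL FL ring_hom_closed[OF f] by (cases "xs ! j") auto
    have "ev f (xs @ [z]) = ev f xs \<oplus> fst z \<otimes> f (snd z)"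
      using snoc.prems ev_append[OF f, of xs "[z]"] z by (cases z) (auto simp: ev_def)
    also have "\<dots> = fst z \<otimes> f (snd z) \<oplus> (\<Oplus>j\<in>{..<length xs}. fst (xs ! j) \<otimes> f (snd (xs ! j)))"
      using snoc z xs by (simp add: a_comm finsum_closed Pi_def)
    also have "\<dots> = fst z \<otimes> f (snd z) \<oplus>
        (\<Oplus>j\<in>{..<length xs}. fst ((xs @ [z]) ! j) \<otimes> f (snd ((xs @ [z]) ! j)))"
    proof -
      have "(\<Oplus>j\<in>{..<length xs}. fst (xs ! j) \<otimes> f (snd (xs ! j))) =
          (\<Oplus>j\<in>{..<length xs}. fst ((xs @ [z]) ! j) \<otimes> f (snd ((xs @ [z]) ! j)))"
        using xs by (intro finsum_cong') (auto simp: nth_append)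
      then show ?thesis by simp
    qed
    also have "\<dots> = (\<Oplus>j\<in>{..<length (xs @ [z])}. fst ((xs @ [z]) ! j) \<otimes> f (snd ((xs @ [z]) ! j)))"
      using xs z by (simp add: lessThan_Suc, subst finsum_insert) (auto simp: nth_append)
    finally show ?case .
  qed
  have "\<exists>xs. set xs \<subseteq> A \<times> F \<and> ev g xs = \<one> \<and> (\<forall>k\<in>I. ev (h k) xs = \<zero>)"
    using assms(6-9)
  proof (induction I rule: finite_induct)
    case empty
    have "ev g [(\<one>, \<one>)] = \<one>" using ring_hom_one[OF g(1)] by (simp add: ev_def)
    then show ?case using As(3) Fs(3) by (intro exI[of _ "[(\<one>, \<one>)]"]) auto
  next
    case (insert k I)
    then obtain xs where xs: "set xs \<subseteq> A \<times> F" "ev g xs = \<one>" "\<forall>k\<in>I. ev (h k) xs = \<zero>" by auto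
    obtain y where y: "y \<in> F" "h k y \<noteq> g y" using insert.prems by blast
    have hk: "h k y \<in> A" "g y \<in> A" using insert.prems g y by auto
    define u where "u = inv (g y \<ominus> h k y)"
    have "g y \<ominus> h k y \<in> A" using hk As by (simp add: a_minus_def)
    moreover have "g y \<ominus> h k y \<noteq> \<zero>" using y hk AL by (simp add: r_right_minus_eq)
    ultimately have u: "u \<in> A" "u \<otimes> (g y \<ominus> h k y) = \<one>"
      using subfield_m_inv[OF A] by (auto simp: u_def)
    define c where "c = \<ominus> (h k y) \<otimes> u"
    have c: "c \<in> A" using hk u As by (simp add: c_def)
    \<comment> \<open>The product of the previous combination with f \<mapsto> u (f(y) - h_k(y)),
      which is 1 at g and 0 at h_k: the first half contributes the term u f(y), the second the
      constant c = - h_k(y) u.\<close>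
    define ys where "ys = map (\<lambda>(a, b). (a \<otimes> u, b \<otimes> y)) xs @ map (\<lambda>(a, b). (a \<otimes> c, b \<otimes> \<one>)) xs"
    have ev_ys: "ev f ys = ev f xs \<otimes> (u \<otimes> (f y \<ominus> h k y))" if f: "f \<in> ring_hom R R" for f
    proof -
      have cl: "u \<in> carrier R" "y \<in> carrier R" "h k y \<in> carrier R" "f y \<in> carrier R"
          "ev f xs \<in> carrier R"
        using u y hk AL FL ring_hom_closed[OF f] ev_closed[OF f xs(1)] by auto
      have "ev f ys = ev f xs \<otimes> (u \<otimes> f y) \<oplus> ev f xs \<otimes> (c \<otimes> f \<one>)"
        unfolding ys_def using xs(1) u(1) c y Fs(3,6) As(6) f
        by (subst ev_append) (auto simp: ev_scale)
      also have "\<dots> = ev f xs \<otimes> (u \<otimes> (f y \<ominus> h k y))"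
        using cl ring_hom_one[OF f] by (simp add: c_def a_minus_def r_distr r_minus l_minus m_ac)
      finally show ?thesis .
    qed
    have "set ys \<subseteq> A \<times> F"
      using xs(1) u c y As(6) Fs(3,6) by (auto simp: ys_def)
    moreover have "ev g ys = \<one>"
      using ev_ys[OF g(1)] xs(2) u(2) by simp
    moreover have "ev (h l) ys = \<zero>" if l: "l \<in> insert k I" for l
    proof -
      have hl: "h l \<in> ring_hom R R" using insert.prems l by blast
      have cl: "u \<in> carrier R" "h l y \<in> carrier R" "h k y \<in> carrier R" "ev (h l) xs \<in> carrier R"
        using u y hk AL FL ring_hom_closed[OF hl] ev_closed[OF hl xs(1)] by auto
      then show ?thesis using l ev_ys[OF hl] xs(3) by (auto simp: a_minus_def r_neg)
    qed
    ultimately show ?case by blast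
  qed
  then obtain xs where xs: "set xs \<subseteq> A \<times> F" "ev g xs = \<one>" "\<forall>k\<in>I. ev (h k) xs = \<zero>" by blast
  have "xs ! j \<in> A \<times> F" if "j < length xs" for j using xs(1) nth_mem[OF that] by blast
  then show ?thesis
    using xs ev_sum[OF g(1) xs(1)] ev_sum[OF assms(7) xs(1)]
    by (intro exI[of _ "length xs"] exI[of _ "\<lambda>j. fst (xs ! j)"] exI[of _ "\<lambda>j. snd (xs ! j)"])
      (auto simp: mem_Times_iff)
qed


section \<open>Degrees of fixed fields: Dedekind's lower bound and Artin's upper bound\<close>

context field_endo
begin

lemma pow_eq_diff:
  assumes "x \<in> carrier L" "(\<sigma> ^^ k) x = (\<sigma> ^^ l) x" "k \<le> l"
  shows "(\<sigma> ^^ (l - k)) x = x"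
proof -
  have "(\<sigma> ^^ k) ((\<sigma> ^^ (l - k)) x) = (\<sigma> ^^ k) x"
    using assms by (metis comp_apply funpow_add le_add_diff_inverse)
  then show ?thesis using pow_inj assms(1) by (metis pow_closed)
qed

text \<open>Dedekind's argument. With fewer than \<open>t\<close> basis vectors there is a
  nontrivial relation sum_i c_i \<sigma>^i = 0 on a basis of \<open>E\<close>. It is
  \<open>K\<close>-linear and so holds on all of \<open>E\<close>, where a separating combination
  isolates one nonzero coefficient.\<close>

lemma dimension_lower_bound:
  assumes K: "subfield K L" and E: "subfield E L" and dim: "dimension d K E"
    and Kfix: "\<And>x. x \<in> K \<Longrightarrow> \<sigma> x = x"
    and dist: "\<And>k. 0 < k \<Longrightarrow> k < t \<Longrightarrow> \<exists>y\<in>E. (\<sigma> ^^ k) y \<noteq> y"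
  shows "t \<le> d"
proof (rule ccontr)
  assume "\<not> t \<le> d"
  then have "d < card {..<t}" by simp
  have KL: "K \<subseteq> carrier L" and EL: "E \<subseteq> carrier L" using K E subfieldE(3) by auto
  obtain Us where Us: "set Us \<subseteq> carrier L" "length Us = d" "Span K Us = E"
    using exists_base[OF K dim] by blast
  have UE: "set Us \<subseteq> E" using Span_base_incl[OF K Us(1)] Us(3) by simp
  have "\<exists>c. (\<forall>i\<in>{..<t}. c i \<in> carrier L) \<and> (\<exists>i\<in>{..<t}. c i \<noteq> \<zero>) \<and>
      (\<forall>k<d. (\<Oplus>i\<in>{..<t}. c i \<otimes> (\<sigma> ^^ i) (Us ! k)) = \<zero>)"
  proof (intro homogeneous_system_nontrivial_solution[OF carrier_is_subfield])
    show "(\<sigma> ^^ i) (Us ! k) \<in> carrier L" if "k < d" for i k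
      using pow_closed[OF subsetD[OF Us(1) nth_mem]] Us(2) that by simp
  qed (use \<open>d < card {..<t}\<close> in auto)
  then obtain c where c: "\<And>i. i < t \<Longrightarrow> c i \<in> carrier L" "\<exists>i<t. c i \<noteq> \<zero>"
    "\<And>k. k < d \<Longrightarrow> (\<Oplus>i\<in>{..<t}. c i \<otimes> (\<sigma> ^^ i) (Us ! k)) = \<zero>" by auto
  then obtain m where m: "m < t" "c m \<noteq> \<zero>" by blast
  have fixp: "(\<sigma> ^^ i) x = x" if "x \<in> K" for i x
    using Kfix that by (induction i) auto
  let ?V = "{x \<in> carrier L. (\<Oplus>i\<in>{..<t}. c i \<otimes> (\<sigma> ^^ i) x) = \<zero>}"
  have add: "(\<Oplus>i\<in>{..<t}. c i \<otimes> (\<sigma> ^^ i) (x \<oplus> y)) =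
      (\<Oplus>i\<in>{..<t}. c i \<otimes> (\<sigma> ^^ i) x) \<oplus> (\<Oplus>i\<in>{..<t}. c i \<otimes> (\<sigma> ^^ i) y)"
    if "x \<in> carrier L" "y \<in> carrier L" for x y
  proof -
    have "(\<Oplus>i\<in>{..<t}. c i \<otimes> (\<sigma> ^^ i) (x \<oplus> y)) =
        (\<Oplus>i\<in>{..<t}. c i \<otimes> (\<sigma> ^^ i) x \<oplus> c i \<otimes> (\<sigma> ^^ i) y)"
      using that c(1) by (intro finsum_cong') (auto simp: pow_add r_distr)
    then show ?thesis using that c(1) by (simp add: finsum_addf Pi_def)
  qed
  have smult: "(\<Oplus>i\<in>{..<t}. c i \<otimes> (\<sigma> ^^ i) (k \<otimes> x)) = k \<otimes> (\<Oplus>i\<in>{..<t}. c i \<otimes> (\<sigma> ^^ i) x)"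
    if "x \<in> carrier L" "k \<in> K" for x k
  proof -
    have k: "k \<in> carrier L" using that KL by blast
    have "(\<Oplus>i\<in>{..<t}. c i \<otimes> (\<sigma> ^^ i) (k \<otimes> x)) = (\<Oplus>i\<in>{..<t}. k \<otimes> (c i \<otimes> (\<sigma> ^^ i) x))"
      using that k c(1) fixp by (intro finsum_cong') (auto simp: pow_mult m_lcomm)
    then show ?thesis using that k c(1) by (simp add: finsum_rdistr Pi_def)
  qed
  have "subalgebra K ?V L"
  proof (intro subalgebra.intro add.subgroupI)
    show "?V \<noteq> {}" using c(1) by (auto intro!: exI[of _ \<zero>] add.finprod_one_eqI)
    show "subalgebra_axioms K ?V L"
      unfolding subalgebra_axioms_def using KL by (auto simp: smult)
  next
    fix x assume "x \<in> ?V"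
    moreover have "(\<Oplus>i\<in>{..<t}. c i \<otimes> \<zero>) = \<zero>"
      using c(1) by (intro add.finprod_one_eqI) auto
    ultimately show "\<ominus> x \<in> ?V" using add[of x "\<ominus> x"] c(1)
      by (auto simp: r_neg)
  qed (auto simp: add)
  moreover have "set Us \<subseteq> ?V" using Us c(3) by (auto simp: in_set_conv_nth)
  ultimately have "E \<subseteq> ?V" using subalgebra_Span_incl[OF K] Us(3) by blast
  have "\<exists>q a b. (\<forall>j<q. a j \<in> carrier L \<and> b j \<in> E) \<and>
    (\<Oplus>j\<in>{..<q::nat}. a j \<otimes> (\<sigma> ^^ m) (b j)) = \<one> \<and>
    (\<forall>k\<in>{..<t} - {m}. (\<Oplus>j\<in>{..<q}. a j \<otimes> (\<sigma> ^^ k) (b j)) = \<zero>)"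
  proof (rule separating_combination[OF carrier_is_subfield subfieldE(1)[OF E] EL pow_hom])
    \<comment> \<open>If two powers with distinct exponents below \<open>t\<close> agreed on
      \<open>E\<close>, injectivity would make a power with a positive exponent below
      \<open>t\<close> trivial on \<open>E\<close>.\<close>
    show "\<exists>y\<in>E. (\<sigma> ^^ k) y \<noteq> (\<sigma> ^^ m) y" if k: "k \<in> {..<t} - {m}" for k
    proof (cases "k \<le> m")
      case True
      then have "0 < m - k" "m - k < t" using k m by auto
      then obtain y where "y \<in> E" "(\<sigma> ^^ (m - k)) y \<noteq> y" using dist by blast
      then show ?thesis using pow_eq_diff[of y k m] True EL by blast
    next
      case False
      then have "0 < k - m" "k - m < t" using k m by auto
      then obtain y where "y \<in> E" "(\<sigma> ^^ (k - m)) y \<noteq> y" using dist by blast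
      then show ?thesis using pow_eq_diff[of y m k] False EL
        by (metis less_imp_le_nat not_le subsetD)
    qed
  qed (use EL pow_hom in auto)
  then obtain q a b where ab: "\<And>j. j < q \<Longrightarrow> a j \<in> carrier L" "\<And>j. j < q \<Longrightarrow> b j \<in> E"
    "(\<Oplus>j\<in>{..<q::nat}. a j \<otimes> (\<sigma> ^^ m) (b j)) = \<one>"
    "\<And>k. k < t \<Longrightarrow> k \<noteq> m \<Longrightarrow> (\<Oplus>j\<in>{..<q}. a j \<otimes> (\<sigma> ^^ k) (b j)) = \<zero>" by blast
  have bL: "b j \<in> carrier L" if "j < q" for j using ab(2) that EL by blast
  \<comment> \<open>The relation is evaluated at all b_j, weighted with a_j and summed; after
    exchanging the sums only the \<open>m\<close>-th coefficient survives.\<close>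
  have "\<zero> = (\<Oplus>j\<in>{..<q}. a j \<otimes> (\<Oplus>k\<in>{..<t}. c k \<otimes> (\<sigma> ^^ k) (b j)))"
  proof (intro add.finprod_one_eqI[symmetric])
    fix j assume "j \<in> {..<q}"
    then have "b j \<in> ?V" "a j \<in> carrier L" using ab(1,2) \<open>E \<subseteq> ?V\<close> by auto
    then show "a j \<otimes> (\<Oplus>k\<in>{..<t}. c k \<otimes> (\<sigma> ^^ k) (b j)) = \<zero>" by simp
  qed
  also have "\<dots> = (\<Oplus>j\<in>{..<q}. \<Oplus>k\<in>{..<t}. c k \<otimes> (a j \<otimes> (\<sigma> ^^ k) (b j)))"
  proof (intro finsum_cong' refl)
    fix j assume j: "j \<in> {..<q}"
    then have "a j \<otimes> (\<Oplus>k\<in>{..<t}. c k \<otimes> (\<sigma> ^^ k) (b j)) = (\<Oplus>k\<in>{..<t}. a j \<otimes> (c k \<otimes> (\<sigma> ^^ k) (b j)))"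
      using ab(1) bL c(1) by (intro finsum_rdistr) auto
    also have "\<dots> = (\<Oplus>k\<in>{..<t}. c k \<otimes> (a j \<otimes> (\<sigma> ^^ k) (b j)))"
      using j ab(1) bL c(1) by (intro finsum_cong') (auto simp: m_lcomm)
    finally show "a j \<otimes> (\<Oplus>k\<in>{..<t}. c k \<otimes> (\<sigma> ^^ k) (b j)) =
      (\<Oplus>k\<in>{..<t}. c k \<otimes> (a j \<otimes> (\<sigma> ^^ k) (b j)))" .
  qed (use ab(1) bL c(1) in \<open>auto intro!: finsum_closed\<close>)
  also have "\<dots> = (\<Oplus>k\<in>{..<t}. \<Oplus>j\<in>{..<q}. c k \<otimes> (a j \<otimes> (\<sigma> ^^ k) (b j)))"
    using ab(1) bL c(1) by (intro finsum_swap) auto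
  also have "\<dots> = (\<Oplus>k\<in>{..<t}. if k = m then c k else \<zero>)"
  proof (intro finsum_cong' refl)
    fix k assume k: "k \<in> {..<t}"
    then have "(\<Oplus>j\<in>{..<q}. c k \<otimes> (a j \<otimes> (\<sigma> ^^ k) (b j))) = c k \<otimes> (\<Oplus>j\<in>{..<q}. a j \<otimes> (\<sigma> ^^ k) (b j))"
      using ab(1) bL c(1) by (intro finsum_rdistr[symmetric]) auto
    then show "(\<Oplus>j\<in>{..<q}. c k \<otimes> (a j \<otimes> (\<sigma> ^^ k) (b j))) = (if k = m then c k else \<zero>)"
      using k ab(3,4) c(1) by auto
  qed (use c(1) in auto)
  also have "\<dots> = c m" using m c(1) by (intro finsum_delta) auto
  finally show False using m by simp
qed

definition trace :: "nat \<Rightarrow> 'a \<Rightarrow> 'a" where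
  "trace t x = (\<Oplus>k\<in>{..<t}. (\<sigma> ^^ k) x)"

lemma trace_closed: "x \<in> carrier L \<Longrightarrow> trace t x \<in> carrier L"
  unfolding trace_def by (auto intro!: finsum_closed)

lemma pow_trace:
  assumes "x \<in> fixed t"
  shows "\<sigma> (trace t x) = trace t x"
proof -
  have x: "x \<in> carrier L" "(\<sigma> ^^ t) x = x" using assms by (auto simp: fixed_def)
  have "\<sigma> (trace t x) = (\<Oplus>k\<in>{..<t}. (\<sigma> ^^ Suc k) x)"
    using pow_finsum[of "\<lambda>k. (\<sigma> ^^ k) x" "{..<t}" 1] x unfolding trace_def by auto
  also have "\<dots> = trace t x"
    unfolding trace_def using x by (intro finsum_cyclic_shift[of "\<lambda>k. (\<sigma> ^^ k) x"]) auto
  finally show ?thesis .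
qed

lemma trace_closed_subfield:
  "x \<in> fixed t \<Longrightarrow> trace t x \<in> fixed t"
  unfolding trace_def using pow_fixed
  by (intro subring_finsum_closed[OF subfieldE(1)[OF subfield_fixed]]) auto

text \<open>A separating combination between the identity and the other powers of \<sigma>, known as
  Galois coordinates. They take the place of a basis and its trace-dual basis in the descent
  arguments below.\<close>

lemma fixed_coordinates:
  assumes "\<And>k. 0 < k \<Longrightarrow> k < t \<Longrightarrow> \<exists>y\<in>fixed t. (\<sigma> ^^ k) y \<noteq> y"
  shows "\<exists>q a b. (\<forall>j<q. a j \<in> fixed t \<and> b j \<in> fixed t) \<and>
    (\<forall>k<t. (\<Oplus>j\<in>{..<q::nat}. a j \<otimes> (\<sigma> ^^ k) (b j)) = (if k = 0 then \<one> else \<zero>))"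
proof -
  have "\<exists>q a b. (\<forall>j<q. a j \<in> fixed t \<and> b j \<in> fixed t) \<and>
    (\<Oplus>j\<in>{..<q::nat}. a j \<otimes> (\<sigma> ^^ 0) (b j)) = \<one> \<and>
    (\<forall>k\<in>{0<..<t}. (\<Oplus>j\<in>{..<q}. a j \<otimes> (\<sigma> ^^ k) (b j)) = \<zero>)"
    using assms pow_fixed pow_hom
    by (intro separating_combination[OF subfield_fixed subfieldE(1)[OF subfield_fixed]])
      (auto intro!: ring_hom_memI)
  then obtain q a b where ab: "\<forall>j<q. a j \<in> fixed t \<and> b j \<in> fixed t"
    "(\<Oplus>j\<in>{..<q::nat}. a j \<otimes> (\<sigma> ^^ 0) (b j)) = \<one>"
    "\<forall>k\<in>{0<..<t}. (\<Oplus>j\<in>{..<q}. a j \<otimes> (\<sigma> ^^ k) (b j)) = \<zero>" by blast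
  then show ?thesis
    by (intro exI[of _ q] exI[of _ a] exI[of _ b]) auto
qed

text \<open>Exchanging sums in the coordinate relation gives sum_j a_j tr(b_j) = 1, so some trace is
  nonzero, and one divides by it. This needs no assumption on the characteristic.\<close>

lemma trace_surj:
  assumes t: "0 < t" and "\<And>k. 0 < k \<Longrightarrow> k < t \<Longrightarrow> \<exists>y\<in>fixed t. (\<sigma> ^^ k) y \<noteq> y"
  shows "\<exists>c\<in>fixed t. trace t c = \<one>"
proof -
  obtain q a b where ab: "\<And>j. j < q \<Longrightarrow> a j \<in> fixed t" "\<And>j. j < q \<Longrightarrow> b j \<in> fixed t"
    "\<And>k. k < t \<Longrightarrow> (\<Oplus>j\<in>{..<q::nat}. a j \<otimes> (\<sigma> ^^ k) (b j)) = (if k = 0 then \<one> else \<zero>)"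
    using fixed_coordinates[OF assms(2)] by blast
  have L: "a j \<in> carrier L" "b j \<in> carrier L" if "j < q" for j
    using ab that by (auto simp: fixed_def)
  have "(\<Oplus>j\<in>{..<q}. a j \<otimes> trace t (b j)) = (\<Oplus>j\<in>{..<q}. \<Oplus>k\<in>{..<t}. a j \<otimes> (\<sigma> ^^ k) (b j))"
    unfolding trace_def using L by (intro finsum_cong' finsum_rdistr) (auto intro!: finsum_closed)
  also have "\<dots> = (\<Oplus>k\<in>{..<t}. \<Oplus>j\<in>{..<q}. a j \<otimes> (\<sigma> ^^ k) (b j))"
    using L by (intro finsum_swap) auto
  also have "\<dots> = (\<Oplus>k\<in>{..<t}. if k = 0 then \<one> else \<zero>)"
    using ab(3) by (intro finsum_cong') auto
  also have "\<dots> = \<one>" using t finsum_delta[of "{..<t}" 0 "\<lambda>_. \<one>"] by auto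
  finally have one: "(\<Oplus>j\<in>{..<q}. a j \<otimes> trace t (b j)) = \<one>" .
  have "\<exists>j<q. trace t (b j) \<noteq> \<zero>"
  proof (rule ccontr)
    assume "\<not> ?thesis"
    then have "(\<Oplus>j\<in>{..<q}. a j \<otimes> trace t (b j)) = \<zero>"
      using L by (intro add.finprod_one_eqI) auto
    then show False using one by simp
  qed
  then obtain j where j: "j < q" "trace t (b j) \<noteq> \<zero>" by blast
  define u where "u = inv (trace t (b j))"
  have tr: "trace t (b j) \<in> fixed t - {\<zero>}" using trace_closed_subfield ab j by blast
  have u: "u \<in> fixed t" "u \<otimes> trace t (b j) = \<one>"
    using subfield_m_inv[OF subfield_fixed tr] by (auto simp: u_def)
  have uL: "u \<in> carrier L" using u by (simp add: fixed_def)
  \<comment> \<open>The trace is invariant, hence so is its inverse, which can then be taken out of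
    the trace.\<close>
  have "\<sigma> u = u"
    using pow_inv[of "trace t (b j)" 1] pow_trace[of "b j" t] ab j trace_closed L by (auto simp: u_def)
  then have up: "(\<sigma> ^^ k) u = u" for k by (induction k) auto
  have "trace t (u \<otimes> b j) = (\<Oplus>k\<in>{..<t}. u \<otimes> (\<sigma> ^^ k) (b j))"
    unfolding trace_def using L j uL up by (intro finsum_cong') (auto simp: pow_mult)
  also have "\<dots> = u \<otimes> trace t (b j)"
    unfolding trace_def using L j uL by (intro finsum_rdistr[symmetric]) auto
  finally have "trace t (u \<otimes> b j) = \<one>" using u by simp
  moreover have "u \<otimes> b j \<in> fixed t"
    using subringE(6)[OF subfieldE(1)[OF subfield_fixed]] u ab j by blast
  ultimately show ?thesis by blast
qed

lemma combine_eq_finsum: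
  assumes "set Us \<subseteq> carrier L" "f \<in> {..<length Us} \<rightarrow> carrier L"
  shows "combine (map f [0..<length Us]) Us = (\<Oplus>i\<in>{..<length Us}. f i \<otimes> Us ! i)"
  using assms
proof (induction Us arbitrary: f)
  case (Cons u Us)
  have f: "f i \<in> carrier L" if "i < Suc (length Us)" for i using Cons.prems(2) that by auto
  have "map f [0..<length (u # Us)] = f 0 # map (\<lambda>i. f (Suc i)) [0..<length Us]"
    by (simp add: map_upt_Suc del: upt_Suc)
  then have "combine (map f [0..<length (u # Us)]) (u # Us) =
      f 0 \<otimes> u \<oplus> (\<Oplus>i\<in>{..<length Us}. f (Suc i) \<otimes> Us ! i)"
    using Cons.IH[of "\<lambda>i. f (Suc i)"] Cons.prems(1) f by (simp del: upt_Suc)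
  also have "\<dots> = (\<Oplus>i\<in>{..<length (u # Us)}. f i \<otimes> (u # Us) ! i)"
    using Cons.prems(1) f subsetD[OF _ nth_mem, of Us "carrier L"]
    by (simp, subst finsum_lessThan_Suc_shift) (auto simp: less_Suc_eq_0_disj)
  finally show ?case .
qed simp

text \<open>Artin's argument. With more than \<open>t\<close> independent vectors u_i there is a
  nontrivial solution c of sum_i c_i \<sigma>^k(u_i) = 0 for all k < t. Rescaled so that one
  coefficient has trace 1, it yields by averaging the relation sum_i tr(c_i) u_i = 0 over
  \<open>K\<close>, against independence.\<close>

lemma dimension_upper_bound:
  assumes t: "0 < t" and K: "K = fixed 1" and dim: "dimension d K (fixed t)"
    and dist: "\<And>k. 0 < k \<Longrightarrow> k < t \<Longrightarrow> \<exists>y\<in>fixed t. (\<sigma> ^^ k) y \<noteq> y"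
  shows "d \<le> t"
proof (rule ccontr)
  assume "\<not> d \<le> t"
  then have "t < card {..<d}" by simp
  have Ksub: "subfield K L" using subfield_fixed K by simp
  have Fs: "subring (fixed t) L" using subfieldE(1)[OF subfield_fixed] .
  obtain Us where Us: "set Us \<subseteq> carrier L" "independent K Us" "length Us = d" "Span K Us = fixed t"
    using exists_base[OF Ksub dim] by blast
  have UF: "set Us \<subseteq> fixed t" using Span_base_incl[OF Ksub Us(1)] Us(4) by simp
  then have u: "Us ! i \<in> fixed t" if "i < d" for i using Us(3) that nth_mem by blast
  have uL: "Us ! i \<in> carrier L" if "i < d" for i using Us(1,3) that nth_mem by blast
  have "\<exists>c. (\<forall>i\<in>{..<d}. c i \<in> fixed t) \<and> (\<exists>i\<in>{..<d}. c i \<noteq> \<zero>) \<and>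
      (\<forall>k<t. (\<Oplus>i\<in>{..<d}. c i \<otimes> (\<sigma> ^^ k) (Us ! i)) = \<zero>)"
    using u pow_fixed \<open>t < card {..<d}\<close>
    by (intro homogeneous_system_nontrivial_solution[OF subfield_fixed]) auto
  then obtain c where c: "\<And>i. i < d \<Longrightarrow> c i \<in> fixed t" "\<exists>i<d. c i \<noteq> \<zero>"
    "\<And>k. k < t \<Longrightarrow> (\<Oplus>i\<in>{..<d}. c i \<otimes> (\<sigma> ^^ k) (Us ! i)) = \<zero>" by auto
  then obtain m where m: "m < d" "c m \<noteq> \<zero>" by blast
  obtain l where l: "l \<in> fixed t" "trace t l = \<one>" using trace_surj[OF t dist] by blast
  have cm: "c m \<in> fixed t - {\<zero>}" using c m by blast
  \<comment> \<open>The factor that turns the nonzero coefficient \<open>c m\<close> into the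
    element \<open>l\<close> of trace 1.\<close>
  define z where "z = l \<otimes> inv (c m)"
  have inv: "inv (c m) \<in> fixed t" "inv (c m) \<otimes> c m = \<one>"
    using subfield_m_inv[OF subfield_fixed cm] by auto
  have z: "z \<in> fixed t" using subringE(6)[OF Fs] l inv by (simp add: z_def)
  have FL: "x \<in> carrier L" if "x \<in> fixed t" for x using that by (simp add: fixed_def)
  have ut: "(\<sigma> ^^ t) (Us ! i) = Us ! i" if "i < d" for i using u[OF that] by (simp add: fixed_def)
  have cL: "c i \<in> carrier L" if "i < d" for i using FL c(1) that by blast
  have "z \<otimes> c m = l" using FL l inv cm by (simp add: z_def m_assoc)
  define e where "e i = z \<otimes> c i" for i
  have e: "e i \<in> fixed t" if "i < d" for i
    using subringE(6)[OF Fs] z c(1) that by (simp add: e_def)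
  \<comment> \<open>The exponent \<open>k = t\<close> is included because \<open>t - k\<close> runs
    from 1 to \<open>t\<close> below; there \<sigma>^t acts as the identity on the u_i.\<close>
  have e0: "(\<Oplus>i\<in>{..<d}. e i \<otimes> (\<sigma> ^^ k) (Us ! i)) = \<zero>" if k: "k \<le> t" for k
  proof -
    have "(\<Oplus>i\<in>{..<d}. e i \<otimes> (\<sigma> ^^ k) (Us ! i)) = z \<otimes> (\<Oplus>i\<in>{..<d}. c i \<otimes> (\<sigma> ^^ k) (Us ! i))"
      using FL z c(1) uL
      by (subst finsum_rdistr) (auto simp: e_def m_assoc intro!: finsum_cong')
    also have "(\<Oplus>i\<in>{..<d}. c i \<otimes> (\<sigma> ^^ k) (Us ! i)) = \<zero>"
    proof (cases "k = t")
      case True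
      have "(\<Oplus>i\<in>{..<d}. c i \<otimes> (\<sigma> ^^ k) (Us ! i)) = (\<Oplus>i\<in>{..<d}. c i \<otimes> (\<sigma> ^^ 0) (Us ! i))"
        using True ut cL uL by (intro finsum_cong') auto
      then show ?thesis using c(3)[OF t] by simp
    qed (use k c in auto)
    finally show ?thesis using FL z by simp
  qed
  \<comment> \<open>Applying \<sigma>^k to the equation with exponent t - k brings every u_i back to
    itself and moves only the coefficients, whose sum over k is a trace.\<close>
  have "\<zero> = (\<Oplus>k\<in>{..<t}. (\<sigma> ^^ k) (\<Oplus>i\<in>{..<d}. e i \<otimes> (\<sigma> ^^ (t - k)) (Us ! i)))"
    using e0 by (intro add.finprod_one_eqI[symmetric]) auto
  also have "\<dots> = (\<Oplus>k\<in>{..<t}. \<Oplus>i\<in>{..<d}. (\<sigma> ^^ k) (e i) \<otimes> Us ! i)"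
  proof (intro finsum_cong' refl)
    fix k assume k: "k \<in> {..<t}"
    have "(\<sigma> ^^ k) (\<Oplus>i\<in>{..<d}. e i \<otimes> (\<sigma> ^^ (t - k)) (Us ! i)) =
      (\<Oplus>i\<in>{..<d}. (\<sigma> ^^ k) (e i \<otimes> (\<sigma> ^^ (t - k)) (Us ! i)))"
      using FL e uL by (intro pow_finsum) auto
    also have "\<dots> = (\<Oplus>i\<in>{..<d}. (\<sigma> ^^ k) (e i) \<otimes> Us ! i)"
    proof (intro finsum_cong' refl)
      fix i assume i: "i \<in> {..<d}"
      have "(\<sigma> ^^ k) ((\<sigma> ^^ (t - k)) (Us ! i)) = (\<sigma> ^^ (k + (t - k))) (Us ! i)"
        by (simp add: funpow_add)
      then have "(\<sigma> ^^ k) ((\<sigma> ^^ (t - k)) (Us ! i)) = Us ! i"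
        using ut i k by simp
      then show "(\<sigma> ^^ k) (e i \<otimes> (\<sigma> ^^ (t - k)) (Us ! i)) = (\<sigma> ^^ k) (e i) \<otimes> Us ! i"
        using FL e uL i by (simp add: pow_mult)
    qed (use FL e uL in auto)
    finally show "(\<sigma> ^^ k) (\<Oplus>i\<in>{..<d}. e i \<otimes> (\<sigma> ^^ (t - k)) (Us ! i)) =
      (\<Oplus>i\<in>{..<d}. (\<sigma> ^^ k) (e i) \<otimes> Us ! i)" .
  qed (use FL e uL in \<open>auto intro!: finsum_closed\<close>)
  also have "\<dots> = (\<Oplus>i\<in>{..<d}. \<Oplus>k\<in>{..<t}. (\<sigma> ^^ k) (e i) \<otimes> Us ! i)"
    using FL e uL by (intro finsum_swap) auto
  also have "\<dots> = (\<Oplus>i\<in>{..<d}. trace t (e i) \<otimes> Us ! i)"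
    unfolding trace_def using FL e uL
    by (intro finsum_cong' finsum_ldistr[symmetric]) (auto intro!: finsum_closed)
  also have "\<dots> = combine (map (\<lambda>i. trace t (e i)) [0..<length Us]) Us"
    using combine_eq_finsum[OF Us(1), of "\<lambda>i. trace t (e i)"] Us(3) FL e trace_closed by auto
  finally have "combine (map (\<lambda>i. trace t (e i)) [0..<length Us]) Us = \<zero>" by simp
  moreover have "set (map (\<lambda>i. trace t (e i)) [0..<length Us]) \<subseteq> K"
  proof -
    have "trace t (e i) \<in> K" if "i < d" for i
      using pow_trace[OF e[OF that]] trace_closed[OF FL[OF e[OF that]]] by (simp add: K fixed_def)
    then show ?thesis using Us(3) by auto
  qed
  ultimately have "set (take (length Us) (map (\<lambda>i. trace t (e i)) [0..<length Us])) \<subseteq> {\<zero>}"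
    using independent_imp_trivial_combine[OF Ksub Us(2)] by blast
  then have "(\<lambda>i. trace t (e i)) ` {0..<d} \<subseteq> {\<zero>}" using Us(3) by simp
  then have "trace t (e m) = \<zero>" using m(1) by (simp add: image_subset_iff)
  then show False using l \<open>z \<otimes> c m = l\<close> by (simp add: e_def)
qed

text \<open>The least positive \<open>t\<close> with \<sigma>^t trivial on \<open>L\<close>
  satisfies t \<le> d by the lower and d \<le> t by the upper bound.\<close>

lemma fixed_carrier_of_dimension:
  assumes K: "K = fixed 1" and dim: "dimension d K (carrier L)"
  shows "0 < d" "fixed d = carrier L" "\<And>k. 0 < k \<Longrightarrow> k < d \<Longrightarrow> \<exists>y\<in>carrier L. (\<sigma> ^^ k) y \<noteq> y"
proof -
  have Ksub: "subfield K L" using subfield_fixed K by simp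
  have Kfix: "\<sigma> x = x" if "x \<in> K" for x using that K by (simp add: fixed_def)
  define P where "P t \<longleftrightarrow> 0 < t \<and> (\<forall>y\<in>carrier L. (\<sigma> ^^ t) y = y)" for t
  have lower: "t \<le> d" if "\<And>k. 0 < k \<Longrightarrow> k < t \<Longrightarrow> \<not> P k" for t
    using that unfolding P_def by (intro dimension_lower_bound[OF Ksub carrier_is_subfield dim Kfix]) auto
  \<comment> \<open>If no power were trivial, the lower bound with t = d + 1 would give d + 1 \<le>
    d.\<close>
  have "\<exists>t. P t" using lower[of "Suc d"] by auto
  then obtain t where t: "P t" "\<And>k. k < t \<Longrightarrow> \<not> P k" by (metis LeastI not_less_Least)
  have fix_t: "fixed t = carrier L" using t(1) by (auto simp: fixed_def P_def)
  have dist: "\<exists>y\<in>carrier L. (\<sigma> ^^ k) y \<noteq> y" if "0 < k" "k < t" for k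
    using t(2)[OF that(2)] that(1) by (auto simp: P_def)
  have "d \<le> t" using t(1) dist dim fix_t K
    by (intro dimension_upper_bound[of t K]) (auto simp: P_def)
  then have "d = t" using lower t(2) by (simp add: le_antisym)
  then show "0 < d" "fixed d = carrier L" "\<And>k. 0 < k \<Longrightarrow> k < d \<Longrightarrow> \<exists>y\<in>carrier L. (\<sigma> ^^ k) y \<noteq> y"
    using t(1) fix_t dist by (auto simp: P_def)
qed

text \<open>For the least positive \<open>t\<close> with \<sigma>^t trivial on \<open>E\<close>, the
  bounds give t \<le> e, and [fixed t : K] \<le> t. Since \<open>E\<close> is contained in
  \<open>fixed t\<close>, all these degrees agree and the two fields coincide. This describes
  \<open>K_i\<close> as the fixed field of a power of \<sigma>.\<close>

lemma fixed_subfield_of_dimension: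
  assumes K: "K = fixed 1" and dim: "dimension d K (carrier L)"
    and E: "subfield E L" "K \<subseteq> E" "dimension e K E"
  shows "0 < e" "fixed e = E" "\<And>k. 0 < k \<Longrightarrow> k < e \<Longrightarrow> \<exists>y\<in>E. (\<sigma> ^^ k) y \<noteq> y"
proof -
  note d = fixed_carrier_of_dimension[OF K dim]
  have Ksub: "subfield K L" using subfield_fixed K by simp
  have Kfix: "\<sigma> x = x" if "x \<in> K" for x using that K by (simp add: fixed_def)
  have EL: "E \<subseteq> carrier L" using E subfieldE(3) by blast
  define P where "P t \<longleftrightarrow> 0 < t \<and> (\<forall>y\<in>E. (\<sigma> ^^ t) y = y)" for t
  have "P d" using d(1,2) EL by (auto simp: P_def fixed_def)
  then obtain t where t: "P t" "\<And>k. k < t \<Longrightarrow> \<not> P k" by (metis LeastI not_less_Least)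
  have dist: "\<exists>y\<in>E. (\<sigma> ^^ k) y \<noteq> y" if "0 < k" "k < t" for k
    using t(2)[OF that(2)] that(1) by (auto simp: P_def)
  have te: "t \<le> e" by (rule dimension_lower_bound[OF Ksub E(1,3) Kfix dist])
  have EF: "E \<subseteq> fixed t" using t(1) EL by (auto simp: P_def fixed_def)
  have "subalgebra K (fixed t) L"
    using subfield_fixed[of t] E(2) EF
    by (intro subalgebra.intro add.subgroupI) (auto simp: subalgebra_axioms_def
        intro: subringE[OF subfieldE(1)[OF subfield_fixed]] dest: subfieldE(3))
  then have "finite_dimension K (fixed t)"
    using subalbegra_incl_imp_finite_dimension[OF Ksub finite_dimensionI[OF dim]]
    by (auto simp: fixed_def)
  then obtain f where f: "dimension f K (fixed t)" by blast
  have ft: "f \<le> t"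
  proof (rule dimension_upper_bound[OF _ K f])
    show "\<exists>y\<in>fixed t. (\<sigma> ^^ k) y \<noteq> y" if "0 < k" "k < t" for k
      using dist[OF that] EF by blast
  qed (use t(1) in \<open>simp add: P_def\<close>)
  obtain Us where Us: "set Us \<subseteq> carrier L" "independent K Us" "length Us = e" "Span K Us = E"
    using exists_base[OF Ksub E(3)] by blast
  have UF: "set Us \<subseteq> fixed t" using Span_base_incl[OF Ksub Us(1)] Us(4) EF by simp
  have "e \<le> f" using independent_length_le_dimension[OF Ksub f Us(2) UF] Us(3) by simp
  then have eq: "e = f" "e = t" using te ft by auto
  have "Span K Us = fixed t"
    using independent_length_eq_dimension[OF Ksub f Us(2) UF] Us(3) eq by simp
  then show "0 < e" "fixed e = E" "\<And>k. 0 < k \<Longrightarrow> k < e \<Longrightarrow> \<exists>y\<in>E. (\<sigma> ^^ k) y \<noteq> y"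
    using t(1) dist eq Us(4) by (auto simp: P_def)
qed

end

section \<open>The Galois group and the fixed field of its generator\<close>

lemma subgroup_galois_group:
  assumes gal: "galois_extension L K"
  shows "subgroup (carrier (galois_group L K)) (BijGroup (carrier L))"
proof (rule group.subgroupI[OF group_BijGroup])
  interpret field L using gal by (simp add: galois_extension_def)
  have KL: "K \<subseteq> carrier L" using gal subfieldE(3) by (auto simp: galois_extension_def)
  let ?G = "galois_group L K"
  have G: "g \<in> Bij (carrier L)" "g \<in> ring_hom L L" "\<forall>x\<in>K. g x = x" if "g \<in> carrier ?G" for g
    using that by (auto simp: galois_group_def)
  show "carrier ?G \<subseteq> carrier (BijGroup (carrier L))" using G by (auto simp: BijGroup_def)
  have "(\<lambda>x\<in>carrier L. x) \<in> carrier ?G"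
    using KL by (auto simp: galois_group_def id_Bij intro!: ring_hom_memI)
  then show "carrier ?G \<noteq> {}" by blast
  show "g \<otimes>\<^bsub>BijGroup (carrier L)\<^esub> h \<in> carrier ?G"
    if g: "g \<in> carrier ?G" and h: "h \<in> carrier ?G" for g h
  proof -
    have "compose (carrier L) g h \<in> ring_hom L L"
      using G(2)[OF g] G(2)[OF h] by (auto simp: ring_hom_def Pi_def compose_def)
    moreover have "\<forall>x\<in>K. compose (carrier L) g h x = x"
      using G(3)[OF g] G(3)[OF h] KL by (auto simp: compose_def)
    ultimately show ?thesis
      using G(1)[OF g] G(1)[OF h] by (simp add: galois_group_def BijGroup_def compose_Bij)
  qed
  show "inv\<^bsub>BijGroup (carrier L)\<^esub> g \<in> carrier ?G" if g: "g \<in> carrier ?G" for g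
  proof -
    have b: "bij_betw g (carrier L) (carrier L)" using G(1)[OF g] by (simp add: Bij_def)
    let ?h = "inv_into (carrier L) g"
    have hL: "?h x \<in> carrier L" and gh: "g (?h x) = x" if "x \<in> carrier L" for x
      using b that by (auto simp: bij_betw_def inv_into_into f_inv_into_f)
    have hI: "?h x = y" if "y \<in> carrier L" "g y = x" for x y
      using b that by (auto simp: bij_betw_def)
    have "restrict ?h (carrier L) \<in> ring_hom L L"
      using G(2)[OF g] hL gh
      by (intro ring_hom_memI) (auto intro!: hI simp: ring_hom_def)
    moreover have "\<forall>x\<in>K. restrict ?h (carrier L) x = x"
      using G(3)[OF g] KL by (auto intro!: hI)
    ultimately show ?thesis
      using G(1)[OF g] by (simp add: galois_group_def inv_BijGroup restrict_inv_into_Bij)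
  qed
qed

lemma group_galois_group: "galois_extension L K \<Longrightarrow> group (galois_group L K)"
  using subgroup.subgroup_is_group[OF subgroup_galois_group group_BijGroup]
  by (simp add: galois_group_def)

text \<open>An element fixed by the generator is fixed by the whole group, and \<open>K\<close> is
  the field of invariants of the group.\<close>

lemma galois_group_cyclic:
  assumes gal: "galois_extension L K" and \<sigma>: "\<sigma> \<in> carrier (galois_group L K)"
    and gen: "generate (galois_group L K) {\<sigma>} = carrier (galois_group L K)"
  shows "field_endo L \<sigma>" "K = field_endo.fixed L \<sigma> 1"
proof -
  interpret field L using gal by (simp add: galois_extension_def)
  have "\<sigma> \<in> ring_hom L L" using \<sigma> by (simp add: galois_group_def)
  then show "field_endo L \<sigma>"
    by (simp add: field_endo_def field_endo_axioms_def field_axioms)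
  then interpret field_endo L \<sigma> .
  let ?G = "galois_group L K"
  have G: "g \<in> Bij (carrier L)" if "g \<in> carrier ?G" for g
    using that by (auto simp: galois_group_def)
  have "g x = x" if "g \<in> generate ?G {\<sigma>}" "x \<in> carrier L" "\<sigma> x = x" for g x
    using that(1)
  proof (induction rule: generate.induct)
    case one
    then show ?case using that by (simp add: galois_group_def BijGroup_def)
  next
    case (incl h)
    then show ?case using that by simp
  next
    case (inv h)
    have "inv\<^bsub>?G\<^esub> \<sigma> = inv\<^bsub>BijGroup (carrier L)\<^esub> \<sigma>"
      using group.m_inv_consistent[OF group_BijGroup subgroup_galois_group[OF gal] \<sigma>] by (simp add: galois_group_def)
    also have "\<dots> = restrict (inv_into (carrier L) \<sigma>) (carrier L)"
      using G[OF \<sigma>] by (simp add: inv_BijGroup)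
    finally show ?case
      using inv that G[OF \<sigma>] by (auto simp: Bij_def bij_betw_def intro!: inv_into_f_eq)
  next
    case (eng h1 h2)
    have "h1 \<in> Bij (carrier L)" "h2 \<in> Bij (carrier L)" using eng.hyps gen G by auto
    then have "h1 \<otimes>\<^bsub>?G\<^esub> h2 = compose (carrier L) h1 h2"
      by (simp add: galois_group_def BijGroup_def)
    then show ?case using eng.IH that(2) by (simp add: compose_def)
  qed
  then have "{x \<in> carrier L. \<forall>g\<in>carrier ?G. g x = x} = fixed 1"
    unfolding fixed_def using \<sigma> gen by auto
  then show "K = fixed 1" using gal by (simp add: galois_extension_def)
qed

section \<open>Semilinear functions on a finite set with automorphism\<close>

lemma funpow_closed: "f \<in> A \<rightarrow> A \<Longrightarrow> x \<in> A \<Longrightarrow> (f ^^ k) x \<in> A"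
  by (induction k) auto

text \<open>Here \<open>m\<close> is the exact order of \<sigma> on \<open>L\<close>, whereas \<psi>
  only satisfies \<psi>^m = id on \<open>Z\<close>: the cyclic group of order \<open>m\<close> acts
  on \<open>Z\<close> with arbitrary stabilizers.\<close>

locale semilinear_functions = field_endo L \<sigma> for L (structure) and \<sigma> +
  fixes Z :: "'x set" and \<psi> :: "'x \<Rightarrow> 'x" and m :: nat
  assumes finite_Z [simp]: "finite Z" and psi_closed: "\<psi> \<in> Z \<rightarrow> Z"
    and psi_pow: "x \<in> Z \<Longrightarrow> (\<psi> ^^ m) x = x"
    and m_pos: "0 < m" and fixed_m: "fixed m = carrier L"
    and sigma_faithful: "0 < k \<Longrightarrow> k < m \<Longrightarrow> \<exists>y\<in>carrier L. (\<sigma> ^^ k) y \<noteq> y"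
begin

text \<open>The invariants in the space of all functions \<open>Z \<rightarrow> L\<close> of the
  semilinear action f \<mapsto> \<sigma> \<circ> f \<circ> \<psi>^-1.\<close>

definition V :: "('x \<Rightarrow> 'a) set" where
  "V = {f \<in> Z \<rightarrow>\<^sub>E carrier L. \<forall>x\<in>Z. f (\<psi> x) = \<sigma> (f x)}"

lemma V_closed: "f \<in> V \<Longrightarrow> x \<in> Z \<Longrightarrow> f x \<in> carrier L"
  by (auto simp: V_def)

lemma psi_pow_closed: "x \<in> Z \<Longrightarrow> (\<psi> ^^ k) x \<in> Z"
  using funpow_closed[OF psi_closed] .

lemma V_pow: "f \<in> V \<Longrightarrow> x \<in> Z \<Longrightarrow> f ((\<psi> ^^ k) x) = (\<sigma> ^^ k) (f x)"
  by (induction k) (auto simp: V_def psi_pow_closed)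

lemma psi_pow_inj:
  assumes "x \<in> Z" "y \<in> Z" "(\<psi> ^^ k) x = (\<psi> ^^ k) y"
  shows "x = y"
proof -
  have pow: "(\<psi> ^^ (m * j)) z = z" if "z \<in> Z" for z j
    using that by (induction j) (auto simp: funpow_add psi_pow psi_pow_closed)
  have "(\<psi> ^^ (m * k - k)) ((\<psi> ^^ k) x) = (\<psi> ^^ (m * k - k)) ((\<psi> ^^ k) y)" using assms by simp
  moreover have "k \<le> m * k" using m_pos by simp
  then have "(\<psi> ^^ (m * k - k)) ((\<psi> ^^ k) z) = (\<psi> ^^ (m * k)) z" for z
    by (metis comp_apply funpow_add le_add_diff_inverse2)
  ultimately show ?thesis using pow assms(1,2) by metis
qed

lemma psi_bij: "inj_on \<psi> Z" "\<psi> ` Z = Z"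
proof -
  show "inj_on \<psi> Z" using psi_pow_inj[of _ _ 1] by (auto simp: inj_on_def)
  then show "\<psi> ` Z = Z" using psi_closed by (intro endo_inj_surj) auto
qed

lemma sigma_pow_m: "x \<in> carrier L \<Longrightarrow> (\<sigma> ^^ m) x = x"
  using fixed_m by (auto simp: fixed_def)

text \<open>The sum of all translates of the function with value \<open>l\<close> at
  \<open>z\<close> and 0 elsewhere. It runs over exponents and not over the points of the orbit,
  which keeps it equivariant when \<open>z\<close> has a nontrivial stabilizer.\<close>

definition orbit_fun :: "'a \<Rightarrow> 'x \<Rightarrow> 'x \<Rightarrow> 'a" where
  "orbit_fun l z = (\<lambda>x\<in>Z. \<Oplus>g\<in>{..<m}. if (\<psi> ^^ g) z = x then (\<sigma> ^^ g) l else \<zero>)"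

lemma orbit_fun_V:
  assumes l: "l \<in> carrier L" and z: "z \<in> Z"
  shows "orbit_fun l z \<in> V"
proof -
  have "orbit_fun l z (\<psi> x) = \<sigma> (orbit_fun l z x)" if x: "x \<in> Z" for x
  proof -
    have px: "\<psi> x \<in> Z" using psi_closed x by auto
    let ?F = "\<lambda>g. if (\<psi> ^^ g) z = \<psi> x then (\<sigma> ^^ g) l else \<zero>"
    have "\<sigma> (orbit_fun l z x) = (\<Oplus>g\<in>{..<m}. \<sigma> (if (\<psi> ^^ g) z = x then (\<sigma> ^^ g) l else \<zero>))"
      using pow_finsum[of "\<lambda>g. if (\<psi> ^^ g) z = x then (\<sigma> ^^ g) l else \<zero>" "{..<m}" 1] x l
      by (auto simp: orbit_fun_def)
    also have "\<dots> = (\<Oplus>g\<in>{..<m}. ?F (Suc g))"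
    proof (intro finsum_cong' refl)
      fix g
      have "\<psi> ((\<psi> ^^ g) z) = \<psi> x \<longleftrightarrow> (\<psi> ^^ g) z = x"
        using psi_pow_inj[of "(\<psi> ^^ g) z" x 1] psi_pow_closed z x by auto
      then show "\<sigma> (if (\<psi> ^^ g) z = x then (\<sigma> ^^ g) l else \<zero>) = ?F (Suc g)"
        using pow_zero[of 1] by simp
    next
      show "(\<lambda>g. ?F (Suc g)) \<in> {..<m} \<rightarrow> carrier L"
        using l pow_closed[of l "Suc _"] by (auto simp del: funpow.simps)
    qed
    also have "\<dots> = (\<Oplus>g\<in>{..<m}. ?F g)"
      using l z psi_pow sigma_pow_m by (intro finsum_cyclic_shift) auto
    also have "\<dots> = orbit_fun l z (\<psi> x)" using px by (simp add: orbit_fun_def)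
    finally show ?thesis by simp
  qed
  moreover have "orbit_fun l z \<in> Z \<rightarrow>\<^sub>E carrier L"
    using l by (auto simp: orbit_fun_def intro!: finsum_closed)
  ultimately show ?thesis by (simp add: V_def)
qed

text \<open>Galois descent for \<open>V\<close> in the form of a pair of dual families.\<close>

lemma frame_exists:
  "\<exists>J v w. finite (J :: ('x \<times> nat) set) \<and> (\<forall>j\<in>J. v j \<in> V \<and> w j \<in> V) \<and>
    (\<forall>x\<in>Z. \<forall>y\<in>Z. (\<Oplus>j\<in>J. v j x \<otimes> w j y) = (if x = y then \<one> else \<zero>))"
proof -
  have "\<exists>q a b. (\<forall>j<q. a j \<in> fixed m \<and> b j \<in> fixed m) \<and>
    (\<forall>k<m. (\<Oplus>j\<in>{..<q::nat}. a j \<otimes> (\<sigma> ^^ k) (b j)) = (if k = 0 then \<one> else \<zero>))"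
    using sigma_faithful fixed_m by (intro fixed_coordinates) auto
  then obtain q a b where ab: "\<And>j. j < q \<Longrightarrow> a j \<in> carrier L" "\<And>j. j < q \<Longrightarrow> b j \<in> carrier L"
    and coord: "\<And>k. k < m \<Longrightarrow>
      (\<Oplus>j\<in>{..<q::nat}. a j \<otimes> (\<sigma> ^^ k) (b j)) = (if k = 0 then \<one> else \<zero>)"
    using fixed_m by blast
  obtain c where c: "c \<in> carrier L" "trace m c = \<one>"
    using trace_surj[of m] m_pos sigma_faithful fixed_m by auto
  \<comment> \<open>Applying \<sigma>^h to the coordinate relation for the exponent
    \<open>k\<close>, the residue of g - h modulo \<open>m\<close>, gives orthogonality for every
    pair of exponents.\<close>
  have coord2: "(\<Oplus>j\<in>{..<q}. (\<sigma> ^^ g) (b j) \<otimes> (\<sigma> ^^ h) (a j)) = (if g = h then \<one> else \<zero>)"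
    if gh: "g < m" "h < m" for g h
  proof -
    define k where "k = (if h \<le> g then g - h else m + g - h)"
    have k: "k < m" "k = 0 \<longleftrightarrow> g = h" using gh by (auto simp: k_def)
    have sk: "(\<sigma> ^^ h) ((\<sigma> ^^ k) x) = (\<sigma> ^^ g) x" if "x \<in> carrier L" for x
    proof (cases "h \<le> g")
      case True
      then have "h + k = g" by (simp add: k_def)
      then show ?thesis by (metis comp_apply funpow_add)
    next
      case False
      then have "h + k = g + m" using gh by (simp add: k_def)
      then show ?thesis using that sigma_pow_m by (metis comp_apply funpow_add)
    qed
    have "(\<Oplus>j\<in>{..<q}. (\<sigma> ^^ g) (b j) \<otimes> (\<sigma> ^^ h) (a j)) =
        (\<Oplus>j\<in>{..<q}. (\<sigma> ^^ h) (a j \<otimes> (\<sigma> ^^ k) (b j)))"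
      using ab sk by (intro finsum_cong') (auto simp: pow_mult m_comm)
    also have "\<dots> = (\<sigma> ^^ h) (\<Oplus>j\<in>{..<q}. a j \<otimes> (\<sigma> ^^ k) (b j))"
      using ab by (intro pow_finsum[symmetric]) auto
    also have "\<dots> = (if g = h then \<one> else \<zero>)"
      using coord[OF k(1)] k(2) by simp
    finally show ?thesis .
  qed
  define v where "v = (\<lambda>(z, j). orbit_fun (b j) z)"
  \<comment> \<open>The factor \<open>c\<close> of trace 1 corrects a multiplicity: for x = y each
    exponent g < m contributes once, through the point z with \<psi>^g z = x, and the contributions
    \<sigma>^g(c) add up to the trace of \<open>c\<close>.\<close>
  define w where "w = (\<lambda>(z, j). orbit_fun (c \<otimes> a j) z)"
  have vw: "v j \<in> V \<and> w j \<in> V" if "j \<in> Z \<times> {..<q}" for j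
    using that ab c by (auto simp: v_def w_def intro!: orbit_fun_V)
  have "(\<Oplus>j\<in>Z \<times> {..<q}. v j x \<otimes> w j y) = (if x = y then \<one> else \<zero>)"
    if x: "x \<in> Z" and y: "y \<in> Z" for x y
  proof -
    let ?d = "\<lambda>z g x u. if (\<psi> ^^ g) z = x then u else \<zero>"
    have inner: "(\<Oplus>j\<in>{..<q}. v (z, j) x \<otimes> w (z, j) y) =
        (\<Oplus>g\<in>{..<m}. if (\<psi> ^^ g) z = x then (if x = y then (\<sigma> ^^ g) c else \<zero>) else \<zero>)"
      if z: "z \<in> Z" for z
    proof -
      have "(\<Oplus>j\<in>{..<q}. v (z, j) x \<otimes> w (z, j) y) =
        (\<Oplus>j\<in>{..<q}. \<Oplus>g\<in>{..<m}. \<Oplus>h\<in>{..<m}.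
          ?d z g x (?d z h y ((\<sigma> ^^ h) c \<otimes> ((\<sigma> ^^ g) (b j) \<otimes> (\<sigma> ^^ h) (a j)))))"
      proof (intro finsum_cong' refl)
        fix j assume "j \<in> {..<q}"
        then have j: "a j \<in> carrier L" "b j \<in> carrier L" using ab by auto
        have "v (z, j) x \<otimes> w (z, j) y = (\<Oplus>g\<in>{..<m}. ?d z g x ((\<sigma> ^^ g) (b j))) \<otimes>
            (\<Oplus>h\<in>{..<m}. ?d z h y ((\<sigma> ^^ h) (c \<otimes> a j)))"
          using x y by (simp add: v_def w_def orbit_fun_def)
        also have "\<dots> = (\<Oplus>g\<in>{..<m}. ?d z g x ((\<sigma> ^^ g) (b j)) \<otimes>
            (\<Oplus>h\<in>{..<m}. ?d z h y ((\<sigma> ^^ h) (c \<otimes> a j))))"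
          using j c by (intro finsum_ldistr) (auto intro!: finsum_closed)
        also have "\<dots> = (\<Oplus>g\<in>{..<m}. \<Oplus>h\<in>{..<m}. ?d z g x ((\<sigma> ^^ g) (b j)) \<otimes>
            ?d z h y ((\<sigma> ^^ h) (c \<otimes> a j)))"
          using j c by (intro finsum_cong' finsum_rdistr) (auto intro!: finsum_closed)
        also have "\<dots> = (\<Oplus>g\<in>{..<m}. \<Oplus>h\<in>{..<m}.
          ?d z g x (?d z h y ((\<sigma> ^^ h) c \<otimes> ((\<sigma> ^^ g) (b j) \<otimes> (\<sigma> ^^ h) (a j)))))"
          using j c by (intro finsum_cong' refl) (auto intro!: finsum_closed simp: pow_mult m_lcomm)
        finally show "v (z, j) x \<otimes> w (z, j) y = (\<Oplus>g\<in>{..<m}. \<Oplus>h\<in>{..<m}.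
          ?d z g x (?d z h y ((\<sigma> ^^ h) c \<otimes> ((\<sigma> ^^ g) (b j) \<otimes> (\<sigma> ^^ h) (a j)))))" .
      qed (use ab c in \<open>auto intro!: finsum_closed\<close>)
      also have "\<dots> = (\<Oplus>g\<in>{..<m}. \<Oplus>j\<in>{..<q}. \<Oplus>h\<in>{..<m}.
          ?d z g x (?d z h y ((\<sigma> ^^ h) c \<otimes> ((\<sigma> ^^ g) (b j) \<otimes> (\<sigma> ^^ h) (a j)))))"
        using ab c by (intro finsum_swap) (auto intro!: finsum_closed)
      also have "\<dots> = (\<Oplus>g\<in>{..<m}. \<Oplus>h\<in>{..<m}. \<Oplus>j\<in>{..<q}.
          ?d z g x (?d z h y ((\<sigma> ^^ h) c \<otimes> ((\<sigma> ^^ g) (b j) \<otimes> (\<sigma> ^^ h) (a j)))))"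
        using ab c by (intro finsum_cong' finsum_swap) (auto intro!: finsum_closed)
      also have "\<dots> = (\<Oplus>g\<in>{..<m}. \<Oplus>h\<in>{..<m}.
          if h = g then ?d z g x (?d z h y ((\<sigma> ^^ h) c)) else \<zero>)"
      proof (intro finsum_cong' refl)
        fix g h assume "g \<in> {..<m}" "h \<in> {..<m}"
        then have gh: "g < m" "h < m" by auto
        have "(\<Oplus>j\<in>{..<q}. (\<sigma> ^^ h) c \<otimes> ((\<sigma> ^^ g) (b j) \<otimes> (\<sigma> ^^ h) (a j))) =
          (\<sigma> ^^ h) c \<otimes> (\<Oplus>j\<in>{..<q}. (\<sigma> ^^ g) (b j) \<otimes> (\<sigma> ^^ h) (a j))"
          using ab c by (intro finsum_rdistr[symmetric]) auto
        then show "(\<Oplus>j\<in>{..<q}.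
          ?d z g x (?d z h y ((\<sigma> ^^ h) c \<otimes> ((\<sigma> ^^ g) (b j) \<otimes> (\<sigma> ^^ h) (a j))))) =
          (if h = g then ?d z g x (?d z h y ((\<sigma> ^^ h) c)) else \<zero>)"
          using c coord2[OF gh]
          by (cases "h = g"; cases "(\<psi> ^^ g) z = x"; cases "(\<psi> ^^ h) z = y") auto
      qed (use c in \<open>auto intro!: finsum_closed\<close>)
      also have "\<dots> = (\<Oplus>g\<in>{..<m}. ?d z g x (?d z g y ((\<sigma> ^^ g) c)))"
        using c by (intro finsum_cong' finsum_delta) auto
      also have "\<dots> = (\<Oplus>g\<in>{..<m}. ?d z g x (if x = y then (\<sigma> ^^ g) c else \<zero>))"
        using c by (intro finsum_cong') auto
      finally show ?thesis .
    qed
    have "(\<Oplus>j\<in>Z \<times> {..<q}. v j x \<otimes> w j y) = (\<Oplus>j\<in>(\<Union>z\<in>Z. Pair z ` {..<q}). v j x \<otimes> w j y)"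
      by (rule arg_cong[of _ _ "finsum L _"]) auto
    also have "\<dots> = (\<Oplus>z\<in>Z. \<Oplus>j\<in>Pair z ` {..<q}. v j x \<otimes> w j y)"
      using vw V_closed x y
      by (intro add.finprod_UN_disjoint) (auto simp: pairwise_def disjnt_def)
    also have "\<dots> = (\<Oplus>z\<in>Z. \<Oplus>j\<in>{..<q}. v (z, j) x \<otimes> w (z, j) y)"
      using vw V_closed x y
      by (intro finsum_cong' add.finprod_reindex) (auto simp: inj_on_def intro!: finsum_closed)
    also have "\<dots> = (\<Oplus>z\<in>Z. \<Oplus>g\<in>{..<m}. ?d z g x (if x = y then (\<sigma> ^^ g) c else \<zero>))"
      using c inner by (intro finsum_cong'[OF refl]) (auto intro!: finsum_closed)
    also have "\<dots> = (\<Oplus>g\<in>{..<m}. \<Oplus>z\<in>Z. ?d z g x (if x = y then (\<sigma> ^^ g) c else \<zero>))"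
      using c by (intro finsum_swap) auto
    also have "\<dots> = (\<Oplus>g\<in>{..<m}. if x = y then (\<sigma> ^^ g) c else \<zero>)"
    proof (intro finsum_cong' refl)
      fix g assume g: "g \<in> {..<m}"
      have uniq: "(\<psi> ^^ g) z = x \<longleftrightarrow> z = (\<psi> ^^ (m - g)) x" if "z \<in> Z" for z
      proof -
        have "(\<psi> ^^ g) ((\<psi> ^^ (m - g)) x) = (\<psi> ^^ (g + (m - g))) x" by (simp add: funpow_add)
        then have "(\<psi> ^^ g) ((\<psi> ^^ (m - g)) x) = x" using g x psi_pow by simp
        then show ?thesis using psi_pow_inj[OF that psi_pow_closed[OF x]] by metis
      qed
      have "(\<Oplus>z\<in>Z. ?d z g x (if x = y then (\<sigma> ^^ g) c else \<zero>)) =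
          (\<Oplus>z\<in>Z. if z = (\<psi> ^^ (m - g)) x then (if x = y then (\<sigma> ^^ g) c else \<zero>) else \<zero>)"
        using uniq c by (intro finsum_cong') auto
      then show "(\<Oplus>z\<in>Z. ?d z g x (if x = y then (\<sigma> ^^ g) c else \<zero>)) =
          (if x = y then (\<sigma> ^^ g) c else \<zero>)"
        using finsum_delta[of Z "(\<psi> ^^ (m - g)) x" "\<lambda>_. if x = y then (\<sigma> ^^ g) c else \<zero>"]
          psi_pow_closed x c by auto
    qed (use c in auto)
    also have "\<dots> = (if x = y then \<one> else \<zero>)"
      using c(2) by (auto simp: trace_def)
    finally show ?thesis .
  qed
  then show ?thesis using vw
    by (intro exI[of _ "Z \<times> {..<q}"] exI[of _ v] exI[of _ w]) auto
qed

end


section \<open>Forms of function spaces\<close>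

lemma self_module_sel [simp]:
  "carrier (self_module L) = carrier L" "\<zero>\<^bsub>self_module L\<^esub> = \<zero>\<^bsub>L\<^esub>"
  "x \<oplus>\<^bsub>self_module L\<^esub> y = x \<oplus>\<^bsub>L\<^esub> y" "x \<odot>\<^bsub>self_module L\<^esub> y = x \<otimes>\<^bsub>L\<^esub> y"
  by (simp_all add: self_module_def)

lemma finsum_structure_cong:
  assumes "carrier A = carrier B" "add A = add B" "\<zero>\<^bsub>A\<^esub> = \<zero>\<^bsub>B\<^esub>"
  shows "finsum A f I = finsum B f I"
  using assms by (simp add: finsum_def finprod_def)

lemma finsum_self_module [simp]: "finsum (self_module L) f I = finsum L f I"
  by (rule finsum_structure_cong) (simp_all add: self_module_def)

lemma (in cring) module_self_module: "module R (self_module R)"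
proof (rule moduleI)
  show "abelian_group (self_module R)"
    by (rule abelian_groupI) (auto simp: a_ac intro: l_neg)
qed (auto simp: is_cring l_distr r_distr m_assoc)

lemma module_restrict_scalars:
  assumes "module R P" "cring (R\<lparr>carrier := K\<rparr>)" "K \<subseteq> carrier R"
  shows "module (R\<lparr>carrier := K\<rparr>) P"
proof -
  interpret module R P by fact
  show ?thesis
    using assms(2) assms(3)[unfolded subset_iff] M.abelian_group_axioms
    by (intro moduleI) (simp_all add: smult_l_distr smult_r_distr smult_assoc1)
qed

lemma (in ring) cring_subfield: "subfield K R \<Longrightarrow> cring (R\<lparr>carrier := K\<rparr>)"
  using subfield_iff(2) fieldE(1) by blast

text \<open>An abstract module \<open>B\<close> over the fixed field \<open>E\<close>, with \<kappa>
  identifying its elements with functions in \<open>V\<close>. It is instantiated with the descended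
  algebra, with the full group algebra for the trivial twist, and with the base change.\<close>

locale semilinear_form = semilinear_functions L \<sigma> Z \<psi> m
  for L (structure) and \<sigma> and Z :: "'x set" and \<psi> m +
  fixes E :: "'a set" and B :: "('a, 't, 'y) module_scheme" and \<kappa> :: "'t \<Rightarrow> 'x \<Rightarrow> 'a"
  assumes E_fixed: "E = fixed 1" and module_B: "module (L\<lparr>carrier := E\<rparr>) B"
    and kappa_bij: "bij_betw \<kappa> (carrier B) V"
    and kappa_add: "\<lbrakk>t \<in> carrier B; u \<in> carrier B; x \<in> Z\<rbrakk> \<Longrightarrow> \<kappa> (t \<oplus>\<^bsub>B\<^esub> u) x = \<kappa> t x \<oplus> \<kappa> u x"
    and kappa_smult: "\<lbrakk>c \<in> E; t \<in> carrier B; x \<in> Z\<rbrakk> \<Longrightarrow> \<kappa> (c \<odot>\<^bsub>B\<^esub> t) x = c \<otimes> \<kappa> t x"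
begin

abbreviation "S \<equiv> L\<lparr>carrier := E\<rparr>"

sublocale BB: module_pair S B B
  by (rule module_pair.intro) (rule module_B)+

lemma E_subfield: "subfield E L"
  using subfield_fixed E_fixed by simp

lemma E_closed: "c \<in> E \<Longrightarrow> c \<in> carrier L"
  using E_fixed by (simp add: fixed_def)

lemma module_L: "module S (self_module L)"
  by (rule module_restrict_scalars[OF module_self_module cring_subfield[OF E_subfield]])
    (auto simp: E_closed)

lemma kappa_V: "t \<in> carrier B \<Longrightarrow> \<kappa> t \<in> V"
  using kappa_bij by (auto simp: bij_betw_def)

lemma kappa_closed: "t \<in> carrier B \<Longrightarrow> x \<in> Z \<Longrightarrow> \<kappa> t x \<in> carrier L"
  using kappa_V V_closed by blast

lemma kappa_finsum:
  assumes g: "g \<in> I \<rightarrow> carrier B" and x: "x \<in> Z"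
  shows "\<kappa> (\<Oplus>\<^bsub>B\<^esub>i\<in>I. g i) x = (\<Oplus>i\<in>I. \<kappa> (g i) x)"
  by (rule additive_finsum[OF BB.M.M.abelian_group_axioms abelian_group_axioms, of "\<lambda>t. \<kappa> t x"])
    (use x g in \<open>auto simp: kappa_add kappa_closed\<close>)

lemma kappa_eqI:
  assumes "t \<in> carrier B" "u \<in> carrier B" "\<And>x. x \<in> Z \<Longrightarrow> \<kappa> t x = \<kappa> u x"
  shows "t = u"
proof -
  have "\<kappa> t = \<kappa> u"
    using kappa_V[OF assms(1)] kappa_V[OF assms(2)] assms(3)
    by (intro extensionalityI[of _ Z]) (auto simp: V_def PiE_def)
  then show ?thesis using kappa_bij assms(1,2) by (auto simp: bij_betw_def inj_on_def)
qed

definition kappa_inv :: "('x \<Rightarrow> 'a) \<Rightarrow> 't" where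
  "kappa_inv = inv_into (carrier B) \<kappa>"

lemma kappa_inv: "f \<in> V \<Longrightarrow> kappa_inv f \<in> carrier B" "f \<in> V \<Longrightarrow> \<kappa> (kappa_inv f) = f"
  using kappa_bij unfolding kappa_inv_def bij_betw_def
  by (auto simp: inv_into_into f_inv_into_f)

text \<open>The image of a tensor under B \<otimes> B \<rightarrow> L^Z \<otimes> L^Z, the target
  being read as functions on \<open>Z \<times> Z\<close>.\<close>

definition kappa2 :: "('t \<times> 't \<Rightarrow> 'a) set \<Rightarrow> 'x \<Rightarrow> 'x \<Rightarrow> 'a" where
  "kappa2 u x y = tensor_lift S (self_module L) (\<lambda>t t'. \<kappa> t x \<otimes> \<kappa> t' y) u"

lemma bilinear_kappa:
  "x \<in> Z \<Longrightarrow> y \<in> Z \<Longrightarrow> bilinear_map S B B (self_module L) (\<lambda>t t'. \<kappa> t x \<otimes> \<kappa> t' y)"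
  by (auto simp: bilinear_map_def kappa_closed kappa_add kappa_smult l_distr r_distr m_ac E_closed)

lemma kappa2_pure:
  "\<lbrakk>t \<in> carrier B; u \<in> carrier B; x \<in> Z; y \<in> Z\<rbrakk> \<Longrightarrow> kappa2 (BB.pt t u) x y = \<kappa> t x \<otimes> \<kappa> u y"
  unfolding kappa2_def by (simp add: BB.tensor_lift_pure[OF module_L bilinear_kappa])

lemma kappa2_add:
  "\<lbrakk>t \<in> carrier BB.T; u \<in> carrier BB.T; x \<in> Z; y \<in> Z\<rbrakk> \<Longrightarrow>
    kappa2 (t \<oplus>\<^bsub>BB.T\<^esub> u) x y = kappa2 t x y \<oplus> kappa2 u x y"
  unfolding kappa2_def by (simp add: BB.tensor_lift_add[OF module_L bilinear_kappa])

lemma kappa2_smult: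
  "\<lbrakk>c \<in> E; t \<in> carrier BB.T; x \<in> Z; y \<in> Z\<rbrakk> \<Longrightarrow>
    kappa2 (c \<odot>\<^bsub>BB.T\<^esub> t) x y = c \<otimes> kappa2 t x y"
  unfolding kappa2_def by (simp add: BB.tensor_lift_smult[OF module_L bilinear_kappa])

lemma kappa2_zero: "\<lbrakk>x \<in> Z; y \<in> Z\<rbrakk> \<Longrightarrow> kappa2 \<zero>\<^bsub>BB.T\<^esub> x y = \<zero>"
  unfolding kappa2_def by (simp add: BB.tensor_lift_zero[OF module_L bilinear_kappa])

lemma kappa2_closed: "\<lbrakk>t \<in> carrier BB.T; x \<in> Z; y \<in> Z\<rbrakk> \<Longrightarrow> kappa2 t x y \<in> carrier L"
  unfolding kappa2_def using BB.tensor_lift_closed[OF module_L bilinear_kappa] by simp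

lemma kappa2_finsum:
  "\<lbrakk>g \<in> I \<rightarrow> carrier BB.T; x \<in> Z; y \<in> Z\<rbrakk> \<Longrightarrow>
    kappa2 (\<Oplus>\<^bsub>BB.T\<^esub>i\<in>I. g i) x y = (\<Oplus>i\<in>I. kappa2 (g i) x y)"
  unfolding kappa2_def by (simp add: BB.tensor_lift_finsum[OF module_L bilinear_kappa])

lemma kappa2_equivariant:
  assumes "u \<in> carrier BB.T" "x \<in> Z" "y \<in> Z"
  shows "kappa2 u (\<psi> x) (\<psi> y) = \<sigma> (kappa2 u x y)"
proof -
  have p: "\<psi> x \<in> Z" "\<psi> y \<in> Z" using psi_closed assms by auto
  note hom = pow_add[of _ _ 1, simplified] pow_mult[of _ _ 1, simplified] pow_zero[of 1, simplified]
  show ?thesis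
    using assms(1)
  proof (induction rule: BB.tensor_induct)
    case zero
    then show ?case using assms p by (simp add: kappa2_zero hom)
  next
    case (pure t u)
    then show ?case
      using assms p kappa_V[OF pure(1)] kappa_V[OF pure(2)]
      by (simp add: kappa2_pure hom kappa_closed V_def)
  next
    case (add t u)
    then show ?case using assms p by (simp add: kappa2_add hom kappa2_closed)
  qed
qed

text \<open>Applying \<sigma> to the sum only permutes its terms, since \<psi> permutes
  \<open>Z\<close>.\<close>

lemma sum_product_fixed:
  assumes "f \<in> V" "g \<in> V"
  shows "(\<Oplus>x\<in>Z. f x \<otimes> g x) \<in> E"
proof -
  note inj = psi_bij(1) and img = psi_bij(2)
  have fg: "f x \<in> carrier L" "g x \<in> carrier L" if "x \<in> Z" for x using assms V_closed that by auto
  have "\<sigma> (\<Oplus>x\<in>Z. f x \<otimes> g x) = (\<Oplus>x\<in>Z. \<sigma> (f x \<otimes> g x))"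
    using pow_finsum[of "\<lambda>x. f x \<otimes> g x" Z 1] fg by auto
  also have "\<dots> = (\<Oplus>x\<in>Z. f (\<psi> x) \<otimes> g (\<psi> x))"
    using assms fg psi_closed pow_mult[of _ _ 1] by (intro finsum_cong'[OF refl]) (auto simp: V_def)
  also have "\<dots> = (\<Oplus>x\<in>\<psi> ` Z. f x \<otimes> g x)"
    using inj fg psi_closed by (intro add.finprod_reindex[symmetric]) auto
  finally show ?thesis using fg img unfolding E_fixed by (auto simp: fixed_def intro!: finsum_closed)
qed

definition frame :: "('x \<times> nat) set \<times> ('x \<times> nat \<Rightarrow> 'x \<Rightarrow> 'a) \<times> ('x \<times> nat \<Rightarrow> 'x \<Rightarrow> 'a)" where
  "frame = (SOME (J, v, w). finite J \<and> (\<forall>j\<in>J. v j \<in> V \<and> w j \<in> V) \<and>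
    (\<forall>x\<in>Z. \<forall>y\<in>Z. (\<Oplus>j\<in>J. v j x \<otimes> w j y) = (if x = y then \<one> else \<zero>)))"

definition "fJ = fst frame"
definition "fv = fst (snd frame)"
definition "fw = snd (snd frame)"

lemma frame:
  "finite fJ" "j \<in> fJ \<Longrightarrow> fv j \<in> V" "j \<in> fJ \<Longrightarrow> fw j \<in> V"
  "\<lbrakk>x \<in> Z; y \<in> Z\<rbrakk> \<Longrightarrow> (\<Oplus>j\<in>fJ. fv j x \<otimes> fw j y) = (if x = y then \<one> else \<zero>)"
proof -
  let ?P = "\<lambda>(J, v, w). finite J \<and> (\<forall>j\<in>J. v j \<in> V \<and> w j \<in> V) \<and>
    (\<forall>x\<in>Z. \<forall>y\<in>Z. (\<Oplus>j\<in>J. v j x \<otimes> w j y) = (if x = y then \<one> else \<zero>))"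
  have "\<exists>p :: ('x \<times> nat) set \<times> _. ?P p" using frame_exists by (simp add: split_paired_Ex)
  then have "?P frame" unfolding frame_def by (rule someI_ex)
  then have P: "?P (fJ, fv, fw)" by (simp add: fJ_def fv_def fw_def)
  then show "finite fJ" "j \<in> fJ \<Longrightarrow> fv j \<in> V" "j \<in> fJ \<Longrightarrow> fw j \<in> V"
    "\<lbrakk>x \<in> Z; y \<in> Z\<rbrakk> \<Longrightarrow> (\<Oplus>j\<in>fJ. fv j x \<otimes> fw j y) = (if x = y then \<one> else \<zero>)"
    by auto
qed

text \<open>The coordinate of \<open>f\<close> along v_j, namely its pairing with w_j. It lies in
  \<open>E\<close> for \<open>f\<close> in \<open>V\<close>, but is also taken of arbitrary
  functions, such as those of one variable obtained from a function of two.\<close>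

definition coef :: "('x \<times> nat) \<Rightarrow> ('x \<Rightarrow> 'a) \<Rightarrow> 'a" where
  "coef j f = (\<Oplus>x\<in>Z. fw j x \<otimes> f x)"

lemma frame_expansion:
  assumes f: "\<And>x. x \<in> Z \<Longrightarrow> f x \<in> carrier L" and y: "y \<in> Z"
  shows "(\<Oplus>j\<in>fJ. fv j y \<otimes> coef j f) = f y"
proof -
  have vw: "fv j x \<in> carrier L" "fw j x \<in> carrier L" if "j \<in> fJ" "x \<in> Z" for j x
    using frame V_closed that by blast+
  have "(\<Oplus>j\<in>fJ. fv j y \<otimes> coef j f) = (\<Oplus>j\<in>fJ. \<Oplus>x\<in>Z. fv j y \<otimes> (fw j x \<otimes> f x))"
    unfolding coef_def using vw f y
    by (intro finsum_cong'[OF refl] finsum_rdistr) (auto intro!: finsum_closed)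
  also have "\<dots> = (\<Oplus>x\<in>Z. \<Oplus>j\<in>fJ. fv j y \<otimes> (fw j x \<otimes> f x))"
    using vw f y frame(1) by (intro finsum_swap) auto
  also have "\<dots> = (\<Oplus>x\<in>Z. if x = y then f x else \<zero>)"
  proof (intro finsum_cong'[OF refl])
    fix x assume x: "x \<in> Z"
    have "(\<Oplus>j\<in>fJ. fv j y \<otimes> (fw j x \<otimes> f x)) = (\<Oplus>j\<in>fJ. (fv j y \<otimes> fw j x) \<otimes> f x)"
      using vw f x y by (intro finsum_cong'[OF refl]) (auto simp: m_assoc)
    also have "\<dots> = (\<Oplus>j\<in>fJ. fv j y \<otimes> fw j x) \<otimes> f x"
      using vw f x y frame(1) by (intro finsum_ldistr[symmetric]) auto
    finally show "(\<Oplus>j\<in>fJ. fv j y \<otimes> (fw j x \<otimes> f x)) = (if x = y then f x else \<zero>)"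
      using frame(4)[OF y x] f x by auto
  qed (use f in auto)
  also have "\<dots> = f y" using y f by (intro finsum_delta) auto
  finally show ?thesis .
qed

lemma coef_E: "j \<in> fJ \<Longrightarrow> f \<in> V \<Longrightarrow> coef j f \<in> E"
  unfolding coef_def using frame by (intro sum_product_fixed) auto

lemma coef_closed: "j \<in> fJ \<Longrightarrow> (\<And>x. x \<in> Z \<Longrightarrow> f x \<in> carrier L) \<Longrightarrow> coef j f \<in> carrier L"
  unfolding coef_def using frame V_closed by (intro finsum_closed) auto

lemma kappa_expansion:
  assumes t: "t \<in> carrier B"
  shows "(\<Oplus>\<^bsub>B\<^esub>j\<in>fJ. coef j (\<kappa> t) \<odot>\<^bsub>B\<^esub> kappa_inv (fv j)) = t"
proof (rule kappa_eqI)
  have c: "coef j (\<kappa> t) \<in> E" if "j \<in> fJ" for j using coef_E kappa_V t that by blast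
  have v: "kappa_inv (fv j) \<in> carrier B" "\<kappa> (kappa_inv (fv j)) = fv j" if "j \<in> fJ" for j
    using frame kappa_inv that by auto
  have cv: "(\<lambda>j. coef j (\<kappa> t) \<odot>\<^bsub>B\<^esub> kappa_inv (fv j)) \<in> fJ \<rightarrow> carrier B"
    using c v BB.M.smult_closed by auto
  then show "(\<Oplus>\<^bsub>B\<^esub>j\<in>fJ. coef j (\<kappa> t) \<odot>\<^bsub>B\<^esub> kappa_inv (fv j)) \<in> carrier B"
    by (rule BB.M.M.finsum_closed)
  fix x assume x: "x \<in> Z"
  have "\<kappa> (\<Oplus>\<^bsub>B\<^esub>j\<in>fJ. coef j (\<kappa> t) \<odot>\<^bsub>B\<^esub> kappa_inv (fv j)) x =
      (\<Oplus>j\<in>fJ. \<kappa> (coef j (\<kappa> t) \<odot>\<^bsub>B\<^esub> kappa_inv (fv j)) x)"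
    using cv x by (rule kappa_finsum)
  also have "\<dots> = (\<Oplus>j\<in>fJ. fv j x \<otimes> coef j (\<kappa> t))"
    using c v x E_closed V_closed frame(2)
    by (intro finsum_cong'[OF refl]) (auto simp: kappa_smult m_comm)
  also have "\<dots> = \<kappa> t x" using frame_expansion[of "\<kappa> t" x] x t kappa_closed by simp
  finally show "\<kappa> (\<Oplus>\<^bsub>B\<^esub>j\<in>fJ. coef j (\<kappa> t) \<odot>\<^bsub>B\<^esub> kappa_inv (fv j)) x = \<kappa> t x" .
qed (rule t)

text \<open>The inverse of \<open>kappa2\<close>: \<open>D\<close> is expanded in its first variable
  along the v_j, and the coefficients are functions of the second variable that again belong to
  \<open>V\<close>.\<close>

definition tensor_of :: "('x \<Rightarrow> 'x \<Rightarrow> 'a) \<Rightarrow> ('t \<times> 't \<Rightarrow> 'a) set" where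
  "tensor_of D = (\<Oplus>\<^bsub>BB.T\<^esub>j\<in>fJ. BB.pt (kappa_inv (fv j))
    (kappa_inv (\<lambda>y\<in>Z. coef j (\<lambda>x. D x y))))"

definition "equivariant2 D \<longleftrightarrow> (\<forall>x\<in>Z. \<forall>y\<in>Z. D x y \<in> carrier L \<and> D (\<psi> x) (\<psi> y) = \<sigma> (D x y))"

lemma coef_V:
  assumes D: "equivariant2 D" and j: "j \<in> fJ"
  shows "(\<lambda>y\<in>Z. coef j (\<lambda>x. D x y)) \<in> V"
proof -
  note inj = psi_bij(1) and img = psi_bij(2)
  have p: "\<psi> x \<in> Z" if "x \<in> Z" for x using psi_closed that by auto
  have w: "fw j x \<in> carrier L" "fw j (\<psi> x) = \<sigma> (fw j x)" if "x \<in> Z" for x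
    using frame(3)[OF j] that by (auto simp: V_def)
  have D': "D x y \<in> carrier L" "D (\<psi> x) (\<psi> y) = \<sigma> (D x y)" if "x \<in> Z" "y \<in> Z" for x y
    using D that by (auto simp: equivariant2_def)
  have "coef j (\<lambda>x. D x (\<psi> y)) = \<sigma> (coef j (\<lambda>x. D x y))" if y: "y \<in> Z" for y
  proof -
    have "coef j (\<lambda>x. D x (\<psi> y)) = (\<Oplus>x\<in>\<psi> ` Z. fw j x \<otimes> D x (\<psi> y))"
      by (simp add: img coef_def)
    also have "\<dots> = (\<Oplus>x\<in>Z. fw j (\<psi> x) \<otimes> D (\<psi> x) (\<psi> y))"
      using inj w p D' y pow_closed[of _ 1] by (intro add.finprod_reindex) auto
    also have "\<dots> = (\<Oplus>x\<in>Z. \<sigma> (fw j x \<otimes> D x y))"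
      using w D' y pow_mult[of _ _ 1] pow_closed[of _ 1]
      by (intro finsum_cong'[OF refl]) auto
    also have "\<dots> = \<sigma> (coef j (\<lambda>x. D x y))"
      unfolding coef_def using pow_finsum[of "\<lambda>x. fw j x \<otimes> D x y" Z 1] w D' y by auto
    finally show ?thesis .
  qed
  then show ?thesis using coef_closed[OF j] D' p by (auto simp: V_def)
qed

lemma tensor_of_closed:
  assumes "equivariant2 D"
  shows "tensor_of D \<in> carrier BB.T"
  unfolding tensor_of_def using assms frame(2) coef_V kappa_inv
  by (intro BB.T.finsum_closed Pi_I BB.pure_closed) auto

lemma kappa2_tensor_of:
  assumes D: "equivariant2 D" and x: "x \<in> Z" and y: "y \<in> Z"
  shows "kappa2 (tensor_of D) x y = D x y"
proof -
  have D': "D z y \<in> carrier L" if "z \<in> Z" for z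
    using D that y by (auto simp: equivariant2_def)
  have "kappa2 (tensor_of D) x y = (\<Oplus>j\<in>fJ. kappa2 (BB.pt (kappa_inv (fv j))
      (kappa_inv (\<lambda>y\<in>Z. coef j (\<lambda>x. D x y)))) x y)"
    unfolding tensor_of_def using D frame(2) coef_V kappa_inv x y
    by (intro kappa2_finsum Pi_I BB.pure_closed) auto
  also have "\<dots> = (\<Oplus>j\<in>fJ. fv j x \<otimes> coef j (\<lambda>x. D x y))"
    using D frame(2) coef_V kappa_inv x y coef_closed D' V_closed
    by (intro finsum_cong'[OF refl]) (auto simp: kappa2_pure)
  also have "\<dots> = D x y" using frame_expansion[of "\<lambda>x. D x y" x] D' x by simp
  finally show ?thesis .
qed

lemma equivariant2_kappa2: "u \<in> carrier BB.T \<Longrightarrow> equivariant2 (kappa2 u)"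
  by (simp add: equivariant2_def kappa2_closed kappa2_equivariant)

lemma coef_add:
  assumes "j \<in> fJ" "\<And>x. x \<in> Z \<Longrightarrow> f x \<in> carrier L" "\<And>x. x \<in> Z \<Longrightarrow> g x \<in> carrier L"
    "\<And>x. x \<in> Z \<Longrightarrow> h x = f x \<oplus> g x"
  shows "coef j h = coef j f \<oplus> coef j g"
proof -
  have w: "fw j x \<in> carrier L" if "x \<in> Z" for x using frame(3) V_closed assms(1) that by blast
  have "coef j h = (\<Oplus>x\<in>Z. fw j x \<otimes> f x \<oplus> fw j x \<otimes> g x)"
    unfolding coef_def using w assms by (intro finsum_cong'[OF refl]) (auto simp: r_distr)
  then show ?thesis
    unfolding coef_def using w assms(2,3) by (simp add: finsum_addf Pi_def)
qed

text \<open>Both sides are additive, so a pure tensor t \<otimes> u suffices. There the coefficients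
  are \<open>u\<close> times scalars in \<open>E\<close>; moved across the tensor sign, these
  scalars reassemble \<open>t\<close> by \<open>kappa_expansion\<close>.\<close>

lemma tensor_of_kappa2:
  assumes "u \<in> carrier BB.T"
  shows "tensor_of (kappa2 u) = u"
proof -
  let ?v = "\<lambda>j. kappa_inv (fv j)" and ?r = "\<lambda>u j. kappa_inv (\<lambda>y\<in>Z. coef j (\<lambda>x. kappa2 u x y))"
  let ?\<Phi> = "\<lambda>u. tensor_of (kappa2 u)"
  have v: "?v j \<in> carrier B" if "j \<in> fJ" for j using frame kappa_inv that by auto
  have r: "?r u j \<in> carrier B" "\<kappa> (?r u j) = (\<lambda>y\<in>Z. coef j (\<lambda>x. kappa2 u x y))"
    if "u \<in> carrier BB.T" "j \<in> fJ" for u j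
    using kappa_inv[OF coef_V[OF equivariant2_kappa2]] that by auto
  have closed: "?\<Phi> u \<in> carrier BB.T" if "u \<in> carrier BB.T" for u
    using tensor_of_closed equivariant2_kappa2 that by blast
  have Phi_add: "?\<Phi> (t \<oplus>\<^bsub>BB.T\<^esub> u) = ?\<Phi> t \<oplus>\<^bsub>BB.T\<^esub> ?\<Phi> u"
    if t: "t \<in> carrier BB.T" and u: "u \<in> carrier BB.T" for t u
  proof -
    have tu: "t \<oplus>\<^bsub>BB.T\<^esub> u \<in> carrier BB.T" using t u by simp
    have radd: "?r (t \<oplus>\<^bsub>BB.T\<^esub> u) j = ?r t j \<oplus>\<^bsub>B\<^esub> ?r u j" if j: "j \<in> fJ" for j
    proof (rule kappa_eqI)
      fix y assume y: "y \<in> Z"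
      have "coef j (\<lambda>x. kappa2 (t \<oplus>\<^bsub>BB.T\<^esub> u) x y) =
          coef j (\<lambda>x. kappa2 t x y) \<oplus> coef j (\<lambda>x. kappa2 u x y)"
        using j t u y by (intro coef_add) (auto simp: kappa2_closed kappa2_add)
      then show "\<kappa> (?r (t \<oplus>\<^bsub>BB.T\<^esub> u) j) y = \<kappa> (?r t j \<oplus>\<^bsub>B\<^esub> ?r u j) y"
        using r[OF tu j] r[OF t j] r[OF u j] y by (simp add: kappa_add)
    qed (use r[OF tu j] r[OF t j] r[OF u j] in auto)
    have "?\<Phi> (t \<oplus>\<^bsub>BB.T\<^esub> u) =
        (\<Oplus>\<^bsub>BB.T\<^esub>j\<in>fJ. BB.pt (?v j) (?r t j) \<oplus>\<^bsub>BB.T\<^esub> BB.pt (?v j) (?r u j))"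
      unfolding tensor_of_def using v r(1) t u
      by (intro BB.T.finsum_cong'[OF refl]) (auto simp: radd BB.pure_add_right BB.pure_closed)
    also have "\<dots> = ?\<Phi> t \<oplus>\<^bsub>BB.T\<^esub> ?\<Phi> u"
      unfolding tensor_of_def using v r(1) t u
      by (intro BB.T.finsum_addf) (auto simp: BB.pure_closed)
    finally show ?thesis .
  qed
  show ?thesis
    using assms
  proof (induction rule: BB.tensor_induct)
    case zero
    show ?case
      using additive_zero[OF BB.T.M.abelian_group_axioms BB.T.M.abelian_group_axioms, of ?\<Phi>]
        closed Phi_add by blast
  next
    case (pure t u)
    have tu: "BB.pt t u \<in> carrier BB.T" using pure by (rule BB.pure_closed)
    let ?c = "\<lambda>j. coef j (\<kappa> t)"
    have c: "?c j \<in> E" if "j \<in> fJ" for j using coef_E kappa_V pure(1) that by blast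
    have rp: "?r (BB.pt t u) j = ?c j \<odot>\<^bsub>B\<^esub> u" if j: "j \<in> fJ" for j
    proof (rule kappa_eqI)
      show "?c j \<odot>\<^bsub>B\<^esub> u \<in> carrier B" using BB.M.smult_closed c[OF j] pure(2) by simp
      fix y assume y: "y \<in> Z"
      have w: "fw j x \<in> carrier L" if "x \<in> Z" for x using frame(3) V_closed j that by blast
      have "coef j (\<lambda>x. kappa2 (BB.pt t u) x y) = (\<Oplus>x\<in>Z. (fw j x \<otimes> \<kappa> t x) \<otimes> \<kappa> u y)"
        unfolding coef_def using w kappa_closed pure y
        by (intro finsum_cong'[OF refl]) (auto simp: kappa2_pure m_assoc)
      also have "\<dots> = ?c j \<otimes> \<kappa> u y"
        unfolding coef_def using w kappa_closed pure y by (intro finsum_ldistr[symmetric]) auto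
      finally show "\<kappa> (?r (BB.pt t u) j) y = \<kappa> (?c j \<odot>\<^bsub>B\<^esub> u) y"
        using r[OF tu j] y kappa_smult[OF c[OF j] pure(2) y] by simp
    qed (rule r(1)[OF tu j])
    have "?\<Phi> (BB.pt t u) = (\<Oplus>\<^bsub>BB.T\<^esub>j\<in>fJ. BB.pt (?c j \<odot>\<^bsub>B\<^esub> ?v j) u)"
      unfolding tensor_of_def using v c pure BB.M.smult_closed
      by (intro BB.T.finsum_cong'[OF refl])
        (auto simp: rp BB.pure_smult_left BB.pure_smult_right BB.pure_closed)
    also have "\<dots> = BB.pt (\<Oplus>\<^bsub>B\<^esub>j\<in>fJ. ?c j \<odot>\<^bsub>B\<^esub> ?v j) u"
      using v c pure BB.M.smult_closed
      by (intro additive_finsum[OF BB.M.M.abelian_group_axioms BB.T.M.abelian_group_axioms,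
            of "\<lambda>t. BB.pt t u", symmetric])
        (auto simp: BB.pure_closed BB.pure_add_left)
    also have "\<dots> = BB.pt t u" using kappa_expansion[OF pure(1)] by simp
    finally show ?case .
  next
    case (add t u)
    then show ?case using Phi_add by simp
  qed
qed

text \<open>The tensor is recovered from its two-variable function by \<open>tensor_of\<close>. This
  is the criterion by which later identities in tensor squares are proved.\<close>

lemma kappa2_eqI:
  assumes "t \<in> carrier BB.T" "u \<in> carrier BB.T"
    "\<And>x y. x \<in> Z \<Longrightarrow> y \<in> Z \<Longrightarrow> kappa2 t x y = kappa2 u x y"
  shows "t = u"
proof -
  have "coef j (\<lambda>x. kappa2 t x y) = coef j (\<lambda>x. kappa2 u x y)" if "y \<in> Z" "j \<in> fJ" for j y
    unfolding coef_def using assms that frame(3) V_closed kappa2_closed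
    by (intro finsum_cong'[OF refl]) auto
  then have r: "(\<lambda>y\<in>Z. coef j (\<lambda>x. kappa2 t x y)) = (\<lambda>y\<in>Z. coef j (\<lambda>x. kappa2 u x y))"
    if "j \<in> fJ" for j using that by (intro restrict_ext) auto
  have "tensor_of (kappa2 t) = tensor_of (kappa2 u)"
    unfolding tensor_of_def using r assms(2) frame(2) coef_V[OF equivariant2_kappa2] kappa_inv
    by (intro BB.T.finsum_cong'[OF refl] Pi_I BB.pure_closed) auto
  then show ?thesis using assms tensor_of_kappa2 by simp
qed

end

section \<open>Descent of group algebras\<close>

text \<open>A tensor product sees only carriers, additions and scalar multiplications. It may
  therefore be formed indifferently from an algebra and from its extension by Hopf
  operations.\<close>

lemma tensor_structure_cong:
  assumes "carrier A = carrier A'" "add A = add A'" "module.smult A = module.smult A'"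
    and "carrier B = carrier B'" "add B = add B'" "module.smult B = module.smult B'"
  shows "tensor R A B = tensor R A' B'" "pure_tensor R A B = pure_tensor R A' B'"
proof -
  have "tensor_gens R A B = tensor_gens R A' B'" using assms by (simp add: tensor_gens_def)
  then have "tensor_rel R A B = tensor_rel R A' B'" using assms by (simp add: tensor_rel_def)
  then show "tensor R A B = tensor R A' B'" "pure_tensor R A B = pure_tensor R A' B'"
    using assms by (simp_all add: tensor_def pure_tensor_def fun_eq_iff)
qed

lemma group_algebra_sel:
  "carrier (group_algebra R M) = carrier M \<rightarrow>\<^sub>E carrier R"
  "f \<otimes>\<^bsub>group_algebra R M\<^esub> g =
    (\<lambda>x\<in>carrier M. \<Oplus>\<^bsub>R\<^esub>y\<in>carrier M. f y \<otimes>\<^bsub>R\<^esub> g (inv\<^bsub>M\<^esub> y \<otimes>\<^bsub>M\<^esub> x))"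
  "\<one>\<^bsub>group_algebra R M\<^esub> = (\<lambda>x\<in>carrier M. free_basis R \<one>\<^bsub>M\<^esub> x)"
  "\<zero>\<^bsub>group_algebra R M\<^esub> = (\<lambda>x\<in>carrier M. \<zero>\<^bsub>R\<^esub>)"
  "f \<oplus>\<^bsub>group_algebra R M\<^esub> g = (\<lambda>x\<in>carrier M. f x \<oplus>\<^bsub>R\<^esub> g x)"
  "c \<odot>\<^bsub>group_algebra R M\<^esub> f = (\<lambda>x\<in>carrier M. c \<otimes>\<^bsub>R\<^esub> f x)"
  "counit (group_algebra R M) f = (\<Oplus>\<^bsub>R\<^esub>x\<in>carrier M. f x)"
  "antipode (group_algebra R M) f = (\<lambda>x\<in>carrier M. f (inv\<^bsub>M\<^esub> x))"
  by (simp_all add: group_algebra_def group_algebra_alg_def Let_def module.defs hopf_alg.defs)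

lemma group_algebra_comult:
  fixes R M defines "A \<equiv> group_algebra R M"
  shows "comult A f = (\<Oplus>\<^bsub>tensor R A A\<^esub>x\<in>carrier M. f x \<odot>\<^bsub>tensor R A A\<^esub>
    pure_tensor R A A (restrict (free_basis R x) (carrier M)) (restrict (free_basis R x) (carrier M)))"
proof -
  let ?A = "group_algebra_alg R M"
  have eq: "tensor R ?A ?A = tensor R A A" "pure_tensor R ?A ?A = pure_tensor R A A"
    unfolding A_def group_algebra_def group_algebra_alg_def Let_def module.defs hopf_alg.defs
    by (rule tensor_structure_cong; simp)+
  show ?thesis
    unfolding eq[symmetric] unfolding A_def
    by (simp add: group_algebra_def Let_def module.defs hopf_alg.defs)
qed

text \<open>The construction of \<open>descended_hopf\<close> with the invariants given as a set
  \<open>W\<close>, so that they can be supplied as a function space \<open>V\<close>.\<close>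

definition fixed_hopf ::
  "('l, 'x) ring_scheme \<Rightarrow> 'l set \<Rightarrow> ('l, 'a) hopf_alg \<Rightarrow> 'a set \<Rightarrow> ('l, 'a) hopf_alg" where
  "fixed_hopf L K A W =
    (let H = A\<lparr>carrier := W\<rparr>
     in H\<lparr>comult := \<lambda>h. THE t. t \<in> carrier (tensor (L\<lparr>carrier := K\<rparr>) H H) \<and>
            tensor_lift (L\<lparr>carrier := K\<rparr>) (tensor L A A) (pure_tensor L A A) t = comult A h\<rparr>)"

lemma fixed_hopf_comult:
  "comult (fixed_hopf L K A W) h = (THE t.
    t \<in> carrier (tensor (L\<lparr>carrier := K\<rparr>) (A\<lparr>carrier := W\<rparr>) (A\<lparr>carrier := W\<rparr>)) \<and>
    tensor_lift (L\<lparr>carrier := K\<rparr>) (tensor L A A) (pure_tensor L A A) t = comult A h)"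
  by (simp add: fixed_hopf_def Let_def)

section \<open>The invariants of a twisted group algebra and their comultiplication\<close>

locale twisted_group = semilinear_functions L \<sigma> "carrier M" \<psi> m
  for L (structure) and \<sigma> and M :: "('g, 'z) monoid_scheme" and \<psi> m +
  fixes K :: "'a set"
  assumes K_fixed: "K = fixed 1" and group_M: "group M"
    and psi_mult: "\<lbrakk>x \<in> carrier M; y \<in> carrier M\<rbrakk> \<Longrightarrow> \<psi> (x \<otimes>\<^bsub>M\<^esub> y) = \<psi> x \<otimes>\<^bsub>M\<^esub> \<psi> y"
begin

sublocale M: group M by (rule group_M)

abbreviation "Z \<equiv> carrier M"
abbreviation "A \<equiv> group_algebra L M"
abbreviation "H \<equiv> fixed_hopf L K A V"
abbreviation "R0 \<equiv> L\<lparr>carrier := K\<rparr>"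

lemma PiE_value: "f \<in> Z \<rightarrow>\<^sub>E carrier L \<Longrightarrow> x \<in> Z \<Longrightarrow> f x \<in> carrier L"
  by auto

lemma PiE_ext: "f \<in> Z \<rightarrow>\<^sub>E carrier L \<Longrightarrow> f \<in> extensional Z"
  by (simp add: PiE_def)

lemma module_A: "module L A"
proof (rule moduleI)
  show "abelian_group A"
  proof (rule abelian_groupI)
    fix f assume f: "f \<in> carrier A"
    then show "\<exists>g\<in>carrier A. g \<oplus>\<^bsub>A\<^esub> f = \<zero>\<^bsub>A\<^esub>"
      by (intro bexI[of _ "\<lambda>x\<in>Z. \<ominus> f x"])
        (auto simp: group_algebra_sel PiE_mem intro!: restrict_ext l_neg)
  qed (auto simp: group_algebra_sel a_ac PiE_value PiE_ext intro!: restrict_ext intro: extensionalityI[of _ Z])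
qed (auto simp: group_algebra_sel is_cring l_distr r_distr m_assoc PiE_value PiE_ext
    intro!: restrict_ext intro: extensionalityI[of _ Z])

lemma H_sel:
  "carrier H = V" "add H = add A" "\<zero>\<^bsub>H\<^esub> = \<zero>\<^bsub>A\<^esub>" "module.smult H = module.smult A"
  "monoid.mult H = monoid.mult A" "\<one>\<^bsub>H\<^esub> = \<one>\<^bsub>A\<^esub>" "counit H = counit A" "antipode H = antipode A"
  by (simp_all add: fixed_hopf_def Let_def)

lemma V_A: "f \<in> V \<Longrightarrow> f \<in> carrier A"
  by (auto simp: V_def group_algebra_sel)

lemma K_subfield: "subfield K L"
  using subfield_fixed K_fixed by simp

lemma K_closed: "c \<in> K \<Longrightarrow> c \<in> carrier L"
  using K_fixed by (simp add: fixed_def)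

lemma sigma_K: "c \<in> K \<Longrightarrow> \<sigma> c = c"
  using K_fixed by (simp add: fixed_def)

lemma cring_R0: "cring R0"
  using cring_subfield[OF K_subfield] .

lemma sigma_hom:
  "x \<in> carrier L \<Longrightarrow> y \<in> carrier L \<Longrightarrow> \<sigma> (x \<oplus> y) = \<sigma> x \<oplus> \<sigma> y"
  "x \<in> carrier L \<Longrightarrow> y \<in> carrier L \<Longrightarrow> \<sigma> (x \<otimes> y) = \<sigma> x \<otimes> \<sigma> y"
  "x \<in> carrier L \<Longrightarrow> \<sigma> (\<ominus> x) = \<ominus> \<sigma> x"
  "\<sigma> \<zero> = \<zero>" "\<sigma> \<one> = \<one>" "x \<in> carrier L \<Longrightarrow> \<sigma> x \<in> carrier L"
  using pow_add[of _ _ 1] pow_mult[of _ _ 1] pow_zero[of 1] pow_one[of 1] pow_closed[of _ 1]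
    pow_minus[of _ 1] by simp_all

lemma psi_Z: "x \<in> Z \<Longrightarrow> \<psi> x \<in> Z"
  using psi_closed by auto

lemma V_I:
  "\<lbrakk>f \<in> extensional Z; \<And>x. x \<in> Z \<Longrightarrow> f x \<in> carrier L; \<And>x. x \<in> Z \<Longrightarrow> f (\<psi> x) = \<sigma> (f x)\<rbrakk>
    \<Longrightarrow> f \<in> V"
  by (auto simp: V_def PiE_def)

lemma V_psi: "f \<in> V \<Longrightarrow> x \<in> Z \<Longrightarrow> f (\<psi> x) = \<sigma> (f x)"
  by (simp add: V_def)

lemma V_ext: "f \<in> V \<Longrightarrow> f \<in> extensional Z"
  by (simp add: V_def PiE_def)

lemma module_H: "module R0 H"
proof (rule moduleI)
  show "abelian_group H"
  proof (rule abelian_groupI)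
    fix f assume f: "f \<in> carrier H"
    then show "\<exists>g\<in>carrier H. g \<oplus>\<^bsub>H\<^esub> f = \<zero>\<^bsub>H\<^esub>"
      by (intro bexI[of _ "\<lambda>x\<in>Z. \<ominus> f x"])
        (auto simp: group_algebra_sel H_sel sigma_hom psi_Z l_neg V_closed V_psi intro!: restrict_ext V_I)
  qed (auto simp: group_algebra_sel H_sel sigma_hom psi_Z a_ac V_closed V_psi V_ext
      intro!: restrict_ext V_I intro: extensionalityI[of _ Z])
qed (auto simp: group_algebra_sel H_sel sigma_hom psi_Z K_closed sigma_K cring_R0 V_closed V_psi V_ext
    l_distr r_distr m_assoc intro!: restrict_ext V_I intro: extensionalityI[of _ Z])

sublocale H: semilinear_form L \<sigma> "carrier M" \<psi> m K H "\<lambda>f. f"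
proof (rule semilinear_form.intro[OF semilinear_functions_axioms], rule semilinear_form_axioms.intro)
  show "bij_betw (\<lambda>f. f) (carrier H) V" by (simp add: H_sel bij_betw_def)
qed (rule K_fixed, rule module_H, simp_all add: H_sel group_algebra_sel)

text \<open>The full group algebra is the form for the trivial twist, with identity maps, order 1
  and fixed field \<open>L\<close>. Its tensor square over \<open>L\<close> thereby gets the same
  two-variable coordinates.\<close>

sublocale A: semilinear_functions L "\<lambda>x. x" "carrier M" "\<lambda>x. x" 1
proof -
  have endo: "field_endo L (\<lambda>x. x)"
    by (rule field_endo.intro[OF field_axioms], rule field_endo_axioms.intro) (auto simp: ring_hom_def)
  show "semilinear_functions L (\<lambda>x. x) Z (\<lambda>x. x) 1"
    by (rule semilinear_functions.intro[OF endo], rule semilinear_functions_axioms.intro)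
      (auto simp: field_endo.fixed_def[OF endo])
qed

sublocale A: semilinear_form L "\<lambda>x. x" "carrier M" "\<lambda>x. x" 1 "carrier L" A "\<lambda>f. f"
proof (rule semilinear_form.intro[OF A.semilinear_functions_axioms], rule semilinear_form_axioms.intro)
  show "bij_betw (\<lambda>f. f) (carrier A) A.V"
    by (auto simp: bij_betw_def A.V_def group_algebra_sel)
qed (auto simp: module_A group_algebra_sel A.fixed_def)

lemma carrier_update_self: "L\<lparr>carrier := carrier L\<rparr> = L"
  by simp

lemmas kappa2_A =
  A.kappa2_pure[unfolded carrier_update_self] A.kappa2_add[unfolded carrier_update_self]
  A.kappa2_smult[unfolded carrier_update_self] A.kappa2_zero[unfolded carrier_update_self]

abbreviation "delta \<equiv> \<lambda>x. restrict (free_basis L x) Z"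

lemma delta_closed: "delta x \<in> carrier A"
  by (auto simp: group_algebra_sel free_basis_def)

text \<open>Group elements are group-like, so the comultiplication places \<open>f\<close> on the
  diagonal.\<close>

lemma comult_A:
  assumes f: "f \<in> carrier A"
  shows "comult A f \<in> carrier A.BB.T"
    "\<lbrakk>x \<in> Z; y \<in> Z\<rbrakk> \<Longrightarrow> A.kappa2 (comult A f) x y = (if x = y then f x else \<zero>)"
proof -
  have fL: "f z \<in> carrier L" if "z \<in> Z" for z using f that by (auto simp: group_algebra_sel)
  have c: "comult A f = (\<Oplus>\<^bsub>A.BB.T\<^esub>z\<in>Z. f z \<odot>\<^bsub>A.BB.T\<^esub> A.BB.pt (delta z) (delta z))"
    using group_algebra_comult[of L M f] by simp
  have t: "f z \<odot>\<^bsub>A.BB.T\<^esub> A.BB.pt (delta z) (delta z) \<in> carrier A.BB.T" if "z \<in> Z" for z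
    using fL that A.BB.pure_closed[OF delta_closed delta_closed] A.BB.T.smult_closed by simp
  show "comult A f \<in> carrier A.BB.T"
    unfolding c using t by (intro A.BB.T.finsum_closed) auto
  show "A.kappa2 (comult A f) x y = (if x = y then f x else \<zero>)" if x: "x \<in> Z" and y: "y \<in> Z"
  proof -
    have "A.kappa2 (comult A f) x y =
        (\<Oplus>z\<in>Z. A.kappa2 (f z \<odot>\<^bsub>A.BB.T\<^esub> A.BB.pt (delta z) (delta z)) x y)"
      unfolding c using t x y by (intro A.kappa2_finsum) auto
    also have "\<dots> = (\<Oplus>z\<in>Z. if z = x then (if x = y then f z else \<zero>) else \<zero>)"
    proof (intro finsum_cong'[OF refl])
      fix z assume z: "z \<in> Z"
      have "A.kappa2 (f z \<odot>\<^bsub>A.BB.T\<^esub> A.BB.pt (delta z) (delta z)) x y = f z \<otimes> (delta z x \<otimes> delta z y)"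
        using fL z x y A.BB.pure_closed[OF delta_closed delta_closed] delta_closed
        by (simp add: kappa2_A)
      then show "A.kappa2 (f z \<odot>\<^bsub>A.BB.T\<^esub> A.BB.pt (delta z) (delta z)) x y =
          (if z = x then (if x = y then f z else \<zero>) else \<zero>)"
        using fL z x y by (auto simp: free_basis_def)
    qed (use fL in auto)
    also have "\<dots> = (if x = y then f x else \<zero>)"
      using finsum_delta[of Z x "\<lambda>z. if x = y then f z else \<zero>"] x fL by auto
    finally show ?thesis .
  qed
qed

abbreviation "incl2 \<equiv> tensor_lift R0 (tensor L A A) (pure_tensor L A A)"

lemma module_AA: "module R0 (tensor L A A)"
  using module_restrict_scalars[OF _ cring_R0, of "tensor L A A"] A.BB.module_tensor K_closed
  by auto

lemma bilinear_incl2: "bilinear_map R0 H H (tensor L A A) (pure_tensor L A A)"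
  using A.BB.bilinear_map_pure V_A K_closed
  by (auto simp: bilinear_map_def H_sel)

text \<open>The canonical map from the tensor square over \<open>K\<close> to that over
  \<open>L\<close> leaves the two-variable function unchanged; as this function determines a tensor,
  the map is injective.\<close>

lemma incl2:
  assumes "t \<in> carrier H.BB.T"
  shows "incl2 t \<in> carrier A.BB.T"
    "\<lbrakk>x \<in> Z; y \<in> Z\<rbrakk> \<Longrightarrow> A.kappa2 (incl2 t) x y = H.kappa2 t x y"
proof -
  note lift = H.BB.tensor_lift_closed[OF module_AA bilinear_incl2]
    H.BB.tensor_lift_zero[OF module_AA bilinear_incl2]
    H.BB.tensor_lift_add[OF module_AA bilinear_incl2]
    H.BB.tensor_lift_pure[OF module_AA bilinear_incl2]
  have cl: "incl2 t \<in> carrier A.BB.T" if "t \<in> carrier H.BB.T" for t using lift(1) that by simp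
  show "incl2 t \<in> carrier A.BB.T" using cl assms .
  show "A.kappa2 (incl2 t) x y = H.kappa2 t x y" if x: "x \<in> Z" and y: "y \<in> Z"
    using assms
  proof (induction rule: H.BB.tensor_induct)
    case zero
    then show ?case
      using x y by (simp add: lift H.kappa2_zero kappa2_A)
  next
    case (pure f g)
    then have "f \<in> carrier A" "g \<in> carrier A" using V_A by (simp_all add: H_sel)
    then show ?case
      using x y pure by (simp add: lift H.kappa2_pure kappa2_A)
  next
    case (add t u)
    then show ?case
      using x y cl by (simp add: lift H.kappa2_add kappa2_A)
  qed
qed

text \<open>The definite description is resolved here. Since \<psi> is injective, \<open>h\<close>
  placed on the diagonal is an equivariant function of two variables, so \<open>tensor_of\<close>
  yields a preimage of the comultiplication in the group algebra; it is unique because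
  \<open>incl2\<close> preserves two-variable functions.\<close>

lemma comult_H:
  assumes h: "h \<in> V"
  shows "comult H h \<in> carrier H.BB.T"
    "\<lbrakk>x \<in> Z; y \<in> Z\<rbrakk> \<Longrightarrow> H.kappa2 (comult H h) x y = (if x = y then h x else \<zero>)"
proof -
  let ?D = "\<lambda>x y. if x = y then h x else \<zero>"
  let ?P = "\<lambda>t. t \<in> carrier H.BB.T \<and> incl2 t = comult A h"
  have hA: "h \<in> carrier A" using V_A h .
  have D: "H.equivariant2 ?D"
    using h psi_pow_inj[of _ _ 1] by (auto simp: H.equivariant2_def V_closed V_psi sigma_hom psi_Z)
  have ex: "?P (H.tensor_of ?D)"
  proof
    show t: "H.tensor_of ?D \<in> carrier H.BB.T" using H.tensor_of_closed[OF D] .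
    have "incl2 (H.tensor_of ?D) = comult A h"
      using incl2[OF t] comult_A[OF hA] H.kappa2_tensor_of[OF D]
      by (intro A.kappa2_eqI) simp_all
    then show "incl2 (H.tensor_of ?D) = comult A h" .
  qed
  have uniq: "t = H.tensor_of ?D" if "?P t" for t
    using that incl2[of t] comult_A[OF hA] H.kappa2_tensor_of[OF D] H.tensor_of_closed[OF D]
    by (intro H.kappa2_eqI) auto
  have T: "tensor R0 (A\<lparr>carrier := V\<rparr>) (A\<lparr>carrier := V\<rparr>) = H.BB.T"
    by (rule tensor_structure_cong) (simp_all add: H_sel)
  have "comult H h = (THE t. ?P t)"
    unfolding fixed_hopf_comult T ..
  also have "\<dots> = H.tensor_of ?D" by (rule the_equality) (rule ex, rule uniq)
  finally have c: "comult H h = H.tensor_of ?D" .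
  show "comult H h \<in> carrier H.BB.T" unfolding c by (rule H.tensor_of_closed[OF D])
  show "\<lbrakk>x \<in> Z; y \<in> Z\<rbrakk> \<Longrightarrow> H.kappa2 (comult H h) x y = (if x = y then h x else \<zero>)"
    unfolding c by (rule H.kappa2_tensor_of[OF D])
qed

end

section \<open>Base change of the descended Hopf algebra\<close>

text \<open>In the application \<open>e\<close> is the degree of \<open>E\<close> over
  \<open>K\<close>. Over \<open>E\<close> the generator is \<sigma>^e, of order
  \<open>m div e\<close>, and it acts on \<open>M\<close> by \<psi>^e.\<close>

locale base_changed = twisted_group L \<sigma> M \<psi> m K
  for L (structure) and \<sigma> and M :: "('g, 'z) monoid_scheme" and \<psi> m K +
  fixes e :: nat and E :: "'a set"
  assumes e_dvd: "e dvd m" and E_eq: "E = fixed e"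
    and E_faithful: "0 < k \<Longrightarrow> k < e \<Longrightarrow> \<exists>y\<in>E. (\<sigma> ^^ k) y \<noteq> y"
begin

abbreviation "R1 \<equiv> L\<lparr>carrier := E\<rparr>"
abbreviation "TM \<equiv> self_module R1"
abbreviation "B \<equiv> base_change_module R0 R1 H"
abbreviation "Bh \<equiv> base_change R0 R1 H"

lemma e_pos: "0 < e"
  using e_dvd m_pos by (auto intro: Nat.gr0I)

lemma e_le: "e \<le> m"
  using e_dvd m_pos dvd_imp_le by blast

lemma E_subfield: "subfield E L"
  using subfield_fixed E_eq by simp

lemma E_closed: "c \<in> E \<Longrightarrow> c \<in> carrier L"
  using E_eq by (simp add: fixed_def)

lemma sigma_E: "c \<in> E \<Longrightarrow> (\<sigma> ^^ e) c = c"
  using E_eq by (simp add: fixed_def)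

lemma K_E: "K \<subseteq> E"
proof
  fix c assume "c \<in> K"
  then have "(\<sigma> ^^ k) c = c" for k by (induction k) (auto simp: sigma_K)
  then show "c \<in> E" using \<open>c \<in> K\<close> K_closed E_eq by (simp add: fixed_def)
qed

lemmas E_ring = subringE[OF subfieldE(1)[OF E_subfield]]

lemma cring_R1: "cring R1"
  using cring_subfield[OF E_subfield] .

lemma module_TM: "module R0 TM"
  using module_restrict_scalars[OF cring.module_self_module[OF cring_R1], of K] K_E cring_R0 by simp

sublocale T: module_pair R0 TM H
  by (rule module_pair.intro) (rule module_TM, rule module_H)

lemma TM_sel: "carrier TM = E" "add TM = add L" "\<zero>\<^bsub>TM\<^esub> = \<zero>" "module.smult TM = monoid.mult L"
  by (simp_all add: self_module_def)

sublocale E: semilinear_functions L "\<sigma> ^^ e" "carrier M" "\<psi> ^^ e" "m div e"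
proof -
  have endo: "field_endo L (\<sigma> ^^ e)"
    by (rule field_endo.intro[OF field_axioms], rule field_endo_axioms.intro) (rule pow_hom)
  have em: "e * (m div e) = m" using e_dvd by simp
  show "semilinear_functions L (\<sigma> ^^ e) Z (\<psi> ^^ e) (m div e)"
  proof (rule semilinear_functions.intro[OF endo], rule semilinear_functions_axioms.intro)
    show "0 < m div e" using em m_pos by (metis mult_0_right neq0_conv)
    show "field_endo.fixed L (\<sigma> ^^ e) (m div e) = carrier L"
      using fixed_m em by (simp add: field_endo.fixed_def[OF endo] fixed_def funpow_mult)
    show "\<exists>y\<in>carrier L. ((\<sigma> ^^ e) ^^ k) y \<noteq> y" if "0 < k" "k < m div e" for k
    proof -
      have "0 < e * k" "e * k < m" using that e_pos em by (simp, metis mult_less_cancel1)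
      then show ?thesis using sigma_faithful[of "e * k"] by (simp add: funpow_mult mult.commute)
    qed
  qed (use psi_pow em in \<open>auto simp: funpow_mult psi_pow_closed\<close>)
qed

abbreviation "ev \<equiv> \<lambda>x. tensor_lift R0 (self_module L) (\<lambda>a h. a \<otimes> h x)"

text \<open>The map a \<otimes> h \<mapsto> a h. It plays the part of \<kappa> for the base change
  once it is known to be bijective onto the functions equivariant under the \<open>e\<close>-th
  powers.\<close>

definition kap :: "('a \<times> ('g \<Rightarrow> 'a) \<Rightarrow> 'a) set \<Rightarrow> 'g \<Rightarrow> 'a" where
  "kap t = (\<lambda>x\<in>Z. ev x t)"

lemma bilinear_ev: "x \<in> Z \<Longrightarrow> bilinear_map R0 TM H (self_module L) (\<lambda>a h. a \<otimes> h x)"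
  by (auto simp: bilinear_map_def TM_sel H_sel group_algebra_sel E_closed K_closed V_closed
      l_distr r_distr m_ac)

lemma kap_closed: "t \<in> carrier T.T \<Longrightarrow> x \<in> Z \<Longrightarrow> kap t x \<in> carrier L"
  using T.tensor_lift_closed[OF H.module_L bilinear_ev] by (simp add: kap_def)

lemma kap_add:
  "\<lbrakk>t \<in> carrier T.T; u \<in> carrier T.T; x \<in> Z\<rbrakk> \<Longrightarrow> kap (t \<oplus>\<^bsub>T.T\<^esub> u) x = kap t x \<oplus> kap u x"
  using T.tensor_lift_add[OF H.module_L bilinear_ev] by (simp add: kap_def)

lemma kap_zero: "x \<in> Z \<Longrightarrow> kap \<zero>\<^bsub>T.T\<^esub> x = \<zero>"
  using T.tensor_lift_zero[OF H.module_L bilinear_ev] by (simp add: kap_def)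

lemma kap_pure: "\<lbrakk>a \<in> E; h \<in> V; x \<in> Z\<rbrakk> \<Longrightarrow> kap (T.pt a h) x = a \<otimes> h x"
  using T.tensor_lift_pure[OF H.module_L bilinear_ev, of x a h] by (simp add: kap_def TM_sel H_sel)

lemma kap_finsum:
  "g \<in> I \<rightarrow> carrier T.T \<Longrightarrow> x \<in> Z \<Longrightarrow> kap (\<Oplus>\<^bsub>T.T\<^esub>i\<in>I. g i) x = (\<Oplus>i\<in>I. kap (g i) x)"
  using T.tensor_lift_finsum[OF H.module_L bilinear_ev] by (simp add: kap_def)

lemma pt_closed: "a \<in> E \<Longrightarrow> h \<in> V \<Longrightarrow> T.pt a h \<in> carrier T.T"
  using T.pure_closed by (simp add: TM_sel H_sel)

lemma tensor_induct [consumes 1, case_names zero pure add]: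
  assumes "t \<in> carrier T.T" "P \<zero>\<^bsub>T.T\<^esub>"
    "\<And>a h. a \<in> E \<Longrightarrow> h \<in> V \<Longrightarrow> P (T.pt a h)"
    "\<And>t u. t \<in> carrier T.T \<Longrightarrow> u \<in> carrier T.T \<Longrightarrow> P t \<Longrightarrow> P u \<Longrightarrow> P (t \<oplus>\<^bsub>T.T\<^esub> u)"
  shows "P t"
  using assms by (rule T.tensor_induct) (simp_all add: TM_sel H_sel)

lemma kap_V:
  assumes t: "t \<in> carrier T.T"
  shows "kap t \<in> E.V"
proof -
  have "kap t ((\<psi> ^^ e) x) = (\<sigma> ^^ e) (kap t x)" if x: "x \<in> Z" for x
    using t
  proof (induction rule: tensor_induct)
    case zero
    then show ?case using x by (simp add: kap_zero psi_pow_closed)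
  next
    case (pure a h)
    then show ?case
      using x by (simp add: kap_pure psi_pow_closed V_pow pow_mult E_closed V_closed sigma_E)
  next
    case (add t u)
    then show ?case using x by (simp add: kap_add psi_pow_closed pow_add kap_closed)
  qed
  moreover have "kap t \<in> extensional Z" by (simp add: kap_def)
  ultimately show ?thesis using kap_closed[OF t] by (auto simp: E.V_def PiE_def)
qed

lemma fun_smult_V: "c \<in> K \<Longrightarrow> h \<in> V \<Longrightarrow> c \<odot>\<^bsub>H\<^esub> h \<in> V"
  using H.BB.M.smult_closed[of c h] by (simp add: H_sel)

text \<open>For dual coordinates \<open>a\<^sub>j, b\<^sub>j\<close> of \<open>E/K\<close>, the inverse of \<open>kap\<close> sends \<open>f\<close> to
  \<open>\<Sum>\<^sub>j a\<^sub>j \<otimes> \<Sum>\<^sub>k \<sigma>\<^sup>k \<cdot> (b\<^sub>j f)\<close>, where \<open>(\<sigma> \<cdot> f)(x) = \<sigma>(f(\<psi>\<^sup>-\<^sup>1 x))\<close>.\<close>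

lemma kap_bij: "bij_betw kap (carrier T.T) E.V"
proof -
  have "\<exists>q a b. (\<forall>j<q. a j \<in> fixed e \<and> b j \<in> fixed e) \<and>
    (\<forall>k<e. (\<Oplus>j\<in>{..<q::nat}. a j \<otimes> (\<sigma> ^^ k) (b j)) = (if k = 0 then \<one> else \<zero>))"
    using E_faithful E_eq by (intro fixed_coordinates) auto
  then obtain q a b where ab: "\<And>j. j < q \<Longrightarrow> a j \<in> E" "\<And>j. j < q \<Longrightarrow> b j \<in> E"
    and coord: "\<And>k. k < e \<Longrightarrow>
      (\<Oplus>j\<in>{..<q::nat}. a j \<otimes> (\<sigma> ^^ k) (b j)) = (if k = 0 then \<one> else \<zero>)"
    using E_eq by blast
  have abL: "a j \<in> carrier L" "b j \<in> carrier L" if "j < q" for j using ab that E_closed by auto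
  \<comment> \<open>For k < e \<le> m the map \<open>\<psi> ^^ (m - k)\<close> is the inverse of
    \<open>\<psi> ^^ k\<close>, so this is a sum of e translates of b_j f.\<close>
  define D where "D j f = (\<lambda>x\<in>Z. \<Oplus>k\<in>{..<e}. (\<sigma> ^^ k) (b j \<otimes> f ((\<psi> ^^ (m - k)) x)))" for j f
  have shift: "(\<psi> ^^ (m - Suc k)) (\<psi> x) = (\<psi> ^^ (m - k)) x" if "k < e" for k x
    using that e_le by (metis Suc_diff_Suc funpow_swap1 funpow.simps(2) comp_apply less_le_trans)
  have DV: "D j f \<in> V" if j: "j < q" and f: "f \<in> E.V" for j f
  proof (rule V_I)
    have fL: "f x \<in> carrier L" if "x \<in> Z" for x using E.V_closed f that .
    show "D j f \<in> extensional Z" by (simp add: D_def)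
    show "D j f x \<in> carrier L" if "x \<in> Z" for x
      using that fL abL j by (auto simp: D_def psi_pow_closed intro!: finsum_closed)
    show "D j f (\<psi> x) = \<sigma> (D j f x)" if x: "x \<in> Z" for x
    proof -
      let ?F = "\<lambda>k. (\<sigma> ^^ k) (b j \<otimes> f ((\<psi> ^^ (m - k)) (\<psi> x)))"
      have px: "\<psi> x \<in> Z" using psi_Z x .
      have FL: "?F k \<in> carrier L" for k using abL j fL px psi_pow_closed by simp
      \<comment> \<open>The terms at k = e and k = 0 agree, because \<open>f\<close> is equivariant
        under the \<open>e\<close>-th powers and \<sigma>^e fixes b_j. Hence e translates suffice
        for invariance under \<sigma>.\<close>
      have "?F e = (\<sigma> ^^ e) (b j) \<otimes> f ((\<psi> ^^ e) ((\<psi> ^^ (m - e)) (\<psi> x)))"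
        using f fL px abL j psi_pow_closed by (simp add: pow_mult E.V_def)
      also have "(\<psi> ^^ e) ((\<psi> ^^ (m - e)) (\<psi> x)) = (\<psi> ^^ m) (\<psi> x)"
        using e_le by (metis comp_apply funpow_add le_add_diff_inverse)
      finally have e0: "?F e = ?F 0" using sigma_E ab j by simp
      have "\<sigma> (D j f x) = (\<Oplus>k\<in>{..<e}. \<sigma> ((\<sigma> ^^ k) (b j \<otimes> f ((\<psi> ^^ (m - k)) x))))"
        using x pow_finsum[of "\<lambda>k. (\<sigma> ^^ k) (b j \<otimes> f ((\<psi> ^^ (m - k)) x))" "{..<e}" 1]
          abL j fL psi_pow_closed by (auto simp: D_def)
      also have "\<dots> = (\<Oplus>k\<in>{..<e}. ?F (Suc k))"
        using FL[of "Suc _"] shift by (intro finsum_cong'[OF refl]) auto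
      also have "\<dots> = (\<Oplus>k\<in>{..<e}. ?F k)"
        using FL e0 by (intro finsum_cyclic_shift) auto
      also have "\<dots> = D j f (\<psi> x)" using px by (simp add: D_def)
      finally show ?thesis by simp
    qed
  qed
  have Dsum: "(\<Oplus>j\<in>{..<q}. a j \<otimes> D j f x) = f x" if f: "f \<in> E.V" and x: "x \<in> Z" for f x
  proof -
    let ?f = "\<lambda>k. (\<sigma> ^^ k) (f ((\<psi> ^^ (m - k)) x))"
    have fL: "f x \<in> carrier L" if "x \<in> Z" for x using E.V_closed f that .
    then have sfL: "?f k \<in> carrier L" for k using psi_pow_closed x by simp
    have "(\<Oplus>j\<in>{..<q}. a j \<otimes> D j f x) =
      (\<Oplus>j\<in>{..<q}. \<Oplus>k\<in>{..<e}. a j \<otimes> (\<sigma> ^^ k) (b j) \<otimes> ?f k)"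
    proof (intro finsum_cong'[OF refl])
      fix j assume j: "j \<in> {..<q}"
      have "a j \<otimes> D j f x = a j \<otimes> (\<Oplus>k\<in>{..<e}. (\<sigma> ^^ k) (b j) \<otimes> ?f k)"
        using x abL j fL psi_pow_closed by (simp add: D_def pow_mult)
      also have "\<dots> = (\<Oplus>k\<in>{..<e}. a j \<otimes> ((\<sigma> ^^ k) (b j) \<otimes> ?f k))"
        using abL j sfL by (intro finsum_rdistr) auto
      also have "\<dots> = (\<Oplus>k\<in>{..<e}. a j \<otimes> (\<sigma> ^^ k) (b j) \<otimes> ?f k)"
        using abL j sfL by (intro finsum_cong'[OF refl]) (auto simp: m_assoc)
      finally show "a j \<otimes> D j f x = (\<Oplus>k\<in>{..<e}. a j \<otimes> (\<sigma> ^^ k) (b j) \<otimes> ?f k)" .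
    qed (use abL sfL in \<open>auto intro!: finsum_closed\<close>)
    also have "\<dots> = (\<Oplus>k\<in>{..<e}. \<Oplus>j\<in>{..<q}. a j \<otimes> (\<sigma> ^^ k) (b j) \<otimes> ?f k)"
      using abL sfL by (intro finsum_swap) auto
    also have "\<dots> = (\<Oplus>k\<in>{..<e}. if k = 0 then ?f k else \<zero>)"
    proof (intro finsum_cong'[OF refl])
      fix k assume k: "k \<in> {..<e}"
      have "(\<Oplus>j\<in>{..<q}. a j \<otimes> (\<sigma> ^^ k) (b j) \<otimes> ?f k) =
          (\<Oplus>j\<in>{..<q}. a j \<otimes> (\<sigma> ^^ k) (b j)) \<otimes> ?f k"
        using abL sfL by (intro finsum_ldistr[symmetric]) auto
      then show "(\<Oplus>j\<in>{..<q}. a j \<otimes> (\<sigma> ^^ k) (b j) \<otimes> ?f k) = (if k = 0 then ?f k else \<zero>)"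
        using coord k sfL[of k] by auto
    qed (use sfL sfL[of 0] in auto)
    also have "\<dots> = ?f 0" using e_pos sfL[of 0] by (intro finsum_delta) auto
    also have "\<dots> = f x" using x psi_pow by simp
    finally show ?thesis .
  qed
  define g where "g f = (\<Oplus>\<^bsub>T.T\<^esub>j\<in>{..<q}. T.pt (a j) (D j f))" for f
  have g_closed: "g f \<in> carrier T.T" if "f \<in> E.V" for f
    unfolding g_def using ab(1) DV that pt_closed by (intro T.T.finsum_closed) auto
  have kap_g: "kap (g f) = f" if f: "f \<in> E.V" for f
  proof (rule extensionalityI[of _ Z])
    show "f \<in> extensional Z" using f by (simp add: E.V_def PiE_def)
    fix x assume x: "x \<in> Z"
    have "kap (g f) x = (\<Oplus>j\<in>{..<q}. kap (T.pt (a j) (D j f)) x)"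
      unfolding g_def using ab(1) DV f pt_closed x by (intro kap_finsum) auto
    also have "\<dots> = (\<Oplus>j\<in>{..<q}. a j \<otimes> D j f x)"
      using ab(1) abL DV f x V_closed by (intro finsum_cong'[OF refl]) (auto simp: kap_pure)
    finally show "kap (g f) x = f x" using Dsum f x by simp
  qed (simp add: kap_def)
  have g_add: "g (kap (t \<oplus>\<^bsub>T.T\<^esub> u)) = g (kap t) \<oplus>\<^bsub>T.T\<^esub> g (kap u)"
    if t: "t \<in> carrier T.T" and u: "u \<in> carrier T.T" for t u
  proof -
    have D_add: "D j (kap (t \<oplus>\<^bsub>T.T\<^esub> u)) = D j (kap t) \<oplus>\<^bsub>H\<^esub> D j (kap u)" if j: "j < q" for j
    proof (rule extensionalityI[of _ Z])
      fix x assume x: "x \<in> Z"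
      let ?p = "\<lambda>k. (\<psi> ^^ (m - k)) x"
      have p: "?p k \<in> Z" for k using psi_pow_closed x .
      have "D j (kap (t \<oplus>\<^bsub>T.T\<^esub> u)) x =
        (\<Oplus>k\<in>{..<e}. (\<sigma> ^^ k) (b j \<otimes> kap t (?p k)) \<oplus> (\<sigma> ^^ k) (b j \<otimes> kap u (?p k)))"
        unfolding D_def using x p t u abL j
        by (simp, intro finsum_cong'[OF refl]) (auto simp: kap_add kap_closed r_distr pow_add)
      also have "\<dots> = D j (kap t) x \<oplus> D j (kap u) x"
        unfolding D_def using x p t u abL j kap_closed by (simp add: finsum_addf Pi_def)
      finally show "D j (kap (t \<oplus>\<^bsub>T.T\<^esub> u)) x = (D j (kap t) \<oplus>\<^bsub>H\<^esub> D j (kap u)) x"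
        using x by (simp add: H_sel group_algebra_sel)
    qed (simp_all add: D_def H_sel group_algebra_sel)
    have "g (kap (t \<oplus>\<^bsub>T.T\<^esub> u)) =
      (\<Oplus>\<^bsub>T.T\<^esub>j\<in>{..<q}. T.pt (a j) (D j (kap t)) \<oplus>\<^bsub>T.T\<^esub> T.pt (a j) (D j (kap u)))"
      unfolding g_def using ab(1) DV kap_V t u T.pure_add_right pt_closed
      by (intro T.T.finsum_cong'[OF refl]) (auto simp: D_add TM_sel H_sel)
    also have "\<dots> = g (kap t) \<oplus>\<^bsub>T.T\<^esub> g (kap u)"
      unfolding g_def using ab(1) DV kap_V t u pt_closed by (intro T.T.finsum_addf) auto
    finally show ?thesis .
  qed
  have g_kap: "g (kap t) = t" if "t \<in> carrier T.T" for t
    using that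
  proof (induction rule: tensor_induct)
    case zero
    show ?case
      using additive_zero[OF T.T.M.abelian_group_axioms T.T.M.abelian_group_axioms,
          of "\<lambda>t. g (kap t)"] g_add g_closed kap_V by blast
  next
    case (pure c h)
    \<comment> \<open>For c \<otimes> h the function \<open>h\<close> is already invariant, so the
      sum of translates is the trace of b_j c times \<open>h\<close>; the trace lies in
      \<open>K\<close> and can cross the tensor sign.\<close>
    let ?r = "\<lambda>j. trace e (b j \<otimes> c)"
    have bc: "b j \<otimes> c \<in> E" if "j < q" for j using E_ring(6) ab(2) pure(1) that by blast
    have r: "?r j \<in> K" if "j < q" for j
    proof -
      have "\<sigma> (?r j) = ?r j" using pow_trace bc[OF that] E_eq by blast
      moreover have "?r j \<in> carrier L" using trace_closed E_closed bc[OF that] by blast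
      ultimately show ?thesis unfolding K_fixed fixed_def by simp
    qed
    have Dp: "D j (kap (T.pt c h)) = ?r j \<odot>\<^bsub>H\<^esub> h" if j: "j < q" for j
    proof (rule extensionalityI[of _ Z])
      fix x assume x: "x \<in> Z"
      have p: "(\<psi> ^^ k) x \<in> Z" for k using psi_pow_closed x .
      have hx: "(\<sigma> ^^ k) (h ((\<psi> ^^ (m - k)) x)) = h x" if "k < e" for k
      proof -
        have "(\<psi> ^^ k) ((\<psi> ^^ (m - k)) x) = (\<psi> ^^ m) x"
          using that e_le by (metis comp_apply funpow_add le_add_diff_inverse le_trans less_imp_le)
        then show ?thesis using V_pow[OF pure(2) p[of "m - k"], of k] psi_pow[OF x] by simp
      qed
      have "D j (kap (T.pt c h)) x = (\<Oplus>k\<in>{..<e}. (\<sigma> ^^ k) (b j \<otimes> c) \<otimes> h x)"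
        unfolding D_def using x p abL j pure hx E_closed V_closed
        by (simp, intro finsum_cong'[OF refl])
          (auto simp: kap_pure m_assoc[symmetric] pow_mult[of "b j \<otimes> c"])
      also have "\<dots> = ?r j \<otimes> h x"
        unfolding trace_def using abL j pure x E_closed V_closed
        by (intro finsum_ldistr[symmetric]) auto
      finally show "D j (kap (T.pt c h)) x = (?r j \<odot>\<^bsub>H\<^esub> h) x"
        using x by (simp add: H_sel group_algebra_sel)
    qed (simp_all add: D_def H_sel group_algebra_sel)
    have ra: "?r j \<otimes> a j \<in> E" if "j < q" for j
      using E_ring(6) r K_E ab(1) that by blast
    have "g (kap (T.pt c h)) = (\<Oplus>\<^bsub>T.T\<^esub>j\<in>{..<q}. T.pt (?r j \<otimes> a j) h)"
      unfolding g_def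
    proof (intro T.T.finsum_cong'[OF refl])
      fix j assume "j \<in> {..<q}"
      then have j: "j < q" by simp
      have "T.pt (a j) (?r j \<odot>\<^bsub>H\<^esub> h) = T.pt (?r j \<odot>\<^bsub>TM\<^esub> a j) h"
        using T.pure_smult_left[of "?r j" "a j" h] T.pure_smult_right[of "?r j" "a j" h]
          r[OF j] ab(1)[OF j] pure(2) by (simp add: TM_sel H_sel)
      then show "T.pt (a j) (D j (kap (T.pt c h))) = T.pt (?r j \<otimes> a j) h"
        by (simp add: Dp[OF j] TM_sel)
    qed (use ra pure pt_closed in auto)
    also have "\<dots> = T.pt (\<Oplus>\<^bsub>TM\<^esub>j\<in>{..<q}. ?r j \<otimes> a j) h"
      using ra pure pt_closed T.pure_add_left
      by (intro additive_finsum[OF T.M.M.abelian_group_axioms T.T.M.abelian_group_axioms,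
            of "\<lambda>c. T.pt c h", symmetric]) (auto simp: TM_sel H_sel)
    \<comment> \<open>The expansion of \<open>c\<close> along the dual coordinates of
      \<open>E\<close> over \<open>K\<close>: exchanging the sums leaves only the term k =
      0.\<close>
    also have "(\<Oplus>\<^bsub>TM\<^esub>j\<in>{..<q}. ?r j \<otimes> a j) = c"
    proof -
      have cL: "c \<in> carrier L" using pure E_closed by blast
      have inj: "(\<lambda>x. x) \<in> carrier TM \<rightarrow> carrier L" using E_closed by (auto simp: TM_sel)
      have "(\<Oplus>\<^bsub>TM\<^esub>j\<in>{..<q}. ?r j \<otimes> a j) = (\<Oplus>j\<in>{..<q}. ?r j \<otimes> a j)"
        using ra additive_finsum[OF T.M.M.abelian_group_axioms abelian_group_axioms inj,
            of "\<lambda>j. ?r j \<otimes> a j" "{..<q}"] by (auto simp: TM_sel)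
      also have "\<dots> = (\<Oplus>j\<in>{..<q}. \<Oplus>k\<in>{..<e}. a j \<otimes> (\<sigma> ^^ k) (b j) \<otimes> (\<sigma> ^^ k) c)"
      proof (intro finsum_cong'[OF refl])
        fix j assume j: "j \<in> {..<q}"
        have "?r j \<otimes> a j = (\<Oplus>k\<in>{..<e}. (\<sigma> ^^ k) (b j \<otimes> c) \<otimes> a j)"
          unfolding trace_def using abL j cL by (intro finsum_ldistr) auto
        also have "\<dots> = (\<Oplus>k\<in>{..<e}. a j \<otimes> (\<sigma> ^^ k) (b j) \<otimes> (\<sigma> ^^ k) c)"
          using abL j cL by (intro finsum_cong'[OF refl]) (auto simp: pow_mult m_ac)
        finally show "?r j \<otimes> a j = (\<Oplus>k\<in>{..<e}. a j \<otimes> (\<sigma> ^^ k) (b j) \<otimes> (\<sigma> ^^ k) c)" .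
      qed (use abL cL in \<open>auto intro!: finsum_closed\<close>)
      also have "\<dots> = (\<Oplus>k\<in>{..<e}. \<Oplus>j\<in>{..<q}. a j \<otimes> (\<sigma> ^^ k) (b j) \<otimes> (\<sigma> ^^ k) c)"
        using abL cL by (intro finsum_swap) auto
      also have "\<dots> = (\<Oplus>k\<in>{..<e}. if k = 0 then (\<sigma> ^^ k) c else \<zero>)"
      proof (intro finsum_cong'[OF refl])
        fix k assume k: "k \<in> {..<e}"
        have "(\<Oplus>j\<in>{..<q}. a j \<otimes> (\<sigma> ^^ k) (b j) \<otimes> (\<sigma> ^^ k) c) =
            (\<Oplus>j\<in>{..<q}. a j \<otimes> (\<sigma> ^^ k) (b j)) \<otimes> (\<sigma> ^^ k) c"
          using abL cL by (intro finsum_ldistr[symmetric]) auto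
        then show "(\<Oplus>j\<in>{..<q}. a j \<otimes> (\<sigma> ^^ k) (b j) \<otimes> (\<sigma> ^^ k) c) =
            (if k = 0 then (\<sigma> ^^ k) c else \<zero>)"
          using coord k cL by auto
      qed (use cL in auto)
      also have "\<dots> = (\<sigma> ^^ 0) c" using e_pos cL by (intro finsum_delta) auto
      finally show ?thesis by simp
    qed
    finally show ?case .
  next
    case (add t u)
    then show ?case using g_add by simp
  qed
  show ?thesis
    by (rule bij_betw_byWitness[of _ g]) (use g_kap kap_g kap_V g_closed in auto)
qed

lemma B_sel:
  "carrier B = carrier T.T" "add B = add T.T" "\<zero>\<^bsub>B\<^esub> = \<zero>\<^bsub>T.T\<^esub>"
  "c \<odot>\<^bsub>B\<^esub> t = tensor_lift R0 T.T (\<lambda>a h. T.pt (c \<otimes> a) h) t"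
  by (simp_all add: base_change_module_def Let_def)

lemma bilinear_smult:
  assumes c: "c \<in> E"
  shows "bilinear_map R0 TM H T.T (\<lambda>a h. T.pt (c \<otimes> a) h)"
proof -
  have "T.pt (c \<otimes> (k \<otimes> a)) h = k \<odot>\<^bsub>T.T\<^esub> T.pt (c \<otimes> a) h"
    if "k \<in> K" "a \<in> E" "h \<in> V" for k a h
  proof -
    have "c \<otimes> (k \<otimes> a) = k \<otimes> (c \<otimes> a)" using that c E_closed K_closed by (simp add: m_lcomm)
    then show ?thesis
      using T.pure_smult_left[of k "c \<otimes> a" h] that c E_ring(6) by (simp add: TM_sel H_sel)
  qed
  moreover have "T.pt (c \<otimes> (a \<oplus> a')) h = T.pt (c \<otimes> a) h \<oplus>\<^bsub>T.T\<^esub> T.pt (c \<otimes> a') h"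
    if "a \<in> E" "a' \<in> E" "h \<in> V" for a a' h
    using T.pure_add_left[of "c \<otimes> a" "c \<otimes> a'" h] that c E_ring(6) E_closed
    by (simp add: TM_sel H_sel r_distr)
  ultimately show ?thesis
    using T.pure_add_right[of "c \<otimes> _"] T.pure_smult_right[of _ "c \<otimes> _"] c E_ring(6) pt_closed
    by (simp add: bilinear_map_def TM_sel H_sel)
qed

lemma B_smult_closed: "c \<in> E \<Longrightarrow> t \<in> carrier T.T \<Longrightarrow> c \<odot>\<^bsub>B\<^esub> t \<in> carrier T.T"
  using T.tensor_lift_closed[OF T.module_tensor bilinear_smult] by (simp add: B_sel)

lemma kap_smult:
  assumes "c \<in> E" "t \<in> carrier T.T" "x \<in> Z"
  shows "kap (c \<odot>\<^bsub>B\<^esub> t) x = c \<otimes> kap t x"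
  using assms(2)
proof (induction rule: tensor_induct)
  note lift = T.tensor_lift_zero[OF T.module_tensor bilinear_smult[OF assms(1)]]
    T.tensor_lift_pure[OF T.module_tensor bilinear_smult[OF assms(1)], unfolded TM_sel H_sel]
    T.tensor_lift_add[OF T.module_tensor bilinear_smult[OF assms(1)]]
    T.tensor_lift_closed[OF T.module_tensor bilinear_smult[OF assms(1)]]
  {
    case zero
    then show ?case using assms E_closed by (simp add: B_sel lift kap_zero)
  next
    case (pure a h)
    then show ?case
      using assms E_closed E_ring(6) V_closed by (simp add: B_sel lift kap_pure m_assoc)
  next
    case (add t u)
    then show ?case using assms E_closed kap_closed
      by (simp add: B_sel lift kap_add r_distr)
  }
qed

lemma kap_eqI:
  assumes "t \<in> carrier T.T" "u \<in> carrier T.T" "\<And>x. x \<in> Z \<Longrightarrow> kap t x = kap u x"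
  shows "t = u"
proof -
  have "kap t = kap u" unfolding kap_def using assms(3) by (intro restrict_ext) (simp add: kap_def)
  then show ?thesis using kap_bij assms(1,2) by (auto simp: bij_betw_def inj_on_def)
qed

text \<open>Additive axioms are inherited from the tensor product over \<open>K\<close>; those on
  scalars in \<open>E\<close> are checked on functions, where they are pointwise, and pulled back by
  injectivity of \<open>kap\<close>.\<close>

lemma module_B: "module R1 B"
proof (rule moduleI[OF cring_R1])
  show "abelian_group B"
    by (rule abelian_groupI)
      (auto simp: B_sel T.T.M.a_ac intro: T.T.M.l_neg T.T.M.a_inv_closed)
next
  fix a x assume "a \<in> carrier R1" "x \<in> carrier B"
  then show "a \<odot>\<^bsub>B\<^esub> x \<in> carrier B" using B_smult_closed by (simp add: B_sel(1))
next
  fix a b x assume "a \<in> carrier R1" "b \<in> carrier R1" "x \<in> carrier B"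
  then have *: "a \<in> E" "b \<in> E" "x \<in> carrier T.T" by (simp_all add: B_sel(1))
  note cl = * E_closed[OF *(1)] E_closed[OF *(2)] E_ring(6,7)[OF *(1,2)] B_smult_closed[OF *(1,3)]
    B_smult_closed[OF *(2,3)]
  show "(a \<oplus>\<^bsub>R1\<^esub> b) \<odot>\<^bsub>B\<^esub> x = a \<odot>\<^bsub>B\<^esub> x \<oplus>\<^bsub>B\<^esub> b \<odot>\<^bsub>B\<^esub> x"
    using cl B_smult_closed
    by (intro kap_eqI) (simp_all add: B_sel(1-3) kap_smult kap_add kap_closed l_distr)
  show "(a \<otimes>\<^bsub>R1\<^esub> b) \<odot>\<^bsub>B\<^esub> x = a \<odot>\<^bsub>B\<^esub> (b \<odot>\<^bsub>B\<^esub> x)"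
    using cl B_smult_closed
    by (intro kap_eqI) (simp_all add: B_sel(1-3) kap_smult kap_closed m_assoc)
next
  fix a x y assume "a \<in> carrier R1" "x \<in> carrier B" "y \<in> carrier B"
  then have *: "a \<in> E" "x \<in> carrier T.T" "y \<in> carrier T.T" by (simp_all add: B_sel(1))
  then show "a \<odot>\<^bsub>B\<^esub> (x \<oplus>\<^bsub>B\<^esub> y) = a \<odot>\<^bsub>B\<^esub> x \<oplus>\<^bsub>B\<^esub> a \<odot>\<^bsub>B\<^esub> y"
    using B_smult_closed E_closed
    by (intro kap_eqI) (simp_all add: B_sel(1-3) kap_smult kap_add kap_closed r_distr)
next
  fix x assume "x \<in> carrier B"
  then show "\<one>\<^bsub>R1\<^esub> \<odot>\<^bsub>B\<^esub> x = x"
    using B_smult_closed E_ring(3)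
    by (intro kap_eqI) (simp_all add: B_sel(1-3) kap_smult kap_closed)
qed

sublocale B: semilinear_form L "\<sigma> ^^ e" "carrier M" "\<psi> ^^ e" "m div e" E B kap
proof (rule semilinear_form.intro[OF E.semilinear_functions_axioms], rule semilinear_form_axioms.intro)
  show "E = E.fixed 1" by (simp add: E_eq fixed_def E.fixed_def)
qed (simp_all add: module_B B_sel(1-3) kap_bij kap_add kap_smult)

lemma Bh_sel:
  "carrier Bh = carrier T.T" "add Bh = add T.T" "\<zero>\<^bsub>Bh\<^esub> = \<zero>\<^bsub>T.T\<^esub>"
  "module.smult Bh = module.smult B" "\<one>\<^bsub>Bh\<^esub> = T.pt \<one> \<one>\<^bsub>H\<^esub>"
  "t \<otimes>\<^bsub>Bh\<^esub> u = tensor_lift R0 B (\<lambda>a h. tensor_lift R0 B (\<lambda>b k. T.pt (a \<otimes> b) (h \<otimes>\<^bsub>H\<^esub> k)) u) t"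
  "counit Bh = tensor_lift R0 (self_module R1) (\<lambda>a h. a \<otimes> counit H h)"
  "antipode Bh = tensor_lift R0 B (\<lambda>a h. T.pt a (antipode H h))"
  "comult Bh = tensor_lift R0 B.BB.T (\<lambda>a h. a \<odot>\<^bsub>B.BB.T\<^esub>
     tensor_lift R0 B.BB.T (\<lambda>h1 h2. B.BB.pt (T.pt \<one> h1) (T.pt \<one> h2)) (comult H h))"
  by (simp_all add: base_change_def Let_def B_sel(1-3))

lemma tensor_Bh: "tensor R1 Bh Bh = B.BB.T" "pure_tensor R1 Bh Bh = B.BB.pt"
  by (rule tensor_structure_cong; simp add: Bh_sel(1-4) B_sel(1-3))+

end

section \<open>Convolution, and closure of the invariants under the Hopf operations\<close>

context twisted_group
begin

lemma psi_hom: "group_hom M M \<psi>"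
  by unfold_locales (auto simp: hom_def psi_Z psi_mult)

lemmas psi_one = group_hom.hom_one[OF psi_hom]
  and psi_inv = group_hom.hom_inv[OF psi_hom]

definition conv :: "('g \<Rightarrow> 'a) \<Rightarrow> ('g \<Rightarrow> 'a) \<Rightarrow> 'g \<Rightarrow> 'a" where
  "conv f g x = (\<Oplus>y\<in>Z. f y \<otimes> g (inv\<^bsub>M\<^esub> y \<otimes>\<^bsub>M\<^esub> x))"

lemma conv_closed:
  "\<lbrakk>\<And>x. x \<in> Z \<Longrightarrow> f x \<in> carrier L; \<And>x. x \<in> Z \<Longrightarrow> g x \<in> carrier L; x \<in> Z\<rbrakk> \<Longrightarrow> conv f g x \<in> carrier L"
  unfolding conv_def by (intro finsum_closed) auto

lemma conv_add_left:
  assumes "\<And>x. x \<in> Z \<Longrightarrow> f x \<in> carrier L" "\<And>x. x \<in> Z \<Longrightarrow> f' x \<in> carrier L"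
    "\<And>x. x \<in> Z \<Longrightarrow> g x \<in> carrier L" "\<And>x. x \<in> Z \<Longrightarrow> h x = f x \<oplus> f' x" "x \<in> Z"
  shows "conv h g x = conv f g x \<oplus> conv f' g x"
proof -
  let ?g = "\<lambda>y. g (inv\<^bsub>M\<^esub> y \<otimes>\<^bsub>M\<^esub> x)"
  have "conv h g x = (\<Oplus>y\<in>Z. f y \<otimes> ?g y \<oplus> f' y \<otimes> ?g y)"
    unfolding conv_def using assms by (intro finsum_cong'[OF refl]) (auto simp: l_distr)
  then show ?thesis unfolding conv_def using assms by (simp add: finsum_addf Pi_def)
qed

lemma conv_add_right:
  assumes "\<And>x. x \<in> Z \<Longrightarrow> f x \<in> carrier L" "\<And>x. x \<in> Z \<Longrightarrow> f' x \<in> carrier L"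
    "\<And>x. x \<in> Z \<Longrightarrow> g x \<in> carrier L" "\<And>x. x \<in> Z \<Longrightarrow> h x = f x \<oplus> f' x" "x \<in> Z"
  shows "conv g h x = conv g f x \<oplus> conv g f' x"
proof -
  let ?z = "\<lambda>y. inv\<^bsub>M\<^esub> y \<otimes>\<^bsub>M\<^esub> x"
  have "conv g h x = (\<Oplus>y\<in>Z. g y \<otimes> f (?z y) \<oplus> g y \<otimes> f' (?z y))"
    unfolding conv_def using assms by (intro finsum_cong'[OF refl]) (auto simp: r_distr)
  then show ?thesis unfolding conv_def using assms by (simp add: finsum_addf Pi_def)
qed

lemma conv_smult_left:
  assumes "c \<in> carrier L" "\<And>x. x \<in> Z \<Longrightarrow> f x \<in> carrier L"
    "\<And>x. x \<in> Z \<Longrightarrow> g x \<in> carrier L" "\<And>x. x \<in> Z \<Longrightarrow> h x = c \<otimes> f x" "x \<in> Z"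
  shows "conv h g x = c \<otimes> conv f g x"
proof -
  have "conv h g x = (\<Oplus>y\<in>Z. c \<otimes> (f y \<otimes> g (inv\<^bsub>M\<^esub> y \<otimes>\<^bsub>M\<^esub> x)))"
    unfolding conv_def using assms by (intro finsum_cong'[OF refl]) (auto simp: m_assoc)
  then show ?thesis unfolding conv_def using assms by (simp add: finsum_rdistr Pi_def)
qed

lemma conv_smult_right:
  assumes "c \<in> carrier L" "\<And>x. x \<in> Z \<Longrightarrow> f x \<in> carrier L"
    "\<And>x. x \<in> Z \<Longrightarrow> g x \<in> carrier L" "\<And>x. x \<in> Z \<Longrightarrow> h x = c \<otimes> f x" "x \<in> Z"
  shows "conv g h x = c \<otimes> conv g f x"
proof -
  have "conv g h x = (\<Oplus>y\<in>Z. c \<otimes> (g y \<otimes> f (inv\<^bsub>M\<^esub> y \<otimes>\<^bsub>M\<^esub> x)))"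
    unfolding conv_def using assms by (intro finsum_cong'[OF refl]) (auto simp: m_lcomm)
  then show ?thesis unfolding conv_def using assms by (simp add: finsum_rdistr Pi_def)
qed

lemma H_mult: "f \<otimes>\<^bsub>H\<^esub> g = restrict (conv f g) Z"
  by (simp add: H_sel group_algebra_sel conv_def[abs_def])

lemma H_mult_V:
  assumes f: "f \<in> V" and g: "g \<in> V"
  shows "f \<otimes>\<^bsub>H\<^esub> g \<in> V"
  unfolding H_mult
proof (rule V_I)
  fix x assume x: "x \<in> Z"
  have px: "\<psi> x \<in> Z" using psi_Z x .
  have fg: "f y \<in> carrier L" "g y \<in> carrier L" if "y \<in> Z" for y using f g V_closed that by auto
  have "conv f g (\<psi> x) = (\<Oplus>y\<in>\<psi> ` Z. f y \<otimes> g (inv\<^bsub>M\<^esub> y \<otimes>\<^bsub>M\<^esub> \<psi> x))"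
    by (simp add: psi_bij conv_def)
  also have "\<dots> = (\<Oplus>y\<in>Z. f (\<psi> y) \<otimes> g (inv\<^bsub>M\<^esub> \<psi> y \<otimes>\<^bsub>M\<^esub> \<psi> x))"
    using fg psi_bij px psi_Z by (intro add.finprod_reindex) auto
  also have "\<dots> = (\<Oplus>y\<in>Z. \<sigma> (f y \<otimes> g (inv\<^bsub>M\<^esub> y \<otimes>\<^bsub>M\<^esub> x)))"
  proof (intro finsum_cong'[OF refl])
    fix y assume y: "y \<in> Z"
    then have "inv\<^bsub>M\<^esub> \<psi> y \<otimes>\<^bsub>M\<^esub> \<psi> x = \<psi> (inv\<^bsub>M\<^esub> y \<otimes>\<^bsub>M\<^esub> x)"
      using x by (simp add: psi_mult psi_inv)
    then show "f (\<psi> y) \<otimes> g (inv\<^bsub>M\<^esub> \<psi> y \<otimes>\<^bsub>M\<^esub> \<psi> x) = \<sigma> (f y \<otimes> g (inv\<^bsub>M\<^esub> y \<otimes>\<^bsub>M\<^esub> x))"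
      using x y f g fg by (simp add: V_psi sigma_hom)
  qed (use x fg sigma_hom in auto)
  also have "\<dots> = \<sigma> (conv f g x)"
    unfolding conv_def using pow_finsum[of "\<lambda>y. f y \<otimes> g (inv\<^bsub>M\<^esub> y \<otimes>\<^bsub>M\<^esub> x)" Z 1] fg x by auto
  finally show "restrict (conv f g) Z (\<psi> x) = \<sigma> (restrict (conv f g) Z x)"
    using x px by simp
qed (use f g V_closed conv_closed in auto)

lemma H_one: "x \<in> Z \<Longrightarrow> \<one>\<^bsub>H\<^esub> x = (if x = \<one>\<^bsub>M\<^esub> then \<one> else \<zero>)"
  by (simp add: H_sel group_algebra_sel free_basis_def)

lemma H_one_V: "\<one>\<^bsub>H\<^esub> \<in> V"
proof (rule V_I)
  fix x assume x: "x \<in> Z"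
  have "\<psi> x = \<one>\<^bsub>M\<^esub> \<longleftrightarrow> x = \<one>\<^bsub>M\<^esub>"
    using psi_one psi_bij(1) x by (metis M.one_closed inj_onD)
  then show "\<one>\<^bsub>H\<^esub> (\<psi> x) = \<sigma> (\<one>\<^bsub>H\<^esub> x)" using x psi_Z by (simp add: H_one sigma_hom)
qed (auto simp: H_one, simp add: H_sel group_algebra_sel)

lemma H_antipode_V: "h \<in> V \<Longrightarrow> antipode H h \<in> V"
  by (rule V_I) (auto simp: H_sel group_algebra_sel V_closed psi_Z psi_inv[symmetric] V_psi)

text \<open>The counit is the pairing with the constant function 1, which belongs to
  \<open>V\<close>.\<close>

lemma counit_K: "h \<in> V \<Longrightarrow> counit H h \<in> K"
proof -
  assume h: "h \<in> V"
  have "(\<lambda>x\<in>Z. \<one>) \<in> V" by (rule V_I) (auto simp: psi_Z sigma_hom)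
  then have "(\<Oplus>x\<in>Z. h x \<otimes> (\<lambda>x\<in>Z. \<one>) x) \<in> K" using H.sum_product_fixed h by blast
  moreover have "(\<Oplus>x\<in>Z. h x \<otimes> (\<lambda>x\<in>Z. \<one>) x) = (\<Oplus>x\<in>Z. h x)"
    using h V_closed by (intro finsum_cong'[OF refl]) auto
  ultimately show ?thesis by (simp add: H_sel group_algebra_sel)
qed

end

section \<open>The Hopf operations of the base change in coordinates\<close>

context base_changed
begin

lemma module_B0: "module R0 B"
  using module_restrict_scalars[OF module_B, of K] K_E cring_R0 by simp

text \<open>Operations of the base change are lifts of maps that act on functions as a \<otimes> h
  \<mapsto> a G(h) with \<open>G\<close> linear over \<open>L\<close>. Injectivity of
  \<open>kap\<close> makes such a map bilinear, and its lift acts as \<open>G\<close> itself.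
  Linearity of \<open>G\<close> is required in terms of values on \<open>Z\<close> only, so that
  nothing depends on values elsewhere.\<close>

lemma lift_kap:
  fixes G :: "('g \<Rightarrow> 'a) \<Rightarrow> 'g \<Rightarrow> 'a"
  assumes G_closed: "\<And>f x. \<lbrakk>\<And>y. y \<in> Z \<Longrightarrow> f y \<in> carrier L; x \<in> Z\<rbrakk> \<Longrightarrow> G f x \<in> carrier L"
    and G_add: "\<And>f g h x. \<lbrakk>\<And>y. y \<in> Z \<Longrightarrow> f y \<in> carrier L; \<And>y. y \<in> Z \<Longrightarrow> g y \<in> carrier L;
      \<And>y. y \<in> Z \<Longrightarrow> h y = f y \<oplus> g y; x \<in> Z\<rbrakk> \<Longrightarrow> G h x = G f x \<oplus> G g x"
    and G_smult: "\<And>c f h x. \<lbrakk>c \<in> carrier L; \<And>y. y \<in> Z \<Longrightarrow> f y \<in> carrier L;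
      \<And>y. y \<in> Z \<Longrightarrow> h y = c \<otimes> f y; x \<in> Z\<rbrakk> \<Longrightarrow> G h x = c \<otimes> G f x"
    and \<beta>_closed: "\<And>a h. \<lbrakk>a \<in> E; h \<in> V\<rbrakk> \<Longrightarrow> \<beta> a h \<in> carrier T.T"
    and \<beta>_kap: "\<And>a h x. \<lbrakk>a \<in> E; h \<in> V; x \<in> Z\<rbrakk> \<Longrightarrow> kap (\<beta> a h) x = a \<otimes> G h x"
    and t: "t \<in> carrier T.T"
  shows "tensor_lift R0 B \<beta> t \<in> carrier T.T"
    "x \<in> Z \<Longrightarrow> kap (tensor_lift R0 B \<beta> t) x = G (kap t) x"
proof -
  have KE: "c \<in> E" if "c \<in> K" for c using K_E that by blast
  have GV: "G h x \<in> carrier L" if "h \<in> V" "x \<in> Z" for h x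
    using G_closed[of h x] V_closed that by blast
  have addV: "h \<oplus>\<^bsub>H\<^esub> h' \<in> V" if "h \<in> V" "h' \<in> V" for h h'
    using H.BB.M.M.a_closed[of h h'] that by (simp add: H_sel)
  have bil: "bilinear_map R0 TM H B \<beta>"
    unfolding bilinear_map_def TM_sel H_sel(1) B_sel(1) ring.simps
  proof (intro conjI ballI)
    fix a h assume ah: "a \<in> E" "h \<in> V"
    show "\<beta> a h \<in> carrier T.T" using \<beta>_closed ah .
    {
      fix a' assume a': "a' \<in> E"
      show "\<beta> (a \<oplus> a') h = \<beta> a h \<oplus>\<^bsub>B\<^esub> \<beta> a' h"
        unfolding B_sel(2) using ah a' \<beta>_closed E_ring(7) E_closed GV
        by (intro kap_eqI) (auto simp: \<beta>_kap kap_add l_distr)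
    }
    {
      fix h' assume h': "h' \<in> V"
      have "G (h \<oplus>\<^bsub>H\<^esub> h') x = G h x \<oplus> G h' x" if "x \<in> Z" for x
        using ah h' that V_closed by (intro G_add) (auto simp: H_sel group_algebra_sel)
      then show "\<beta> a (h \<oplus>\<^bsub>H\<^esub> h') = \<beta> a h \<oplus>\<^bsub>B\<^esub> \<beta> a h'"
        unfolding B_sel(2) using ah h' \<beta>_closed E_closed GV addV
        by (intro kap_eqI) (auto simp: \<beta>_kap kap_add r_distr)
    }
  next
    fix c a h assume *: "c \<in> carrier R0" "a \<in> E" "h \<in> V"
    then have c: "c \<in> K" by simp
    show "\<beta> (c \<otimes> a) h = c \<odot>\<^bsub>B\<^esub> \<beta> a h"
      using * c KE \<beta>_closed E_ring(6) E_closed GV B_smult_closed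
      by (intro kap_eqI) (auto simp: \<beta>_kap kap_smult m_assoc)
    have "G (c \<odot>\<^bsub>H\<^esub> h) x = c \<otimes> G h x" if "x \<in> Z" for x
      using * c K_closed that V_closed by (intro G_smult) (auto simp: H_sel group_algebra_sel)
    then show "\<beta> a (c \<odot>\<^bsub>H\<^esub> h) = c \<odot>\<^bsub>B\<^esub> \<beta> a h"
      using * c KE \<beta>_closed E_ring(6) E_closed GV B_smult_closed fun_smult_V
      by (intro kap_eqI) (auto simp: \<beta>_kap kap_smult m_lcomm)
  qed
  note lift = T.tensor_lift_closed[OF module_B0 bil, unfolded B_sel(1)]
    T.tensor_lift_zero[OF module_B0 bil, unfolded B_sel(3)]
    T.tensor_lift_add[OF module_B0 bil, unfolded B_sel(2)]
    T.tensor_lift_pure[OF module_B0 bil, unfolded TM_sel H_sel]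
  show "tensor_lift R0 B \<beta> t \<in> carrier T.T" using lift(1) t .
  show "kap (tensor_lift R0 B \<beta> t) x = G (kap t) x" if x: "x \<in> Z"
    using t
  proof (induction rule: tensor_induct)
    case zero
    have "G (kap \<zero>\<^bsub>T.T\<^esub>) x = \<zero> \<otimes> G (kap \<zero>\<^bsub>T.T\<^esub>) x"
      using x by (intro G_smult) (auto simp: kap_zero)
    moreover have "G (kap \<zero>\<^bsub>T.T\<^esub>) x \<in> carrier L"
      using x by (intro G_closed) (auto simp: kap_zero)
    ultimately show ?case using x by (simp add: lift kap_zero)
  next
    case (pure a h)
    then have "G (kap (T.pt a h)) x = a \<otimes> G h x"
      using x E_closed V_closed by (intro G_smult) (auto simp: kap_pure)
    then show ?case using pure x by (simp add: lift \<beta>_kap)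
  next
    case (add t u)
    then have "G (kap (t \<oplus>\<^bsub>T.T\<^esub> u)) x = G (kap t) x \<oplus> G (kap u) x"
      using x kap_closed by (intro G_add) (auto simp: kap_add)
    then show ?case using add x by (simp add: lift kap_add)
  qed
qed

text \<open>The product is a lift within a lift. \<open>lift_kap\<close> is applied to the inner one
  with f \<mapsto> a (h * f), where \<open>*\<close> is convolution and \<open>a\<close>,
  \<open>h\<close> are fixed, and then to the outer one with convolution by the second
  factor.\<close>

lemma Bh_mult:
  assumes t: "t \<in> carrier T.T" and u: "u \<in> carrier T.T"
  shows "t \<otimes>\<^bsub>Bh\<^esub> u \<in> carrier T.T"
    "x \<in> Z \<Longrightarrow> kap (t \<otimes>\<^bsub>Bh\<^esub> u) x = conv (kap t) (kap u) x"
proof -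
  define I where "I a h = tensor_lift R0 B (\<lambda>b k. T.pt (a \<otimes> b) (h \<otimes>\<^bsub>H\<^esub> k)) u" for a h
  have I: "I a h \<in> carrier T.T" "x \<in> Z \<Longrightarrow> kap (I a h) x = a \<otimes> conv h (kap u) x"
    if a: "a \<in> E" and h: "h \<in> V" for a h x
  proof -
    note aL = E_closed[OF a] and hL = V_closed[OF h]
    have G1: "a \<otimes> conv h f x \<in> carrier L" if "\<And>y. y \<in> Z \<Longrightarrow> f y \<in> carrier L" "x \<in> Z" for f x
      using aL hL that conv_closed by simp
    have G2: "a \<otimes> conv h k x = a \<otimes> conv h f x \<oplus> a \<otimes> conv h g x"
      if "\<And>y. y \<in> Z \<Longrightarrow> f y \<in> carrier L" "\<And>y. y \<in> Z \<Longrightarrow> g y \<in> carrier L"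
      "\<And>y. y \<in> Z \<Longrightarrow> k y = f y \<oplus> g y" "x \<in> Z" for f g k x
      using conv_add_right[of f g h k x] that hL aL conv_closed by (simp add: r_distr)
    have G3: "a \<otimes> conv h k x = c \<otimes> (a \<otimes> conv h f x)"
      if "c \<in> carrier L" "\<And>y. y \<in> Z \<Longrightarrow> f y \<in> carrier L" "\<And>y. y \<in> Z \<Longrightarrow> k y = c \<otimes> f y" "x \<in> Z"
      for c f k x
      using conv_smult_right[of c f h k x] that hL aL conv_closed by (simp add: m_lcomm)
    have G4: "T.pt (a \<otimes> b) (h \<otimes>\<^bsub>H\<^esub> k) \<in> carrier T.T" if "b \<in> E" "k \<in> V" for b k
      using pt_closed E_ring(6) H_mult_V a h that by blast
    have G5: "kap (T.pt (a \<otimes> b) (h \<otimes>\<^bsub>H\<^esub> k)) x = b \<otimes> (a \<otimes> conv h k x)"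
      if "b \<in> E" "k \<in> V" "x \<in> Z" for b k x
    proof -
      have "kap (T.pt (a \<otimes> b) (h \<otimes>\<^bsub>H\<^esub> k)) x = (a \<otimes> b) \<otimes> (h \<otimes>\<^bsub>H\<^esub> k) x"
        using that a h E_ring(6) H_mult_V by (intro kap_pure) auto
      then show ?thesis
        using that aL hL E_closed V_closed conv_closed[of h k x] by (simp add: H_mult m_ac)
    qed
    note L = lift_kap[of "\<lambda>f x. a \<otimes> conv h f x" "\<lambda>b k. T.pt (a \<otimes> b) (h \<otimes>\<^bsub>H\<^esub> k)", OF G1 G2 G3 G4 G5 u]
    show "I a h \<in> carrier T.T" unfolding I_def by (rule L(1)) auto
    show "x \<in> Z \<Longrightarrow> kap (I a h) x = a \<otimes> conv h (kap u) x" unfolding I_def by (rule L(2)) auto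
  qed
  have uL: "kap u x \<in> carrier L" if "x \<in> Z" for x using kap_closed u that .
  note L = lift_kap[of "\<lambda>f x. conv f (kap u) x" I,
      OF conv_closed[OF _ uL] conv_add_left[OF _ _ uL] conv_smult_left[OF _ _ uL] I t]
  have eq: "t \<otimes>\<^bsub>Bh\<^esub> u = tensor_lift R0 B I t"
    by (simp add: Bh_sel I_def[abs_def])
  show "t \<otimes>\<^bsub>Bh\<^esub> u \<in> carrier T.T" unfolding eq by (rule L(1)) auto
  show "x \<in> Z \<Longrightarrow> kap (t \<otimes>\<^bsub>Bh\<^esub> u) x = conv (kap t) (kap u) x"
    unfolding eq by (rule L(2)) auto
qed

lemma Bh_one: "\<one>\<^bsub>Bh\<^esub> \<in> carrier T.T" "x \<in> Z \<Longrightarrow> kap \<one>\<^bsub>Bh\<^esub> x = (if x = \<one>\<^bsub>M\<^esub> then \<one> else \<zero>)"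
  using pt_closed[OF E_ring(3) H_one_V] kap_pure[OF E_ring(3) H_one_V]
  by (simp_all add: Bh_sel H_one)

lemma Bh_antipode:
  assumes "t \<in> carrier T.T"
  shows "antipode Bh t \<in> carrier T.T" "x \<in> Z \<Longrightarrow> kap (antipode Bh t) x = kap t (inv\<^bsub>M\<^esub> x)"
proof -
  have b: "kap (T.pt a (antipode H h)) x = a \<otimes> h (inv\<^bsub>M\<^esub> x)" if "a \<in> E" "h \<in> V" "x \<in> Z" for a h x
    using kap_pure[OF that(1) H_antipode_V[OF that(2)] that(3)] that by (simp add: H_sel group_algebra_sel)
  note L = lift_kap[of "\<lambda>f x. f (inv\<^bsub>M\<^esub> x)" "\<lambda>a h. T.pt a (antipode H h)",
      OF _ _ _ pt_closed[OF _ H_antipode_V] b assms]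
  show "antipode Bh t \<in> carrier T.T" unfolding Bh_sel by (rule L(1)) auto
  show "x \<in> Z \<Longrightarrow> kap (antipode Bh t) x = kap t (inv\<^bsub>M\<^esub> x)" unfolding Bh_sel by (rule L(2)) auto
qed

lemma Bh_counit:
  assumes "t \<in> carrier T.T"
  shows "counit Bh t = (\<Oplus>x\<in>Z. kap t x)"
proof -
  have c: "counit H h = (\<Oplus>x\<in>Z. h x)" for h by (simp add: H_sel group_algebra_sel)
  have cL: "counit H h \<in> carrier L" "counit H h \<in> E" if "h \<in> V" for h
    using counit_K[OF that] K_closed K_E by auto
  have c_add: "counit H (h \<oplus>\<^bsub>H\<^esub> h') = counit H h \<oplus> counit H h'" if "h \<in> V" "h' \<in> V" for h h'
  proof -
    have "counit H (h \<oplus>\<^bsub>H\<^esub> h') = (\<Oplus>x\<in>Z. h x \<oplus> h' x)"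
      unfolding c using that V_closed
      by (intro finsum_cong'[OF refl]) (auto simp: H_sel group_algebra_sel)
    then show ?thesis unfolding c using that V_closed by (simp add: finsum_addf Pi_def)
  qed
  have c_smult: "counit H (k \<odot>\<^bsub>H\<^esub> h) = k \<otimes> counit H h" if "k \<in> K" "h \<in> V" for k h
  proof -
    have "counit H (k \<odot>\<^bsub>H\<^esub> h) = (\<Oplus>x\<in>Z. k \<otimes> h x)"
      unfolding c using that V_closed K_closed
      by (intro finsum_cong'[OF refl]) (auto simp: H_sel group_algebra_sel)
    then show ?thesis unfolding c using that V_closed K_closed by (simp add: finsum_rdistr Pi_def)
  qed
  have bil: "bilinear_map R0 TM H TM (\<lambda>a h. a \<otimes> counit H h)"
    using c_add c_smult cL E_closed K_closed E_ring(6)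
    by (auto simp: bilinear_map_def TM_sel H_sel(1) l_distr r_distr m_ac)
  note lift = T.tensor_lift_zero[OF module_TM bil, unfolded TM_sel]
    T.tensor_lift_add[OF module_TM bil, unfolded TM_sel]
    T.tensor_lift_pure[OF module_TM bil, unfolded TM_sel H_sel(1)]
  show ?thesis
    unfolding Bh_sel using assms
  proof (induction rule: tensor_induct)
    case zero
    have "(\<Oplus>x\<in>Z. kap \<zero>\<^bsub>T.T\<^esub> x) = \<zero>" by (rule add.finprod_one_eqI) (simp add: kap_zero)
    then show ?case by (simp add: lift)
  next
    case (pure a h)
    have "(\<Oplus>x\<in>Z. kap (T.pt a h) x) = (\<Oplus>x\<in>Z. a \<otimes> h x)"
      using pure E_closed V_closed by (intro finsum_cong'[OF refl]) (auto simp: kap_pure)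
    also have "\<dots> = a \<otimes> counit H h"
      unfolding c using pure E_closed V_closed by (intro finsum_rdistr[symmetric]) auto
    finally show ?case using pure by (simp add: lift)
  next
    case (add t u)
    have "(\<Oplus>x\<in>Z. kap (t \<oplus>\<^bsub>T.T\<^esub> u) x) = (\<Oplus>x\<in>Z. kap t x \<oplus> kap u x)"
      using add kap_closed by (intro finsum_cong'[OF refl]) (auto simp: kap_add)
    also have "\<dots> = (\<Oplus>x\<in>Z. kap t x) \<oplus> (\<Oplus>x\<in>Z. kap u x)"
      using add kap_closed by (intro finsum_addf) auto
    finally show ?case using add by (simp add: lift)
  qed
qed

lemma module_BB0: "module R0 B.BB.T"
  using module_restrict_scalars[OF B.BB.module_tensor, of K] K_E cring_R0 by simp

text \<open>After scalar extension the comultiplication is still the diagonal. Both bilinearity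
  conditions behind its definition are verified on two-variable functions.\<close>

lemma Bh_comult:
  assumes t: "t \<in> carrier T.T"
  shows "comult Bh t \<in> carrier B.BB.T"
    "\<lbrakk>x \<in> Z; y \<in> Z\<rbrakk> \<Longrightarrow> B.kappa2 (comult Bh t) x y = (if x = y then kap t x else \<zero>)"
proof -
  have KE: "c \<in> E" if "c \<in> K" for c using K_E that by blast
  note oneE = E_ring(3)
  have pc: "T.pt \<one> h \<in> carrier B" "x \<in> Z \<Longrightarrow> kap (T.pt \<one> h) x = h x" if "h \<in> V" for h x
    using that pt_closed[OF oneE] kap_pure[OF oneE] V_closed by (simp_all add: B_sel(1))
  have addV: "h \<oplus>\<^bsub>H\<^esub> h' \<in> V" "x \<in> Z \<Longrightarrow> (h \<oplus>\<^bsub>H\<^esub> h') x = h x \<oplus> h' x"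
    if "h \<in> V" "h' \<in> V" for h h' x
    using H.BB.M.M.a_closed[of h h'] that by (simp_all add: H_sel group_algebra_sel)
  have smV: "x \<in> Z \<Longrightarrow> (c \<odot>\<^bsub>H\<^esub> h) x = c \<otimes> h x" for c h x
    by (simp add: H_sel group_algebra_sel)
  let ?\<gamma> = "\<lambda>h1 h2. B.BB.pt (T.pt \<one> h1) (T.pt \<one> h2)"
  have \<gamma>: "?\<gamma> h1 h2 \<in> carrier B.BB.T" if "h1 \<in> V" "h2 \<in> V" for h1 h2
    using B.BB.pure_closed pc that by blast
  have \<gamma>k: "B.kappa2 (?\<gamma> h1 h2) x y = h1 x \<otimes> h2 y" if "h1 \<in> V" "h2 \<in> V" "x \<in> Z" "y \<in> Z"
    for h1 h2 x y
    using B.kappa2_pure[OF pc(1)[OF that(1)] pc(1)[OF that(2)] that(3,4)] pc that by simp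
  have bil1: "bilinear_map R0 H H B.BB.T ?\<gamma>"
    unfolding bilinear_map_def H_sel(1) ring.simps
  proof (intro conjI ballI)
    fix h1 h2 assume h: "h1 \<in> V" "h2 \<in> V"
    show "?\<gamma> h1 h2 \<in> carrier B.BB.T" using \<gamma> h .
    {
      fix h' assume h': "h' \<in> V"
      show "?\<gamma> (h1 \<oplus>\<^bsub>H\<^esub> h') h2 = ?\<gamma> h1 h2 \<oplus>\<^bsub>B.BB.T\<^esub> ?\<gamma> h' h2"
        using h h' \<gamma> addV V_closed
        by (intro B.kappa2_eqI) (simp_all add: \<gamma>k B.kappa2_add l_distr)
      show "?\<gamma> h1 (h2 \<oplus>\<^bsub>H\<^esub> h') = ?\<gamma> h1 h2 \<oplus>\<^bsub>B.BB.T\<^esub> ?\<gamma> h1 h'"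
        using h h' \<gamma> addV V_closed
        by (intro B.kappa2_eqI) (simp_all add: \<gamma>k B.kappa2_add r_distr)
    }
    {
      fix c assume "c \<in> carrier R0"
      then have c: "c \<in> K" by simp
      show "?\<gamma> (c \<odot>\<^bsub>H\<^esub> h1) h2 = c \<odot>\<^bsub>B.BB.T\<^esub> ?\<gamma> h1 h2"
        using h c \<gamma> smV V_closed fun_smult_V KE K_closed B.BB.T.smult_closed
        by (intro B.kappa2_eqI) (simp_all add: \<gamma>k B.kappa2_smult m_assoc)
      show "?\<gamma> h1 (c \<odot>\<^bsub>H\<^esub> h2) = c \<odot>\<^bsub>B.BB.T\<^esub> ?\<gamma> h1 h2"
        using h c \<gamma> smV V_closed fun_smult_V KE K_closed B.BB.T.smult_closed
        by (intro B.kappa2_eqI) (simp_all add: \<gamma>k B.kappa2_smult m_lcomm)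
    }
  qed
  \<comment> \<open>The canonical map H \<otimes> H \<rightarrow> B \<otimes> B from the tensor
    square over \<open>K\<close> to that over \<open>E\<close>; it preserves the two-variable
    function.\<close>
  define J where "J = tensor_lift R0 B.BB.T ?\<gamma>"
  note lift1 = H.BB.tensor_lift_closed[OF module_BB0 bil1, folded J_def]
    H.BB.tensor_lift_zero[OF module_BB0 bil1, folded J_def]
    H.BB.tensor_lift_add[OF module_BB0 bil1, folded J_def]
    H.BB.tensor_lift_pure[OF module_BB0 bil1, folded J_def, unfolded H_sel(1)]
  have Jk: "B.kappa2 (J s) x y = H.kappa2 s x y" if s: "s \<in> carrier H.BB.T" and x: "x \<in> Z" and y: "y \<in> Z"
    for s x y
    using s
  proof (induction rule: H.BB.tensor_induct)
    case zero
    then show ?case using x y by (simp add: lift1 B.kappa2_zero H.kappa2_zero)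
  next
    case (pure f g)
    then have "f \<in> V" "g \<in> V" by (simp_all add: H_sel)
    then show ?case using x y H.kappa2_pure[OF pure x y] by (simp add: lift1 \<gamma>k)
  next
    case (add t u)
    then show ?case using x y lift1(1) by (simp add: lift1(3) H.kappa2_add B.kappa2_add)
  qed
  let ?\<beta> = "\<lambda>a h. a \<odot>\<^bsub>B.BB.T\<^esub> J (comult H h)"
  have J: "J (comult H h) \<in> carrier B.BB.T" if "h \<in> V" for h
    using lift1(1) comult_H(1)[OF that] .
  have \<beta>: "?\<beta> a h \<in> carrier B.BB.T" if "a \<in> E" "h \<in> V" for a h
    using B.BB.T.smult_closed J that by simp
  have \<beta>k: "B.kappa2 (?\<beta> a h) x y = a \<otimes> (if x = y then h x else \<zero>)"
    if "a \<in> E" "h \<in> V" "x \<in> Z" "y \<in> Z" for a h x y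
    using that by (simp add: B.kappa2_smult J Jk comult_H)
  have bil2: "bilinear_map R0 TM H B.BB.T ?\<beta>"
    unfolding bilinear_map_def TM_sel H_sel(1) ring.simps
  proof (intro conjI ballI)
    fix a h assume ah: "a \<in> E" "h \<in> V"
    show "?\<beta> a h \<in> carrier B.BB.T" using \<beta> ah .
    {
      fix a' assume a': "a' \<in> E"
      show "?\<beta> (a \<oplus> a') h = ?\<beta> a h \<oplus>\<^bsub>B.BB.T\<^esub> ?\<beta> a' h"
        using ah a' \<beta> E_ring(7) E_closed V_closed
        by (intro B.kappa2_eqI) (simp_all add: \<beta>k B.kappa2_add l_distr)
    }
    {
      fix h' assume h': "h' \<in> V"
      show "?\<beta> a (h \<oplus>\<^bsub>H\<^esub> h') = ?\<beta> a h \<oplus>\<^bsub>B.BB.T\<^esub> ?\<beta> a h'"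
        using ah h' \<beta> addV E_closed V_closed
        by (intro B.kappa2_eqI) (simp_all add: \<beta>k B.kappa2_add r_distr)
    }
    {
      fix c assume "c \<in> carrier R0"
      then have c: "c \<in> K" by simp
      show "?\<beta> (c \<otimes> a) h = c \<odot>\<^bsub>B.BB.T\<^esub> ?\<beta> a h"
        using ah c \<beta> V_closed KE K_closed E_closed E_ring(6) B.BB.T.smult_closed
        by (intro B.kappa2_eqI) (simp_all add: \<beta>k B.kappa2_smult m_assoc)
      show "?\<beta> a (c \<odot>\<^bsub>H\<^esub> h) = c \<odot>\<^bsub>B.BB.T\<^esub> ?\<beta> a h"
        using ah c \<beta> V_closed KE K_closed E_closed fun_smult_V smV B.BB.T.smult_closed
        by (intro B.kappa2_eqI) (simp_all add: \<beta>k B.kappa2_smult m_lcomm)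
    }
  qed
  have eq: "comult Bh = tensor_lift R0 B.BB.T ?\<beta>" by (simp add: Bh_sel J_def)
  note lift2 = T.tensor_lift_closed[OF module_BB0 bil2, folded eq]
    T.tensor_lift_zero[OF module_BB0 bil2, folded eq]
    T.tensor_lift_add[OF module_BB0 bil2, folded eq]
    T.tensor_lift_pure[OF module_BB0 bil2, folded eq, unfolded TM_sel H_sel(1)]
  show "comult Bh t \<in> carrier B.BB.T" using lift2(1) t .
  show "B.kappa2 (comult Bh t) x y = (if x = y then kap t x else \<zero>)" if x: "x \<in> Z" and y: "y \<in> Z"
    using t
  proof (induction rule: tensor_induct)
    case zero
    then show ?case using x y by (simp add: lift2 B.kappa2_zero kap_zero)
  next
    case (pure a h)
    then show ?case using x y E_closed by (simp add: lift2 \<beta>k kap_pure)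
  next
    case (add t u)
    then show ?case using x y lift2(1) kap_closed by (simp add: lift2(3) B.kappa2_add kap_add)
  qed
qed

end

section \<open>Isomorphisms of base-changed Hopf algebras\<close>

context semilinear_form
begin

text \<open>The form spans all functions on \<open>Z\<close> over \<open>L\<close>: by duality c(y)
  = sum_j (sum_x c(x) v_j(x)) w_j(y), so the coefficients are recovered from the values of the
  functional at the v_j.\<close>

lemma functional_eqI:
  assumes c: "\<And>x. x \<in> Z \<Longrightarrow> c x \<in> carrier L" and d: "\<And>x. x \<in> Z \<Longrightarrow> d x \<in> carrier L"
    and eq: "\<And>f. f \<in> V \<Longrightarrow> (\<Oplus>x\<in>Z. c x \<otimes> f x) = (\<Oplus>x\<in>Z. d x \<otimes> f x)" and y: "y \<in> Z"
  shows "c y = d y"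
proof -
  have vw: "fv j x \<in> carrier L" "fw j x \<in> carrier L" if "j \<in> fJ" "x \<in> Z" for j x
    using frame V_closed that by blast+
  have expand: "c y = (\<Oplus>j\<in>fJ. (\<Oplus>x\<in>Z. c x \<otimes> fv j x) \<otimes> fw j y)"
    if c: "\<And>x. x \<in> Z \<Longrightarrow> c x \<in> carrier L" for c
  proof -
    have "(\<Oplus>j\<in>fJ. (\<Oplus>x\<in>Z. c x \<otimes> fv j x) \<otimes> fw j y) = (\<Oplus>j\<in>fJ. \<Oplus>x\<in>Z. c x \<otimes> fv j x \<otimes> fw j y)"
      using c vw y by (intro finsum_cong'[OF refl] finsum_ldistr) (auto intro!: finsum_closed)
    also have "\<dots> = (\<Oplus>x\<in>Z. \<Oplus>j\<in>fJ. c x \<otimes> fv j x \<otimes> fw j y)"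
      using c vw y frame(1) by (intro finsum_swap) auto
    also have "\<dots> = (\<Oplus>x\<in>Z. if x = y then c x else \<zero>)"
    proof (intro finsum_cong'[OF refl])
      fix x assume x: "x \<in> Z"
      have "(\<Oplus>j\<in>fJ. c x \<otimes> fv j x \<otimes> fw j y) = (\<Oplus>j\<in>fJ. c x \<otimes> (fv j x \<otimes> fw j y))"
        using c vw x y by (intro finsum_cong'[OF refl]) (auto simp: m_assoc)
      also have "\<dots> = c x \<otimes> (\<Oplus>j\<in>fJ. fv j x \<otimes> fw j y)"
        using c vw x y frame(1) by (intro finsum_rdistr[symmetric]) auto
      finally show "(\<Oplus>j\<in>fJ. c x \<otimes> fv j x \<otimes> fw j y) = (if x = y then c x else \<zero>)"
        using frame(4)[OF x y] c x by auto
    qed (use c in auto)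
    also have "\<dots> = c y" using y c by (intro finsum_delta) auto
    finally show ?thesis by simp
  qed
  have "(\<Oplus>j\<in>fJ. (\<Oplus>x\<in>Z. c x \<otimes> fv j x) \<otimes> fw j y) = (\<Oplus>j\<in>fJ. (\<Oplus>x\<in>Z. d x \<otimes> fv j x) \<otimes> fw j y)"
    using eq frame(2) d vw y by (intro finsum_cong'[OF refl]) (auto intro!: finsum_closed)
  then show ?thesis using expand[of c] expand[of d] c d by simp
qed

text \<open>The evaluations at \<open>x\<close> and \<open>y\<close> are functionals agreeing on
  \<open>V\<close>, hence have the same coefficients.\<close>

lemma V_separates:
  assumes "x \<in> Z" "y \<in> Z" "\<And>f. f \<in> V \<Longrightarrow> f x = f y"
  shows "x = y"
proof -
  have "(\<lambda>z. if z = x then \<one> else \<zero>) x = (\<lambda>z. if z = y then \<one> else \<zero>) x"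
  proof (rule functional_eqI[of "\<lambda>z. if z = x then \<one> else \<zero>" "\<lambda>z. if z = y then \<one> else \<zero>" x])
    fix f assume f: "f \<in> V"
    have "(\<Oplus>z\<in>Z. (if z = a then \<one> else \<zero>) \<otimes> f z) = f a" if a: "a \<in> Z" for a
    proof -
      have "(\<Oplus>z\<in>Z. (if z = a then \<one> else \<zero>) \<otimes> f z) = (\<Oplus>z\<in>Z. if z = a then f z else \<zero>)"
        using f V_closed by (intro finsum_cong'[OF refl]) auto
      then show ?thesis using finsum_delta[of Z a f] a f V_closed by simp
    qed
    then show "(\<Oplus>z\<in>Z. (if z = x then \<one> else \<zero>) \<otimes> f z) = (\<Oplus>z\<in>Z. (if z = y then \<one> else \<zero>) \<otimes> f z)"
      using assms f by simp
  qed (use assms in auto)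
  then show ?thesis by (simp split: if_splits)
qed

end

section \<open>Maps between two forms over the same intermediate field\<close>

locale form_pair =
  P: base_changed L \<sigma> M1 \<psi>1 m K e E + Q: base_changed L \<sigma> M2 \<psi>2 m K e E
  for L (structure) and \<sigma> and M1 :: "('g, 'z) monoid_scheme" and \<psi>1
    and M2 :: "('h, 'w) monoid_scheme" and \<psi>2 m K e E
begin

abbreviation "R1 \<equiv> L\<lparr>carrier := E\<rparr>"

definition linear_map :: "(('a \<times> ('g \<Rightarrow> 'a) \<Rightarrow> 'a) set \<Rightarrow> ('a \<times> ('h \<Rightarrow> 'a) \<Rightarrow> 'a) set) \<Rightarrow> bool" where
  "linear_map \<phi> \<longleftrightarrow> \<phi> \<in> carrier P.T.T \<rightarrow> carrier Q.T.T \<and>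
    (\<forall>t\<in>carrier P.T.T. \<forall>u\<in>carrier P.T.T. \<phi> (t \<oplus>\<^bsub>P.T.T\<^esub> u) = \<phi> t \<oplus>\<^bsub>Q.T.T\<^esub> \<phi> u) \<and>
    (\<forall>c\<in>E. \<forall>t\<in>carrier P.T.T. \<phi> (c \<odot>\<^bsub>P.B\<^esub> t) = c \<odot>\<^bsub>Q.B\<^esub> \<phi> t)"

abbreviation "phi2 \<equiv> \<lambda>\<phi>. tensor_lift R1 Q.B.BB.T (\<lambda>x y. Q.B.BB.pt (\<phi> x) (\<phi> y))"

lemma bilinear_phi2:
  "linear_map \<phi> \<Longrightarrow> bilinear_map R1 P.B P.B Q.B.BB.T (\<lambda>x y. Q.B.BB.pt (\<phi> x) (\<phi> y))"
  using Q.B.BB.bilinear_map_pure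
  by (simp add: linear_map_def bilinear_map_def P.B_sel(1-2) Q.B_sel(1-2) Pi_iff)

lemmas phi2_lift =
  P.B.BB.tensor_lift_closed[OF Q.B.BB.module_tensor bilinear_phi2]
  P.B.BB.tensor_lift_zero[OF Q.B.BB.module_tensor bilinear_phi2]
  P.B.BB.tensor_lift_add[OF Q.B.BB.module_tensor bilinear_phi2]
  P.B.BB.tensor_lift_pure[OF Q.B.BB.module_tensor bilinear_phi2, unfolded P.B_sel(1)]

text \<open>Functions are transported along the inverse of \<theta>. Equivariance survives because
  \<theta> intertwines the twists, and in coordinates each Hopf operation is expressed through the
  group structure alone.\<close>

lemma hopf_isomorphic_if_iso:
  assumes \<theta>: "\<theta> \<in> iso M1 M2"
    and tw: "\<And>x. x \<in> carrier M1 \<Longrightarrow> \<theta> ((\<psi>1 ^^ e) x) = (\<psi>2 ^^ e) (\<theta> x)"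
  shows "hopf_isomorphic R1 P.Bh Q.Bh"
proof -
  define \<zeta> where "\<zeta> = inv_into (carrier M1) \<theta>"
  have \<zeta>: "\<zeta> \<in> iso M2 M1" unfolding \<zeta>_def using P.M.iso_set_sym[OF \<theta>] .
  have \<zeta>c: "\<zeta> y \<in> carrier M1" if "y \<in> carrier M2" for y using \<zeta> that by (auto simp: iso_def hom_def)
  have \<theta>c: "\<theta> x \<in> carrier M2" if "x \<in> carrier M1" for x using \<theta> that by (auto simp: iso_def hom_def)
  have bij\<theta>: "bij_betw \<theta> (carrier M1) (carrier M2)" using \<theta> by (simp add: iso_def)
  have \<theta>\<zeta>: "\<theta> (\<zeta> y) = y" if "y \<in> carrier M2" for y
    unfolding \<zeta>_def using bij\<theta> that by (simp add: bij_betw_def f_inv_into_f)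
  have \<zeta>\<theta>: "\<zeta> (\<theta> x) = x" if "x \<in> carrier M1" for x
    unfolding \<zeta>_def using bij\<theta> that by (simp add: bij_betw_def)
  have \<zeta>bij: "inj_on \<zeta> (carrier M2)" "\<zeta> ` carrier M2 = carrier M1"
    using \<zeta> by (auto simp: iso_def bij_betw_def)
  have \<zeta>hom: "group_hom M2 M1 \<zeta>"
    using \<zeta> P.group_M Q.group_M by (simp add: iso_def group_hom_def group_hom_axioms_def)
  have \<zeta>mult: "\<zeta> (x \<otimes>\<^bsub>M2\<^esub> y) = \<zeta> x \<otimes>\<^bsub>M1\<^esub> \<zeta> y" if "x \<in> carrier M2" "y \<in> carrier M2" for x y
    using \<zeta> that by (simp add: iso_def hom_def)
  note \<zeta>inv = group_hom.hom_inv[OF \<zeta>hom] and \<zeta>one = group_hom.hom_one[OF \<zeta>hom]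
  have \<zeta>tw: "\<zeta> ((\<psi>2 ^^ e) y) = (\<psi>1 ^^ e) (\<zeta> y)" if "y \<in> carrier M2" for y
    using tw[of "\<zeta> y"] \<zeta>c \<theta>\<zeta> \<zeta>\<theta>[of "(\<psi>1 ^^ e) (\<zeta> y)"] P.psi_pow_closed that by simp
  define tr where "tr f = (\<lambda>y\<in>carrier M2. f (\<zeta> y))" for f :: "'g \<Rightarrow> 'a"
  have trV: "tr f \<in> Q.E.V" if "f \<in> P.E.V" for f
    using that \<zeta>c \<zeta>tw Q.psi_pow_closed by (auto simp: tr_def Q.E.V_def P.E.V_def)
  define \<phi> where "\<phi> t = Q.B.kappa_inv (tr (P.kap t))" for t
  have closed: "\<phi> t \<in> carrier Q.T.T" if "t \<in> carrier P.T.T" for t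
    unfolding \<phi>_def using Q.B.kappa_inv(1)[OF trV[OF P.kap_V[OF that]]] by (simp add: Q.B_sel(1))
  have kap: "Q.kap (\<phi> t) y = P.kap t (\<zeta> y)" if "t \<in> carrier P.T.T" "y \<in> carrier M2" for t y
    unfolding \<phi>_def using Q.B.kappa_inv(2)[OF trV[OF P.kap_V[OF that(1)]]] that by (simp add: tr_def)
  have kapL: "P.kap t (\<zeta> y) \<in> carrier L" if "t \<in> carrier P.T.T" "y \<in> carrier M2" for t y
    using P.kap_closed that \<zeta>c by blast
  have sum: "(\<Oplus>y\<in>carrier M2. F (\<zeta> y)) = (\<Oplus>x\<in>carrier M1. F x)"
    if "\<And>x. x \<in> carrier M1 \<Longrightarrow> F x \<in> carrier L" for F
    using P.add.finprod_reindex[of F \<zeta> "carrier M2"] \<zeta>bij that by (simp add: Pi_def)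
  have add: "\<phi> (t \<oplus>\<^bsub>P.T.T\<^esub> u) = \<phi> t \<oplus>\<^bsub>Q.T.T\<^esub> \<phi> u"
    if "t \<in> carrier P.T.T" "u \<in> carrier P.T.T" for t u
    using that closed \<zeta>c by (intro Q.kap_eqI) (simp_all add: kap Q.kap_add P.kap_add)
  have smult: "\<phi> (c \<odot>\<^bsub>P.B\<^esub> t) = c \<odot>\<^bsub>Q.B\<^esub> \<phi> t" if "c \<in> E" "t \<in> carrier P.T.T" for c t
    using that closed \<zeta>c P.B_smult_closed Q.B_smult_closed
    by (intro Q.kap_eqI) (simp_all add: kap Q.kap_smult P.kap_smult)
  have mult: "\<phi> (t \<otimes>\<^bsub>P.Bh\<^esub> u) = \<phi> t \<otimes>\<^bsub>Q.Bh\<^esub> \<phi> u"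
    if t: "t \<in> carrier P.T.T" and u: "u \<in> carrier P.T.T" for t u
  proof (rule Q.kap_eqI)
    fix y assume y: "y \<in> carrier M2"
    have "Q.kap (\<phi> t \<otimes>\<^bsub>Q.Bh\<^esub> \<phi> u) y = Q.conv (Q.kap (\<phi> t)) (Q.kap (\<phi> u)) y"
      using Q.Bh_mult(2) closed t u y by simp
    also have "\<dots> = (\<Oplus>z\<in>carrier M2. P.kap t (\<zeta> z) \<otimes> P.kap u (inv\<^bsub>M1\<^esub> (\<zeta> z) \<otimes>\<^bsub>M1\<^esub> \<zeta> y))"
      unfolding Q.conv_def using t u y \<zeta>c P.kap_closed
      by (intro P.finsum_cong'[OF refl]) (auto simp: kap \<zeta>mult \<zeta>inv)
    also have "\<dots> = P.conv (P.kap t) (P.kap u) (\<zeta> y)"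
      unfolding P.conv_def using t u y \<zeta>c P.kap_closed
      by (intro sum[of "\<lambda>z. P.kap t z \<otimes> P.kap u (inv\<^bsub>M1\<^esub> z \<otimes>\<^bsub>M1\<^esub> \<zeta> y)"]) auto
    also have "\<dots> = Q.kap (\<phi> (t \<otimes>\<^bsub>P.Bh\<^esub> u)) y"
      using P.Bh_mult t u y \<zeta>c kap by simp
    finally show "Q.kap (\<phi> (t \<otimes>\<^bsub>P.Bh\<^esub> u)) y = Q.kap (\<phi> t \<otimes>\<^bsub>Q.Bh\<^esub> \<phi> u) y" by simp
  qed (use P.Bh_mult(1) Q.Bh_mult(1) closed t u in auto)
  have one: "\<phi> \<one>\<^bsub>P.Bh\<^esub> = \<one>\<^bsub>Q.Bh\<^esub>"
  proof (rule Q.kap_eqI)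
    fix y assume y: "y \<in> carrier M2"
    have "\<zeta> y = \<one>\<^bsub>M1\<^esub> \<longleftrightarrow> y = \<one>\<^bsub>M2\<^esub>"
      using \<zeta>one \<zeta>bij(1) y Q.M.one_closed by (metis inj_onD)
    then show "Q.kap (\<phi> \<one>\<^bsub>P.Bh\<^esub>) y = Q.kap \<one>\<^bsub>Q.Bh\<^esub> y"
      using y P.Bh_one Q.Bh_one \<zeta>c by (simp add: kap)
  qed (use P.Bh_one(1) Q.Bh_one(1) closed in auto)
  have bij: "bij_betw \<phi> (carrier P.T.T) (carrier Q.T.T)"
  proof (rule bij_betw_imageI)
    show "inj_on \<phi> (carrier P.T.T)"
    proof (rule inj_onI)
      fix t u assume *: "t \<in> carrier P.T.T" "u \<in> carrier P.T.T" "\<phi> t = \<phi> u"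
      show "t = u"
        using kap[OF *(1)] kap[OF *(2)] *(3) \<theta>c \<zeta>\<theta> by (intro P.kap_eqI[OF *(1,2)]) metis
    qed
    show "\<phi> ` carrier P.T.T = carrier Q.T.T"
    proof
      show "carrier Q.T.T \<subseteq> \<phi> ` carrier P.T.T"
      proof
        fix u assume u: "u \<in> carrier Q.T.T"
        define f where "f = (\<lambda>x\<in>carrier M1. Q.kap u (\<theta> x))"
        have f: "f \<in> P.E.V"
          using Q.kap_V[OF u] \<theta>c tw P.psi_pow_closed by (auto simp: f_def Q.E.V_def P.E.V_def)
        let ?t = "P.B.kappa_inv f"
        have t: "?t \<in> carrier P.T.T" "P.kap ?t = f"
          using P.B.kappa_inv[OF f] by (simp_all add: P.B_sel(1))
        have "\<phi> ?t = u"
          using t u closed \<zeta>c \<theta>\<zeta> by (intro Q.kap_eqI) (auto simp: kap f_def)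
        then show "u \<in> \<phi> ` carrier P.T.T" using t(1) by blast
      qed
    qed (use closed in auto)
  qed
  have comult: "comult Q.Bh (\<phi> t) = phi2 \<phi> (comult P.Bh t)" if t: "t \<in> carrier P.T.T" for t
  proof (rule Q.B.kappa2_eqI)
    have "linear_map \<phi>" using closed add smult by (simp add: linear_map_def)
    note lift = phi2_lift[OF this]
    \<comment> \<open>On two-variable functions, \<phi> \<otimes> \<phi> substitutes \<zeta> in both
      arguments.\<close>
    have k: "Q.B.kappa2 (phi2 \<phi> u) x y = P.B.kappa2 u (\<zeta> x) (\<zeta> y)"
      if u: "u \<in> carrier P.B.BB.T" and x: "x \<in> carrier M2" and y: "y \<in> carrier M2" for u x y
      using u
    proof (induction rule: P.B.BB.tensor_induct)
      case zero
      then show ?case using x y \<zeta>c by (simp add: lift Q.B.kappa2_zero P.B.kappa2_zero)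
    next
      case (pure a b)
      then have ab: "a \<in> carrier P.T.T" "b \<in> carrier P.T.T" by (simp_all add: P.B_sel(1))
      then have "\<phi> a \<in> carrier Q.B" "\<phi> b \<in> carrier Q.B" using closed by (simp_all add: Q.B_sel(1))
      then show ?case
        using x y \<zeta>c ab pure by (simp add: lift Q.B.kappa2_pure P.B.kappa2_pure kap)
    next
      case (add a b)
      then show ?case
        using x y \<zeta>c lift(1) by (simp add: lift(3) Q.B.kappa2_add P.B.kappa2_add)
    qed
    note cP = P.Bh_comult[OF t] and cQ = Q.Bh_comult[OF closed[OF t]]
    show "comult Q.Bh (\<phi> t) \<in> carrier Q.B.BB.T" by (rule cQ(1))
    show "phi2 \<phi> (comult P.Bh t) \<in> carrier Q.B.BB.T" using lift(1) cP(1) .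
    fix x y assume xy: "x \<in> carrier M2" "y \<in> carrier M2"
    then have "\<zeta> x = \<zeta> y \<longleftrightarrow> x = y" using \<zeta>bij(1) by (auto simp: inj_on_def)
    then show "Q.B.kappa2 (comult Q.Bh (\<phi> t)) x y = Q.B.kappa2 (phi2 \<phi> (comult P.Bh t)) x y"
      using xy cP cQ k[OF cP(1)] \<zeta>c kap t by simp
  qed
  have counit: "counit Q.Bh (\<phi> t) = counit P.Bh t" if t: "t \<in> carrier P.T.T" for t
  proof -
    have "counit Q.Bh (\<phi> t) = (\<Oplus>y\<in>carrier M2. P.kap t (\<zeta> y))"
      using Q.Bh_counit[OF closed[OF t]] kapL kap t
      by (simp, intro P.finsum_cong'[OF refl]) auto
    then show ?thesis using sum[of "P.kap t"] P.kap_closed P.Bh_counit t by simp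
  qed
  have antipode: "antipode Q.Bh (\<phi> t) = \<phi> (antipode P.Bh t)" if t: "t \<in> carrier P.T.T" for t
    using t closed P.Bh_antipode Q.Bh_antipode \<zeta>c
    by (intro Q.kap_eqI) (simp_all add: kap \<zeta>inv)
  have "\<phi> \<in> hopf_iso R1 P.Bh Q.Bh"
    unfolding hopf_iso_def ring_iso_def
    using closed add mult one bij smult comult counit antipode
    by (simp add: P.Bh_sel(1-4) Q.Bh_sel(1-4) Q.tensor_Bh ring_hom_def)
  then show ?thesis unfolding hopf_isomorphic_def by blast
qed

text \<open>Expanding \<open>t\<close> along the v_j, with coefficients sum_x w_j(x) t(x) in
  \<open>E\<close>, and using linearity gives the matrix W(y, x) = sum_j \<phi>(v_j)(y)
  w_j(x).\<close>

lemma linear_map_matrix: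
  assumes \<phi>: "linear_map \<phi>"
  shows "\<exists>W. (\<forall>y\<in>carrier M2. \<forall>x\<in>carrier M1. W y x \<in> carrier L) \<and>
    (\<forall>t\<in>carrier P.T.T. \<forall>y\<in>carrier M2. Q.kap (\<phi> t) y = (\<Oplus>x\<in>carrier M1. W y x \<otimes> P.kap t x))"
proof -
  have closed: "\<phi> t \<in> carrier Q.T.T" if "t \<in> carrier P.T.T" for t
    using \<phi> that by (auto simp: linear_map_def)
  let ?v = "\<lambda>j. P.B.kappa_inv (P.B.fv j)"
  have v: "?v j \<in> carrier P.T.T" if "j \<in> P.B.fJ" for j
    using P.B.kappa_inv(1) P.B.frame(2) that by (simp add: P.B_sel(1))
  have w: "P.B.fw j x \<in> carrier L" if "j \<in> P.B.fJ" "x \<in> carrier M1" for j x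
    using P.B.frame(3) P.E.V_closed that by blast
  have vL: "Q.kap (\<phi> (?v j)) y \<in> carrier L" if "j \<in> P.B.fJ" "y \<in> carrier M2" for j y
    using Q.kap_closed closed v that by blast
  define W where "W y x = (\<Oplus>j\<in>P.B.fJ. Q.kap (\<phi> (?v j)) y \<otimes> P.B.fw j x)" for y x
  have "Q.kap (\<phi> t) y = (\<Oplus>x\<in>carrier M1. W y x \<otimes> P.kap t x)"
    if t: "t \<in> carrier P.T.T" and y: "y \<in> carrier M2" for t y
  proof -
    let ?c = "\<lambda>j. P.B.coef j (P.kap t)"
    have tL: "P.kap t x \<in> carrier L" if "x \<in> carrier M1" for x using P.kap_closed t that .
    have c: "?c j \<in> E" if "j \<in> P.B.fJ" for j using P.B.coef_E P.kap_V t that by blast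
    have cv: "?c j \<odot>\<^bsub>P.B\<^esub> ?v j \<in> carrier P.T.T" if "j \<in> P.B.fJ" for j
      using P.B_smult_closed c v that by blast
    have "\<phi> (\<Oplus>\<^bsub>P.T.T\<^esub>j\<in>P.B.fJ. ?c j \<odot>\<^bsub>P.B\<^esub> ?v j) = (\<Oplus>\<^bsub>Q.T.T\<^esub>j\<in>P.B.fJ. \<phi> (?c j \<odot>\<^bsub>P.B\<^esub> ?v j))"
      using \<phi> cv by (intro additive_finsum[OF P.T.T.M.abelian_group_axioms Q.T.T.M.abelian_group_axioms])
        (auto simp: linear_map_def)
    moreover have "(\<Oplus>\<^bsub>P.T.T\<^esub>j\<in>P.B.fJ. ?c j \<odot>\<^bsub>P.B\<^esub> ?v j) = t"
      using P.B.kappa_expansion[of t] t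
      by (simp add: P.B_sel(1) finsum_structure_cong[OF P.B_sel(1-3)])
    ultimately have "\<phi> t = (\<Oplus>\<^bsub>Q.T.T\<^esub>j\<in>P.B.fJ. \<phi> (?c j \<odot>\<^bsub>P.B\<^esub> ?v j))" by simp
    then have "Q.kap (\<phi> t) y = (\<Oplus>j\<in>P.B.fJ. Q.kap (\<phi> (?c j \<odot>\<^bsub>P.B\<^esub> ?v j)) y)"
      using cv closed y by (simp add: Q.kap_finsum)
    also have "\<dots> = (\<Oplus>j\<in>P.B.fJ. \<Oplus>x\<in>carrier M1. Q.kap (\<phi> (?v j)) y \<otimes> P.B.fw j x \<otimes> P.kap t x)"
    proof (intro P.finsum_cong'[OF refl])
      fix j assume j: "j \<in> P.B.fJ"
      have "Q.kap (\<phi> (?c j \<odot>\<^bsub>P.B\<^esub> ?v j)) y = ?c j \<otimes> Q.kap (\<phi> (?v j)) y"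
        using \<phi> c[OF j] v[OF j] closed y by (simp add: linear_map_def Q.kap_smult)
      also have "\<dots> = Q.kap (\<phi> (?v j)) y \<otimes> ?c j"
        using P.E_closed[OF c[OF j]] vL[OF j y] by (rule P.m_comm)
      also have "\<dots> = (\<Oplus>x\<in>carrier M1. Q.kap (\<phi> (?v j)) y \<otimes> (P.B.fw j x \<otimes> P.kap t x))"
        unfolding P.B.coef_def using w[OF j] tL vL[OF j y] by (intro P.finsum_rdistr) auto
      also have "\<dots> = (\<Oplus>x\<in>carrier M1. Q.kap (\<phi> (?v j)) y \<otimes> P.B.fw j x \<otimes> P.kap t x)"
        using w[OF j] tL vL[OF j y] by (intro P.finsum_cong'[OF refl]) (auto simp: P.m_assoc)
      finally show "Q.kap (\<phi> (?c j \<odot>\<^bsub>P.B\<^esub> ?v j)) y =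
        (\<Oplus>x\<in>carrier M1. Q.kap (\<phi> (?v j)) y \<otimes> P.B.fw j x \<otimes> P.kap t x)" .
    qed (use w tL vL y in \<open>auto intro!: P.finsum_closed\<close>)
    also have "\<dots> = (\<Oplus>x\<in>carrier M1. \<Oplus>j\<in>P.B.fJ. Q.kap (\<phi> (?v j)) y \<otimes> P.B.fw j x \<otimes> P.kap t x)"
      using w tL vL y P.B.frame(1) by (intro P.finsum_swap) auto
    also have "\<dots> = (\<Oplus>x\<in>carrier M1. W y x \<otimes> P.kap t x)"
      unfolding W_def using w tL vL y P.B.frame(1)
      by (intro P.finsum_cong'[OF refl] P.finsum_ldistr[symmetric]) (auto intro!: P.finsum_closed)
    finally show ?thesis .
  qed
  moreover have "W y x \<in> carrier L" if "y \<in> carrier M2" "x \<in> carrier M1" for y x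
    unfolding W_def using w vL that by (intro P.finsum_closed) auto
  ultimately show ?thesis by blast
qed

text \<open>The matrix of a Hopf algebra isomorphism has orthogonal idempotent rows because of the
  comultiplication, and columns of sum 1 because of the counit. Hence it is a permutation matrix.\<close>

lemma iso_if_hopf_isomorphic:
  assumes "hopf_isomorphic R1 P.Bh Q.Bh" and card: "card (carrier M1) = card (carrier M2)"
  shows "\<exists>\<theta>\<in>iso M1 M2. \<forall>x\<in>carrier M1. \<theta> ((\<psi>1 ^^ e) x) = (\<psi>2 ^^ e) (\<theta> x)"
proof -
  obtain \<phi> where \<phi>: "\<phi> \<in> hopf_iso R1 P.Bh Q.Bh"
    using assms(1) by (auto simp: hopf_isomorphic_def)
  have ring: "\<phi> \<in> ring_hom P.Bh Q.Bh" and bij: "bij_betw \<phi> (carrier P.T.T) (carrier Q.T.T)"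
    using \<phi> by (auto simp: hopf_iso_def ring_iso_def P.Bh_sel(1) Q.Bh_sel(1))
  have closed: "\<phi> t \<in> carrier Q.T.T" if "t \<in> carrier P.T.T" for t
    using bij that by (auto simp: bij_betw_def)
  have lin: "linear_map \<phi>"
    using \<phi> closed by (auto simp: linear_map_def hopf_iso_def ring_iso_def ring_hom_def
        P.Bh_sel(1-4) Q.Bh_sel(1-4))
  have mult: "\<phi> (t \<otimes>\<^bsub>P.Bh\<^esub> u) = \<phi> t \<otimes>\<^bsub>Q.Bh\<^esub> \<phi> u" if "t \<in> carrier P.T.T" "u \<in> carrier P.T.T" for t u
    using ring_hom_mult[OF ring] that by (simp add: P.Bh_sel(1))
  have comult: "comult Q.Bh (\<phi> t) = phi2 \<phi> (comult P.Bh t)" if "t \<in> carrier P.T.T" for t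
    using \<phi> that by (simp add: hopf_iso_def P.Bh_sel(1) Q.tensor_Bh)
  have counit: "counit Q.Bh (\<phi> t) = counit P.Bh t" if "t \<in> carrier P.T.T" for t
    using \<phi> that by (simp add: hopf_iso_def P.Bh_sel(1))
  let ?X = "carrier M1" and ?Y = "carrier M2"
  obtain W where W: "\<And>y x. y \<in> ?Y \<Longrightarrow> x \<in> ?X \<Longrightarrow> W y x \<in> carrier L"
    and kapW: "\<And>t y. t \<in> carrier P.T.T \<Longrightarrow> y \<in> ?Y \<Longrightarrow>
      Q.kap (\<phi> t) y = (\<Oplus>x\<in>?X. W y x \<otimes> P.kap t x)"
    using linear_map_matrix[OF lin] by blast
  have finX: "finite ?X" and finY: "finite ?Y" by simp_all
  have kL: "P.kap t x \<in> carrier L" if "t \<in> carrier P.T.T" "x \<in> ?X" for t x using P.kap_closed that .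
  have VE: "\<exists>t\<in>carrier P.T.T. P.kap t = f" if "f \<in> P.E.V" for f
    using P.B.kappa_inv[OF that] by (auto simp: P.B_sel(1))
  have eqI: "c x = d x"
    if "\<And>x. x \<in> ?X \<Longrightarrow> c x \<in> carrier L" "\<And>x. x \<in> ?X \<Longrightarrow> d x \<in> carrier L"
      "\<And>t. t \<in> carrier P.T.T \<Longrightarrow> (\<Oplus>x\<in>?X. c x \<otimes> P.kap t x) = (\<Oplus>x\<in>?X. d x \<otimes> P.kap t x)"
      "x \<in> ?X" for c d x
  proof (rule P.B.functional_eqI[of c d])
    fix f assume "f \<in> P.E.V"
    then obtain t where "t \<in> carrier P.T.T" "P.kap t = f" using VE by blast
    then show "(\<Oplus>x\<in>?X. c x \<otimes> f x) = (\<Oplus>x\<in>?X. d x \<otimes> f x)" using that(3) by blast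
  qed (use that in blast)+
  note lift = phi2_lift[OF lin]
  have k2: "Q.B.kappa2 (phi2 \<phi> u) y z =
      (\<Oplus>x\<in>?X. \<Oplus>x'\<in>?X. W y x \<otimes> W z x' \<otimes> P.B.kappa2 u x x')"
    if u: "u \<in> carrier P.B.BB.T" and y: "y \<in> ?Y" and z: "z \<in> ?Y" for u y z
    using u
  proof (induction rule: P.B.BB.tensor_induct)
    case zero
    have "(\<Oplus>x\<in>?X. \<Oplus>x'\<in>?X. W y x \<otimes> W z x' \<otimes> P.B.kappa2 \<zero>\<^bsub>P.B.BB.T\<^esub> x x') = \<zero>"
      using W y z by (intro P.add.finprod_one_eqI) (auto simp: P.B.kappa2_zero)
    then show ?case using y z by (simp add: lift Q.B.kappa2_zero)
  next
    case (pure a b)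
    then have ab: "a \<in> carrier P.T.T" "b \<in> carrier P.T.T" by (simp_all add: P.B_sel(1))
    then have "\<phi> a \<in> carrier Q.B" "\<phi> b \<in> carrier Q.B" using closed by (simp_all add: Q.B_sel(1))
    then have "Q.B.kappa2 (phi2 \<phi> (P.B.BB.pt a b)) y z = Q.kap (\<phi> a) y \<otimes> Q.kap (\<phi> b) z"
      using y z ab by (simp add: lift Q.B.kappa2_pure)
    also have "\<dots> = (\<Oplus>x\<in>?X. W y x \<otimes> P.kap a x) \<otimes> (\<Oplus>x'\<in>?X. W z x' \<otimes> P.kap b x')"
      using kapW ab y z by simp
    also have "\<dots> = (\<Oplus>x\<in>?X. W y x \<otimes> P.kap a x \<otimes> (\<Oplus>x'\<in>?X. W z x' \<otimes> P.kap b x'))"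
      using W kL ab y z by (intro P.finsum_ldistr) (auto intro!: P.finsum_closed)
    also have "\<dots> = (\<Oplus>x\<in>?X. \<Oplus>x'\<in>?X. W y x \<otimes> P.kap a x \<otimes> (W z x' \<otimes> P.kap b x'))"
      using W kL ab y z by (intro P.finsum_cong'[OF refl] P.finsum_rdistr) (auto intro!: P.finsum_closed)
    also have "\<dots> = (\<Oplus>x\<in>?X. \<Oplus>x'\<in>?X. W y x \<otimes> W z x' \<otimes> P.B.kappa2 (P.B.BB.pt a b) x x')"
      using W kL ab y z pure
      by (intro P.finsum_cong'[OF refl]) (auto intro!: P.finsum_closed simp: P.B.kappa2_pure P.m_ac)
    finally show ?case .
  next
    case (add a b)
    have cl: "P.B.kappa2 a x x' \<in> carrier L" "P.B.kappa2 b x x' \<in> carrier L" if "x \<in> ?X" "x' \<in> ?X" for x x'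
      using P.B.kappa2_closed add that by auto
    have "(\<Oplus>x\<in>?X. \<Oplus>x'\<in>?X. W y x \<otimes> W z x' \<otimes> P.B.kappa2 (a \<oplus>\<^bsub>P.B.BB.T\<^esub> b) x x') =
      (\<Oplus>x\<in>?X. \<Oplus>x'\<in>?X. W y x \<otimes> W z x' \<otimes> P.B.kappa2 a x x' \<oplus> W y x \<otimes> W z x' \<otimes> P.B.kappa2 b x x')"
      using W cl y z add
      by (intro P.finsum_cong'[OF refl]) (auto intro!: P.finsum_closed simp: P.B.kappa2_add P.r_distr)
    also have "\<dots> = (\<Oplus>x\<in>?X. (\<Oplus>x'\<in>?X. W y x \<otimes> W z x' \<otimes> P.B.kappa2 a x x') \<oplus>
        (\<Oplus>x'\<in>?X. W y x \<otimes> W z x' \<otimes> P.B.kappa2 b x x'))"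
      using W cl y z by (intro P.finsum_cong'[OF refl] P.finsum_addf) (auto intro!: P.finsum_closed)
    also have "\<dots> = (\<Oplus>x\<in>?X. \<Oplus>x'\<in>?X. W y x \<otimes> W z x' \<otimes> P.B.kappa2 a x x') \<oplus>
        (\<Oplus>x\<in>?X. \<Oplus>x'\<in>?X. W y x \<otimes> W z x' \<otimes> P.B.kappa2 b x x')"
      using W cl y z by (intro P.finsum_addf) (auto intro!: P.finsum_closed)
    finally show ?case
      using add y z lift(1) by (simp add: lift(3) Q.B.kappa2_add)
  qed
  \<comment> \<open>At (y, z) the comultiplication of \<phi>(t) gives row y if y = z and 0
    otherwise, while \<phi> \<otimes> \<phi> of the comultiplication of \<open>t\<close> gives sum_x
    W(y, x) W(z, x) t(x). Both are functionals of \<open>t\<close>, so their coefficients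
    agree.\<close>
  have orth: "(if y = z then W y x else \<zero>) = W y x \<otimes> W z x" if y: "y \<in> ?Y" and z: "z \<in> ?Y" and x: "x \<in> ?X"
    for x y z
  proof (rule eqI[of "\<lambda>x. if y = z then W y x else \<zero>" "\<lambda>x. W y x \<otimes> W z x", OF _ _ _ x])
    fix t assume t: "t \<in> carrier P.T.T"
    have "(\<Oplus>x\<in>?X. (if y = z then W y x else \<zero>) \<otimes> P.kap t x) = (if y = z then Q.kap (\<phi> t) y else \<zero>)"
      using kapW t y kL by (auto intro!: P.add.finprod_one_eqI)
    also have "\<dots> = Q.B.kappa2 (phi2 \<phi> (comult P.Bh t)) y z"
      using Q.Bh_comult(2)[OF closed[OF t] y z] comult[OF t] by simp
    also have "\<dots> = (\<Oplus>x\<in>?X. \<Oplus>x'\<in>?X. W y x \<otimes> W z x' \<otimes> P.B.kappa2 (comult P.Bh t) x x')"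
      by (rule k2[OF P.Bh_comult(1)[OF t] y z])
    also have "\<dots> = (\<Oplus>x\<in>?X. \<Oplus>x'\<in>?X. if x' = x then W y x \<otimes> W z x' \<otimes> P.kap t x else \<zero>)"
      using W kL t y z by (intro P.finsum_cong'[OF refl])
        (auto intro!: P.finsum_closed simp: P.Bh_comult(2)[OF t])
    also have "\<dots> = (\<Oplus>x\<in>?X. W y x \<otimes> W z x \<otimes> P.kap t x)"
      using W kL t y z by (intro P.finsum_cong'[OF refl] P.finsum_delta) auto
    finally show "(\<Oplus>x\<in>?X. (if y = z then W y x else \<zero>) \<otimes> P.kap t x) =
      (\<Oplus>x\<in>?X. W y x \<otimes> W z x \<otimes> P.kap t x)" .
  qed (use W y z in auto)
  have colsum: "(\<Oplus>y\<in>?Y. W y x) = \<one>" if x: "x \<in> ?X" for x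
  proof (rule eqI[of "\<lambda>x. \<Oplus>y\<in>?Y. W y x" "\<lambda>x. \<one>", OF _ _ _ x])
    fix t assume t: "t \<in> carrier P.T.T"
    have "(\<Oplus>x\<in>?X. (\<Oplus>y\<in>?Y. W y x) \<otimes> P.kap t x) = (\<Oplus>x\<in>?X. \<Oplus>y\<in>?Y. W y x \<otimes> P.kap t x)"
      using W kL t by (intro P.finsum_cong'[OF refl] P.finsum_ldistr) (auto intro!: P.finsum_closed)
    also have "\<dots> = (\<Oplus>y\<in>?Y. \<Oplus>x\<in>?X. W y x \<otimes> P.kap t x)"
      using W kL t by (intro P.finsum_swap) auto
    also have "\<dots> = (\<Oplus>y\<in>?Y. Q.kap (\<phi> t) y)"
      using kapW[OF t] Q.kap_closed[OF closed[OF t]]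
      by (intro P.finsum_cong'[OF refl]) (blast, simp)
    also have "\<dots> = counit P.Bh t" using Q.Bh_counit[OF closed[OF t]] counit[OF t] by simp
    also have "\<dots> = (\<Oplus>x\<in>?X. \<one> \<otimes> P.kap t x)"
      unfolding P.Bh_counit[OF t] using kL[OF t] by (intro P.finsum_cong'[OF refl]) auto
    finally show "(\<Oplus>x\<in>?X. (\<Oplus>y\<in>?Y. W y x) \<otimes> P.kap t x) = (\<Oplus>x\<in>?X. \<one> \<otimes> P.kap t x)" .
  qed (use W in \<open>auto intro!: P.finsum_closed\<close>)
  have "\<exists>y\<in>?Y. \<forall>z\<in>?Y. W z x = (if z = y then \<one> else \<zero>)" if x: "x \<in> ?X" for x
  proof -
    have "\<exists>y\<in>?Y. W y x \<noteq> \<zero>"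
    proof (rule ccontr)
      assume "\<not> ?thesis"
      then have "(\<Oplus>y\<in>?Y. W y x) = \<zero>" by (intro P.add.finprod_one_eqI) auto
      then show False using colsum x by simp
    qed
    then obtain y where y: "y \<in> ?Y" "W y x \<noteq> \<zero>" by blast
    \<comment> \<open>A nonzero idempotent of a field is 1, and orthogonality then annihilates the
      rest of the column.\<close>
    have "W y x \<otimes> W y x = W y x \<otimes> \<one>" using orth[OF y(1) y(1) x] W y x by simp
    then have y1: "W y x = \<one>" using P.m_lcancel[of "W y x" "W y x" \<one>] W x y by simp
    have "W z x = \<zero>" if "z \<in> ?Y" "z \<noteq> y" for z
      using orth[OF y(1) that(1) x] that y1 W x by auto
    then show ?thesis using y y1 by (intro bexI[of _ y]) auto
  qed
  then obtain \<theta> where \<theta>: "\<And>x. x \<in> ?X \<Longrightarrow> \<theta> x \<in> ?Y"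
    and W\<theta>: "\<And>x z. x \<in> ?X \<Longrightarrow> z \<in> ?Y \<Longrightarrow> W z x = (if z = \<theta> x then \<one> else \<zero>)"
    by metis
  \<comment> \<open>If \<open>y\<close> were missed, row \<open>y\<close> of the matrix would be
    zero and every function of the second form would vanish at \<open>y\<close>, although the form
    spans all functions.\<close>
  have surj: "\<theta> ` ?X = ?Y"
  proof (rule ccontr)
    assume "\<theta> ` ?X \<noteq> ?Y"
    then obtain y where y: "y \<in> ?Y" "y \<notin> \<theta> ` ?X" using \<theta> by blast
    have zero: "Q.kap u y = \<zero>" if u: "u \<in> carrier Q.T.T" for u
    proof -
      obtain t where t: "t \<in> carrier P.T.T" "u = \<phi> t" using bij u by (auto simp: bij_betw_def)
      have "(\<Oplus>x\<in>?X. W y x \<otimes> P.kap t x) = \<zero>"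
        using y W\<theta> kL t(1) by (intro P.add.finprod_one_eqI) auto
      then show ?thesis using kapW[OF t(1) y(1)] t(2) by simp
    qed
    have "(\<lambda>z. if z = y then \<one> else \<zero>) y = (\<lambda>_. \<zero>) y"
    proof (rule Q.B.functional_eqI[of "\<lambda>z. if z = y then \<one> else \<zero>" "\<lambda>_. \<zero>" y])
      fix f assume f: "f \<in> Q.E.V"
      then have "f y = \<zero>" using zero[of "Q.B.kappa_inv f"] Q.B.kappa_inv[OF f] by (simp add: Q.B_sel(1))
      moreover have "f z \<in> carrier L" if "z \<in> ?Y" for z using Q.E.V_closed f that .
      ultimately have "(\<Oplus>z\<in>?Y. (if z = y then \<one> else \<zero>) \<otimes> f z) = \<zero>" "(\<Oplus>z\<in>?Y. \<zero> \<otimes> f z) = \<zero>"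
        by (auto intro!: P.add.finprod_one_eqI)
      then show "(\<Oplus>z\<in>?Y. (if z = y then \<one> else \<zero>) \<otimes> f z) = (\<Oplus>z\<in>?Y. \<zero> \<otimes> f z)" by simp
    qed (use y in auto)
    then show False by simp
  qed
  have inj: "inj_on \<theta> ?X" using surj card finX by (simp add: eq_card_imp_inj_on)
  have kap\<theta>: "Q.kap (\<phi> t) (\<theta> x) = P.kap t x" if t: "t \<in> carrier P.T.T" and x: "x \<in> ?X" for t x
  proof -
    have "Q.kap (\<phi> t) (\<theta> x) = (\<Oplus>x'\<in>?X. if x' = x then P.kap t x' else \<zero>)"
      unfolding kapW[OF t \<theta>[OF x]] using W\<theta> \<theta> inj kL t x
      by (intro P.finsum_cong'[OF refl]) (auto simp: inj_on_def)
    also have "\<dots> = P.kap t x" using kL t x by (intro P.finsum_delta) auto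
    finally show ?thesis .
  qed
  \<comment> \<open>Equations in \<open>M2\<close> can be tested on the functions \<phi>(t), which
    exhaust the second form as \<phi> is surjective.\<close>
  have sep: "y = z" if "y \<in> ?Y" "z \<in> ?Y" "\<And>t. t \<in> carrier P.T.T \<Longrightarrow> Q.kap (\<phi> t) y = Q.kap (\<phi> t) z" for y z
  proof (rule Q.B.V_separates[OF that(1,2)])
    fix f assume "f \<in> Q.E.V"
    then obtain u where u: "u \<in> carrier Q.T.T" "Q.kap u = f"
      using Q.B.kappa_inv by (metis Q.B_sel(1))
    then obtain t where "t \<in> carrier P.T.T" "u = \<phi> t" using bij by (auto simp: bij_betw_def)
    then show "f y = f z" using that(3) u by blast
  qed
  have tw: "\<theta> ((\<psi>1 ^^ e) x) = (\<psi>2 ^^ e) (\<theta> x)" if x: "x \<in> ?X" for x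
  proof (rule sep)
    fix t assume t: "t \<in> carrier P.T.T"
    have px: "(\<psi>1 ^^ e) x \<in> ?X" using P.psi_pow_closed x .
    have "Q.kap (\<phi> t) ((\<psi>2 ^^ e) (\<theta> x)) = (\<sigma> ^^ e) (Q.kap (\<phi> t) (\<theta> x))"
      using Q.kap_V[OF closed[OF t]] \<theta> x by (simp add: Q.E.V_def)
    moreover have "P.kap t ((\<psi>1 ^^ e) x) = (\<sigma> ^^ e) (P.kap t x)"
      using P.kap_V[OF t] x by (simp add: P.E.V_def)
    ultimately show "Q.kap (\<phi> t) (\<theta> ((\<psi>1 ^^ e) x)) = Q.kap (\<phi> t) ((\<psi>2 ^^ e) (\<theta> x))"
      using kap\<theta> t x px by simp
  qed (use \<theta> x P.psi_pow_closed Q.psi_pow_closed in auto)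
  have hom: "\<theta> (x \<otimes>\<^bsub>M1\<^esub> x') = \<theta> x \<otimes>\<^bsub>M2\<^esub> \<theta> x'" if x: "x \<in> ?X" and x': "x' \<in> ?X" for x x'
  proof -
    \<comment> \<open>For fixed \<open>r\<close>, both sides of \<phi>(t u) = \<phi>(t) \<phi>(u) at
      \<theta>(r) are functionals of \<open>t\<close>. Their coefficients at \<open>x\<close> show
      that \<theta>(x^-1 r) = \<theta>(x)^-1 \<theta>(r), which for r = x x' is
      multiplicativity.\<close>
    define r where "r = x \<otimes>\<^bsub>M1\<^esub> x'"
    have r: "r \<in> ?X" using x x' by (simp add: r_def)
    have cancel: "inv\<^bsub>M1\<^esub> x \<otimes>\<^bsub>M1\<^esub> r = x'"
      using x x' by (simp add: r_def P.M.m_assoc[symmetric])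
    have "\<theta> (inv\<^bsub>M1\<^esub> x \<otimes>\<^bsub>M1\<^esub> r) = inv\<^bsub>M2\<^esub> (\<theta> x) \<otimes>\<^bsub>M2\<^esub> \<theta> r"
    proof (rule sep)
      fix u assume u: "u \<in> carrier P.T.T"
      let ?c = "\<lambda>x. P.kap u (inv\<^bsub>M1\<^esub> x \<otimes>\<^bsub>M1\<^esub> r)"
        and ?d = "\<lambda>x. Q.kap (\<phi> u) (inv\<^bsub>M2\<^esub> (\<theta> x) \<otimes>\<^bsub>M2\<^esub> \<theta> r)"
      have cL: "?c x \<in> carrier L" if "x \<in> ?X" for x using kL[OF u] r that by simp
      have dL: "?d x \<in> carrier L" if "x \<in> ?X" for x
        using Q.kap_closed[OF closed[OF u]] \<theta> r that by simp
      have "?c x = ?d x"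
      proof (rule eqI[OF cL dL _ x])
        fix t assume t: "t \<in> carrier P.T.T"
        have "(\<Oplus>x\<in>?X. ?c x \<otimes> P.kap t x) = P.conv (P.kap t) (P.kap u) r"
          unfolding P.conv_def using cL kL[OF t]
          by (intro P.finsum_cong'[OF refl]) (auto simp: P.m_comm)
        also have "\<dots> = Q.kap (\<phi> (t \<otimes>\<^bsub>P.Bh\<^esub> u)) (\<theta> r)"
          using kap\<theta>[OF P.Bh_mult(1)[OF t u] r] P.Bh_mult(2)[OF t u r] by simp
        also have "\<dots> = Q.conv (Q.kap (\<phi> t)) (Q.kap (\<phi> u)) (\<theta> r)"
          using mult[OF t u] Q.Bh_mult(2)[OF closed[OF t] closed[OF u] \<theta>[OF r]] by simp
        also have "\<dots> = (\<Oplus>y\<in>\<theta> ` ?X. Q.kap (\<phi> t) y \<otimes> Q.kap (\<phi> u) (inv\<^bsub>M2\<^esub> y \<otimes>\<^bsub>M2\<^esub> \<theta> r))"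
          by (simp add: surj Q.conv_def)
        also have "\<dots> = (\<Oplus>x\<in>?X. Q.kap (\<phi> t) (\<theta> x) \<otimes> ?d x)"
          using inj \<theta> r Q.kap_closed closed t u by (intro P.add.finprod_reindex) auto
        also have "\<dots> = (\<Oplus>x\<in>?X. ?d x \<otimes> P.kap t x)"
          using dL kL[OF t] kap\<theta>[OF t] by (intro P.finsum_cong'[OF refl]) (auto simp: P.m_comm)
        finally show "(\<Oplus>x\<in>?X. ?c x \<otimes> P.kap t x) = (\<Oplus>x\<in>?X. ?d x \<otimes> P.kap t x)" .
      qed
      then show "Q.kap (\<phi> u) (\<theta> (inv\<^bsub>M1\<^esub> x \<otimes>\<^bsub>M1\<^esub> r)) =
          Q.kap (\<phi> u) (inv\<^bsub>M2\<^esub> (\<theta> x) \<otimes>\<^bsub>M2\<^esub> \<theta> r)"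
        using kap\<theta>[OF u, of "inv\<^bsub>M1\<^esub> x \<otimes>\<^bsub>M1\<^esub> r"] x r by simp
    qed (use \<theta> x r in auto)
    then have "\<theta> x \<otimes>\<^bsub>M2\<^esub> \<theta> x' = \<theta> x \<otimes>\<^bsub>M2\<^esub> (inv\<^bsub>M2\<^esub> (\<theta> x) \<otimes>\<^bsub>M2\<^esub> \<theta> r)"
      using cancel by simp
    also have "\<dots> = \<theta> r" using \<theta> x r by (simp add: Q.M.m_assoc[symmetric])
    finally show ?thesis by (simp add: r_def)
  qed
  have "\<theta> \<in> iso M1 M2"
    using \<theta> hom inj surj by (auto simp: iso_def hom_def bij_betw_def)
  then show ?thesis using tw by blast
qed

end

section \<open>Geometric sums modulo prime powers\<close>

text \<open>The exponents below p k are sorted into k blocks of length p.\<close>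

lemma geometric_sum_mult:
  fixes a :: nat
  shows "(\<Sum>j<p * k. a ^ j) = (\<Sum>j<p. a ^ j) * (\<Sum>j<k. (a ^ p) ^ j)"
proof -
  have "(\<Sum>j<p * k. a ^ j) = (\<Sum>j<k. \<Sum>i\<in>{j * p..<j * p + p}. a ^ i)"
    by (simp add: sum.nat_group mult.commute)
  also have "\<dots> = (\<Sum>j<k. \<Sum>i<p. a ^ (j * p + i))"
  proof (rule sum.cong[OF refl])
    fix j
    show "(\<Sum>i\<in>{j * p..<j * p + p}. a ^ i) = (\<Sum>i<p. a ^ (j * p + i))"
      using sum.shift_bounds_nat_ivl[of "\<lambda>i. a ^ i" 0 "j * p" p]
      by (simp add: add.commute lessThan_atLeast0)
  qed
  also have "\<dots> = (\<Sum>j<p. a ^ j) * (\<Sum>j<k. (a ^ p) ^ j)"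
    by (simp add: power_add power_mult mult.commute sum_distrib_left sum_distrib_right
        sum.swap[of _ "{..<p}"] flip: power_mult)
  finally show ?thesis .
qed

text \<open>Induction on \<open>n\<close>. Modulo p the sum is k, which settles the case where p
  does not divide k. If k = p l, the sum has the factor 1 + a + ... + a^(p-1), which is p times a
  number prime to p, and the cofactor is the sum of length l for a^p.\<close>

lemma prime_power_dvd_geometric_sum:
  fixes a p :: nat
  assumes p: "Factorial_Ring.prime p" "odd p" and a: "[a = 1] (mod p)"
  shows "p ^ n dvd (\<Sum>j<k. a ^ j) \<longleftrightarrow> p ^ n dvd k"
  using a
proof (induction n arbitrary: a k)
  case 0
  then show ?case by simp
next
  case (Suc n)
  have p2: "p > 1" using p(1) prime_gt_1_nat by blast
  have "[(\<Sum>j<k. a ^ j) = (\<Sum>j<k. 1)] (mod p)"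
    using Suc.prems by (intro cong_sum) (metis cong_pow power_one)
  then have mod_p: "p dvd (\<Sum>j<k. a ^ j) \<longleftrightarrow> p dvd k"
    using cong_dvd_iff by fastforce
  show ?case
  proof (cases "p dvd k")
    case False
    then show ?thesis using mod_p by (metis dvd_trans dvd_triv_left power_Suc)
  next
    case True
    then obtain l where l: "k = p * l" by auto
    have "a \<ge> 1" using Suc.prems p2 by (cases "a = 0") (auto simp: cong_def)
    then obtain t where t: "a = 1 + p * t"
      using Suc.prems by (metis cong_to_1_nat dvdE le_add_diff_inverse)
    \<comment> \<open>The binomial expansion of (1 + p t)^j to first order.\<close>
    have pw: "[a ^ j = 1 + j * p * t] (mod p\<^sup>2)" for j
    proof (induction j)
      case (Suc j)
      have "[a ^ Suc j = (1 + p * t) * (1 + j * p * t)] (mod p\<^sup>2)"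
        using cong_scalar_left[OF Suc, of a] by (simp only: power_Suc t)
      also have "(1 + p * t) * (1 + j * p * t) = 1 + Suc j * p * t + p\<^sup>2 * (j * t * t)"
        by (simp add: algebra_simps power2_eq_square)
      also have "[\<dots> = 1 + Suc j * p * t] (mod p\<^sup>2)" by (simp add: cong_def)
      finally show ?case .
    qed simp
    \<comment> \<open>Oddness is used here: the sum of the numbers below p is p h, so the
      first-order terms contribute a multiple of p^2 and only p remains.\<close>
    obtain h where h: "p = Suc (2 * h)" using p(2) by (metis oddE Suc_eq_plus1)
    have "[(\<Sum>j<p. a ^ j) = (\<Sum>j<p. 1 + j * p * t)] (mod p\<^sup>2)"
      by (intro cong_sum pw)
    also have "(\<Sum>j<p. 1 + j * p * t) = p + (\<Sum>j<p. j) * (p * t)"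
      by (simp only: sum.distrib) (simp add: sum_distrib_right mult.assoc)
    also have "(\<Sum>j<p. j) = p * h"
      using Sum_Ico_nat[of 0 p] by (simp add: h lessThan_atLeast0)
    also have "p + p * h * (p * t) = p + p\<^sup>2 * (h * t)" by (simp add: power2_eq_square algebra_simps)
    also have "[\<dots> = p] (mod p\<^sup>2)" by (simp add: cong_def)
    finally have Sp: "[(\<Sum>j<p. a ^ j) = p] (mod p\<^sup>2)" .
    then have "p dvd (\<Sum>j<p. a ^ j)"
      by (metis cong_dvd_iff cong_dvd_modulus_nat dvd_refl dvd_triv_left power2_eq_square)
    then obtain u where u: "(\<Sum>j<p. a ^ j) = p * u" by auto
    have "\<not> p dvd u"
    proof
      assume "p dvd u"
      then have "p\<^sup>2 dvd p * u" by (simp add: power2_eq_square)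
      then have "p\<^sup>2 dvd p" using Sp u cong_dvd_iff by metis
      then show False using p2 by (simp add: power2_eq_square)
    qed
    then have cop: "coprime (p ^ n) u" using p(1) prime_imp_coprime coprime_power_left_iff by blast
    have "p ^ Suc n dvd (\<Sum>j<k. a ^ j) \<longleftrightarrow> p ^ Suc n dvd p * (u * (\<Sum>j<l. (a ^ p) ^ j))"
      by (simp add: l geometric_sum_mult u mult.assoc)
    also have "\<dots> \<longleftrightarrow> p ^ n dvd u * (\<Sum>j<l. (a ^ p) ^ j)" using p2 by simp
    also have "\<dots> \<longleftrightarrow> p ^ n dvd (\<Sum>j<l. (a ^ p) ^ j)"
      using cop by (simp add: coprime_dvd_mult_right_iff)
    also have "\<dots> \<longleftrightarrow> p ^ n dvd l"
      using Suc.IH[of "a ^ p" l] Suc.prems by (metis cong_pow power_one)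
    also have "\<dots> \<longleftrightarrow> p ^ Suc n dvd k" using p2 by (simp add: l)
    finally show ?thesis .
  qed
qed

section \<open>Cyclic groups and their automorphisms\<close>

lemma BijGroup_sel:
  "carrier (BijGroup S) = Bij S" "\<one>\<^bsub>BijGroup S\<^esub> = (\<lambda>x\<in>S. x)"
  "f \<in> Bij S \<Longrightarrow> g \<in> Bij S \<Longrightarrow> f \<otimes>\<^bsub>BijGroup S\<^esub> g = compose S f g"
  by (simp_all add: BijGroup_def)

lemma BijGroup_pow:
  assumes f: "f \<in> Bij S" and x: "x \<in> S"
  shows "(f [^]\<^bsub>BijGroup S\<^esub> (k::nat)) x = (f ^^ k) x"
  using x
proof (induction k arbitrary: x)
  case 0
  then show ?case by (simp add: BijGroup_sel)
next
  case (Suc k)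
  interpret group "BijGroup S" by (rule group_BijGroup)
  have "f [^]\<^bsub>BijGroup S\<^esub> k \<in> Bij S" using f nat_pow_closed[of f k] by (simp add: BijGroup_sel)
  then show ?case
    using Suc f Bij_imp_funcset[OF f]
    by (simp add: BijGroup_sel compose_eq funpow_swap1 Pi_iff)
qed

lemma Bij_ext: "f \<in> Bij S \<Longrightarrow> g \<in> Bij S \<Longrightarrow> (\<And>x. x \<in> S \<Longrightarrow> f x = g x) \<Longrightarrow> f = g"
  using Bij_imp_extensional extensionalityI by metis

section \<open>Exponents, automorphisms and homomorphisms of a finite cyclic group\<close>

locale cyclic_generator = group N for N (structure) +
  fixes \<eta> and q :: nat
  assumes eta: "\<eta> \<in> carrier N" and gen: "generate N {\<eta>} = carrier N"
    and card_N: "order N = q" and q_pos: "0 < q"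
begin

lemma finite_N: "finite (carrier N)"
  using card_N q_pos by (metis card.infinite order_def less_irrefl)

lemma ord_eta: "ord \<eta> = q"
  using generate_pow_card[OF eta] gen card_N by (simp add: order_def)

lemma pow_eq_iff: "\<eta> [^] (j::nat) = \<eta> [^] (k::nat) \<longleftrightarrow> [j = k] (mod q)"
proof -
  have *: "\<eta> [^] j = \<eta> [^] k \<longleftrightarrow> [j = k] (mod q)" if "j \<le> k" for j k :: nat
  proof -
    have "\<eta> [^] k = \<eta> [^] j \<otimes> \<eta> [^] (k - j)" using that eta by (simp add: nat_pow_mult)
    then have "\<eta> [^] j = \<eta> [^] k \<longleftrightarrow> \<eta> [^] (k - j) = \<one>" using eta by (simp add: r_cancel_one')
    also have "\<dots> \<longleftrightarrow> q dvd k - j" using pow_eq_id[OF eta] ord_eta by simp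
    also have "\<dots> \<longleftrightarrow> [j = k] (mod q)" using that by (metis cong_altdef_nat cong_sym_eq)
    finally show ?thesis .
  qed
  show ?thesis using *[of j k] *[of k j] by (metis cong_sym_eq nat_le_linear)
qed

lemma elemE:
  assumes "x \<in> carrier N"
  obtains k :: nat where "x = \<eta> [^] k" "k < q"
proof -
  have "x \<in> generate N {\<eta>}" using gen assms by simp
  then obtain k :: nat where "x = \<eta> [^] k"
    using generate_pow_on_finite_carrier[OF finite_N eta] by auto
  then have "x = \<eta> [^] (k mod q)" using pow_eq_iff[of k "k mod q"] by (simp add: cong_def)
  then show ?thesis using that q_pos by simp
qed

lemma hom_pow_eta:
  assumes "f \<in> hom N N" "f \<eta> = \<eta> [^] (u::nat)" "x \<in> carrier N"
  shows "f x = x [^] u"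
proof -
  obtain k :: nat where k: "x = \<eta> [^] k" using elemE assms(3) by metis
  have "group_hom N N f" using assms(1) by (simp add: group_hom_def group_hom_axioms_def is_group)
  then have "f x = (f \<eta>) [^] k" using k eta by (simp add: group_hom.hom_nat_pow)
  then show ?thesis using assms(2) k eta by (simp add: nat_pow_pow mult.commute)
qed

lemma comm: "x \<in> carrier N \<Longrightarrow> y \<in> carrier N \<Longrightarrow> x \<otimes> y = y \<otimes> x"
  by (elim elemE) (simp add: eta nat_pow_mult add.commute)

sublocale comm_group N
  by (rule group_comm_groupI) (rule comm)

lemma auto_pow:
  assumes u: "coprime u q"
  shows "(\<lambda>x\<in>carrier N. x [^] u) \<in> auto N"
proof -
  let ?f = "\<lambda>x\<in>carrier N. x [^] u"
  have hom: "?f \<in> hom N N"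
    by (auto simp: hom_def pow_mult_distrib comm)
  have "inj_on ?f (carrier N)"
  proof (rule inj_onI)
    fix x y assume *: "x \<in> carrier N" "y \<in> carrier N" "?f x = ?f y"
    obtain j k :: nat where jk: "x = \<eta> [^] j" "y = \<eta> [^] k" using elemE * by metis
    then have "[j * u = k * u] (mod q)"
      using * eta by (simp add: nat_pow_pow pow_eq_iff)
    then have "[j = k] (mod q)" using u by (simp add: cong_mult_rcancel_nat)
    then show "x = y" using jk pow_eq_iff by simp
  qed
  moreover from this have "?f ` carrier N = carrier N"
    using finite_N by (intro endo_inj_surj) auto
  ultimately have "bij_betw ?f (carrier N) (carrier N)"
    unfolding bij_betw_def by blast
  then show ?thesis using hom by (simp add: auto_def Bij_def)
qed

lemma autoE:
  assumes f: "f \<in> auto N"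
  obtains u where "u \<in> totatives q" "f = (\<lambda>x\<in>carrier N. x [^] u)"
proof -
  have fh: "f \<in> hom N N" and fb: "f \<in> Bij (carrier N)" using f by (auto simp: auto_def)
  have "f \<eta> \<in> carrier N" using fh eta by (auto simp: hom_def)
  then obtain k :: nat where k: "f \<eta> = \<eta> [^] k" "k < q" using elemE by metis
  \<comment> \<open>\<open>totatives q\<close> lies in the range 1 to q, so the exponent 0 is
    replaced by q; this case occurs for q = 1.\<close>
  define u where "u = (if k = 0 then q else k)"
  have u: "0 < u" "u \<le> q" "f \<eta> = \<eta> [^] u"
    using k q_pos pow_eq_iff[of k u] by (auto simp: u_def cong_def)
  have fu: "f x = x [^] u" if "x \<in> carrier N" for x using hom_pow_eta[OF fh u(3) that] .
  obtain y where y: "y \<in> carrier N" "f y = \<eta>"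
    using fb eta by (auto simp: Bij_def bij_betw_def image_iff) (metis image_iff)
  obtain j :: nat where j: "y = \<eta> [^] j" using elemE y by metis
  \<comment> \<open>The preimage of the generator has an exponent inverse to \<open>u\<close> modulo
    \<open>q\<close>.\<close>
  have "\<eta> [^] (j * u) = \<eta> [^] (1::nat)" using fu[OF y(1)] y j eta by (simp add: nat_pow_pow)
  then have "[j * u = 1] (mod q)" using pow_eq_iff by blast
  then have "coprime u q"
    unfolding coprime_iff_invertible_nat by (intro exI[of _ j]) (simp add: mult.commute)
  then have "u \<in> totatives q" using u by (simp add: in_totatives_iff)
  moreover have "f = (\<lambda>x\<in>carrier N. x [^] u)"
    using fu Bij_imp_extensional[OF fb] by (auto intro!: extensionalityI[of _ "carrier N"])
  ultimately show ?thesis using that by blast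
qed

lemma card_auto: "card (auto N) = totient q"
proof -
  let ?F = "\<lambda>u::nat. \<lambda>x\<in>carrier N. x [^] u"
  have "inj_on ?F (totatives q)"
  proof (rule inj_onI)
    fix u v assume *: "u \<in> totatives q" "v \<in> totatives q" "?F u = ?F v"
    then have "\<eta> [^] u = \<eta> [^] v" using eta by (metis restrict_apply')
    then have c: "[u = v] (mod q)" using pow_eq_iff by blast
    have uv: "0 < u" "u \<le> q" "0 < v" "v \<le> q" using * by (auto simp: in_totatives_iff)
    show "u = v"
    proof (cases "u = q \<or> v = q")
      case True
      then have "q dvd u" "q dvd v" using cong_dvd_iff[OF c] by auto
      then show ?thesis using uv by (metis dvd_imp_le le_antisym)
    next
      case False
      then show ?thesis using c uv cong_less_modulus_unique_nat by (metis le_neq_implies_less)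
    qed
  qed
  moreover have "?F ` totatives q = auto N"
    using auto_pow autoE by (auto simp: in_totatives_iff) (metis image_eqI in_totatives_iff)
  ultimately show ?thesis using card_image by (metis totient_def)
qed

lemma AutoGroup_pow:
  assumes "f \<in> auto N" "x \<in> carrier N"
  shows "(f [^]\<^bsub>AutoGroup N\<^esub> (k::nat)) x = (f ^^ k) x"
proof -
  interpret P: group "BijGroup (carrier N)" by (rule group_BijGroup)
  show ?thesis
    using BijGroup_pow[of f "carrier N" x k] assms P.nat_pow_consistent[of f k "auto N"]
    by (simp add: AutoGroup_def auto_def)
qed

lemma automorphism_generator_power:
  assumes p: "Factorial_Ring.prime p" and n: "n \<ge> 1" and q: "q = p ^ n"
    and \<gamma>: "\<gamma> \<in> carrier (AutoGroup N)"
    and gen\<gamma>: "generate (AutoGroup N) {\<gamma>} = carrier (AutoGroup N)"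
    and \<delta>: "\<delta> = \<gamma> [^]\<^bsub>AutoGroup N\<^esub> (p - 1)"
  shows "\<delta> \<in> auto N"
    and "\<exists>d. [d = 1] (mod p) \<and> (\<forall>x\<in>carrier N. \<delta> x = x [^] d)"
    and "(\<forall>x\<in>carrier N. (\<delta> ^^ j) x = (\<delta> ^^ k) x) \<longleftrightarrow> [j = k] (mod p ^ (n - 1))"
proof -
  have A: "carrier (AutoGroup N) = auto N" by (simp add: AutoGroup_def)
  have tot: "totient q = p ^ (n - 1) * (p - 1)" using totient_prime_power p n q by simp
  have p1: "p > 1" using p prime_gt_1_nat by blast
  \<comment> \<open>The automorphism group is itself a cyclic group with a known generator, so the
    rule for equal powers applies to \<gamma> as well.\<close>
  interpret A: cyclic_generator "AutoGroup N" \<gamma> "totient q"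
    by (rule cyclic_generator.intro[OF AutoGroup], rule cyclic_generator_axioms.intro)
      (use \<gamma> gen\<gamma> A card_auto q_pos in \<open>auto simp: order_def\<close>)
  show \<delta>a: "\<delta> \<in> auto N" using \<delta> A.nat_pow_closed \<gamma> A by simp
  obtain u where u: "u \<in> totatives q" "\<gamma> = (\<lambda>x\<in>carrier N. x [^] u)" using autoE \<gamma> A by blast
  have pw: "(\<gamma> ^^ k) x = x [^] (u ^ k)" if "x \<in> carrier N" for x k
    using that by (induction k) (auto simp: u nat_pow_pow mult.commute)
  have "\<not> p dvd u"
    using u(1) n q p1 by (auto simp: in_totatives_iff coprime_power_right_iff
        dest!: coprime_common_divisor_nat[of u p p])
  then have "[u ^ (p - 1) = 1] (mod p)" using fermat_theorem p by blast
  moreover have "\<delta> x = x [^] (u ^ (p - 1))" if "x \<in> carrier N" for x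
    unfolding \<delta> using AutoGroup_pow[of \<gamma> x "p - 1"] \<gamma> A pw that by simp
  ultimately show "\<exists>d. [d = 1] (mod p) \<and> (\<forall>x\<in>carrier N. \<delta> x = x [^] d)" by blast
  have "(\<forall>x\<in>carrier N. (\<delta> ^^ j) x = (\<delta> ^^ k) x) \<longleftrightarrow>
      \<delta> [^]\<^bsub>AutoGroup N\<^esub> j = \<delta> [^]\<^bsub>AutoGroup N\<^esub> k"
  proof
    assume *: "\<forall>x\<in>carrier N. (\<delta> ^^ j) x = (\<delta> ^^ k) x"
    have B: "\<delta> [^]\<^bsub>AutoGroup N\<^esub> i \<in> Bij (carrier N)" for i :: nat
      using A.nat_pow_closed[of \<delta> i] \<delta>a A by (simp add: auto_def)
    show "\<delta> [^]\<^bsub>AutoGroup N\<^esub> j = \<delta> [^]\<^bsub>AutoGroup N\<^esub> k"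
      using * AutoGroup_pow[OF \<delta>a] by (intro Bij_ext[OF B B]) simp
  next
    assume *: "\<delta> [^]\<^bsub>AutoGroup N\<^esub> j = \<delta> [^]\<^bsub>AutoGroup N\<^esub> k"
    show "\<forall>x\<in>carrier N. (\<delta> ^^ j) x = (\<delta> ^^ k) x"
      using AutoGroup_pow[OF \<delta>a, of _ j] AutoGroup_pow[OF \<delta>a, of _ k] * by simp
  qed
  also have "\<dots> \<longleftrightarrow> [(p - 1) * j = (p - 1) * k] (mod (p - 1) * p ^ (n - 1))"
    unfolding \<delta> using \<gamma> A.pow_eq_iff tot by (simp add: A.nat_pow_pow mult.commute)
  also have "\<dots> \<longleftrightarrow> [j = k] (mod p ^ (n - 1))"
    using p1 by (simp add: cong_def mod_mult_mult1)
  finally show "(\<forall>x\<in>carrier N. (\<delta> ^^ j) x = (\<delta> ^^ k) x) \<longleftrightarrow> [j = k] (mod p ^ (n - 1))" .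
qed

text \<open>This gives the definite description in \<open>beta_hom\<close> a value: a homomorphism
  on a cyclic group is the choice of an image of the generator killed by the order.\<close>

lemma hom_generator_unique:
  assumes P: "group P" and c: "c \<in> carrier P" "c [^]\<^bsub>P\<^esub> q = \<one>\<^bsub>P\<^esub>"
  shows "\<exists>!\<beta>. \<beta> \<in> hom N P \<and> \<beta> \<in> extensional (carrier N) \<and> \<beta> \<eta> = c"
proof (rule ex1I)
  interpret P: group P by (rule P)
  have c_cong: "c [^]\<^bsub>P\<^esub> j = c [^]\<^bsub>P\<^esub> k" if "[j = k] (mod q)" for j k :: nat
  proof -
    have "c [^]\<^bsub>P\<^esub> i = c [^]\<^bsub>P\<^esub> (i mod q)" for i :: nat
    proof -
      have "c [^]\<^bsub>P\<^esub> (q * (i div q) + i mod q) = (c [^]\<^bsub>P\<^esub> q) [^]\<^bsub>P\<^esub> (i div q) \<otimes>\<^bsub>P\<^esub> c [^]\<^bsub>P\<^esub> (i mod q)"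
        using c(1) by (simp only: P.nat_pow_mult[symmetric] P.nat_pow_pow)
      then show ?thesis using c by simp
    qed
    then show ?thesis using that by (metis cong_def)
  qed
  \<comment> \<open>Any exponent of \<open>x\<close> will do: two of them are congruent modulo
    \<open>q\<close>, and the \<open>q\<close>-th power of \<open>c\<close> is trivial.\<close>
  define \<beta> where "\<beta> = (\<lambda>x\<in>carrier N. c [^]\<^bsub>P\<^esub> (SOME k::nat. x = \<eta> [^] k))"
  have \<beta>: "\<beta> (\<eta> [^] k) = c [^]\<^bsub>P\<^esub> k" for k :: nat
  proof -
    have "\<eta> [^] k = \<eta> [^] (SOME j::nat. \<eta> [^] k = \<eta> [^] j)" by (rule someI) (rule refl)
    then show ?thesis using c_cong eta unfolding \<beta>_def by (simp add: pow_eq_iff cong_sym)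
  qed
  have "\<beta> \<in> hom N P"
  proof (rule homI)
    fix x assume x: "x \<in> carrier N"
    then show "\<beta> x \<in> carrier P" using c by (simp add: \<beta>_def)
    fix y assume "y \<in> carrier N"
    with x obtain j k :: nat where "x = \<eta> [^] j" "y = \<eta> [^] k" using elemE by metis
    then show "\<beta> (x \<otimes> y) = \<beta> x \<otimes>\<^bsub>P\<^esub> \<beta> y"
      using eta c by (simp add: nat_pow_mult \<beta> P.nat_pow_mult)
  qed
  moreover have "\<beta> \<eta> = c" using \<beta>[of 1] eta c by simp
  ultimately show "\<beta> \<in> hom N P \<and> \<beta> \<in> extensional (carrier N) \<and> \<beta> \<eta> = c"
    by (simp add: \<beta>_def)
  fix \<beta>' assume *: "\<beta>' \<in> hom N P \<and> \<beta>' \<in> extensional (carrier N) \<and> \<beta>' \<eta> = c"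
  then interpret h: group_hom N P \<beta>' by unfold_locales auto
  show "\<beta>' = \<beta>"
  proof (rule extensionalityI[of _ "carrier N"])
    fix x assume "x \<in> carrier N"
    then obtain k :: nat where k: "x = \<eta> [^] k" using elemE by metis
    then show "\<beta>' x = \<beta> x" using * \<beta> eta by (simp add: h.hom_nat_pow)
  qed (use * in \<open>auto simp: \<beta>_def\<close>)
qed

end

section \<open>The regular subgroups\<close>

lemma pow_multiple_order:
  fixes N (structure)
  assumes "cyclic_generator N \<eta> q" "q dvd k" "x \<in> carrier N"
  shows "x [^] k = \<one>"
proof -
  interpret cyclic_generator N \<eta> q by fact
  obtain j where j: "x = \<eta> [^] (j::nat)" using elemE assms(3) by metis
  have "\<eta> [^] (j * k) = \<eta> [^] (0::nat)"
    unfolding pow_eq_iff using assms(2) by (simp add: cong_0_iff)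
  then show ?thesis using j eta by (simp add: nat_pow_pow)
qed

text \<open>The number \<open>a\<close> is the exponent by which \<delta>^s acts on
  \<open>N\<close>. All facts about \<beta>_s, b_s and \<alpha>_s are derived from its being 1
  modulo \<open>p\<close>.\<close>

locale regular_twist =
  G: cyclic_generator G \<sigma> q + N: cyclic_generator N \<eta> q
  for G :: "('g, 'y) monoid_scheme" and \<sigma> and N :: "('n, 'z) monoid_scheme" and \<eta> q +
  fixes p n a :: nat and \<delta> :: "'n \<Rightarrow> 'n" and s :: nat
  assumes p: "Factorial_Ring.prime p" "odd p" and q: "q = p ^ n"
    and delta: "\<delta> \<in> auto N" and delta_pow: "x \<in> carrier N \<Longrightarrow> (\<delta> ^^ s) x = x [^]\<^bsub>N\<^esub> a"
    and a: "[a = 1] (mod p)"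
begin

abbreviation "P \<equiv> BijGroup (carrier N)"
abbreviation "PG \<equiv> BijGroup (carrier G)"

definition "D = \<delta> [^]\<^bsub>P\<^esub> s"
text \<open>The image of \<sigma> under \<beta>_s, the affine map x \<mapsto> x^a \<eta>^-1.\<close>

definition "c = right_translation N \<eta> \<otimes>\<^bsub>P\<^esub> D"
definition "beta = beta_hom G \<sigma> N \<eta> \<delta> s"
definition "b = b_map N beta"
definition "al = alpha_map G N beta"

sublocale P: group P by (rule group_BijGroup)
sublocale PG: group PG by (rule group_BijGroup)

lemma delta_Bij: "\<delta> \<in> Bij (carrier N)"
  using delta by (simp add: auto_def)

lemma D_Bij: "D \<in> Bij (carrier N)"
  using P.nat_pow_closed[of \<delta> s] delta_Bij by (simp add: D_def BijGroup_sel)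

lemma D_apply: "x \<in> carrier N \<Longrightarrow> D x = x [^]\<^bsub>N\<^esub> a"
  unfolding D_def using BijGroup_pow[OF delta_Bij] delta_pow by simp

lemma right_translation_Bij: "right_translation N \<eta> \<in> Bij (carrier N)"
proof -
  have "inj_on (right_translation N \<eta>) (carrier N)"
    by (rule inj_onI) (simp add: right_translation_def N.eta)
  moreover from this have "right_translation N \<eta> ` carrier N = carrier N"
    using N.finite_N by (intro endo_inj_surj) (auto simp: right_translation_def N.eta)
  ultimately show ?thesis by (simp add: Bij_def bij_betw_def right_translation_def)
qed

lemma c_Bij: "c \<in> Bij (carrier N)"
  unfolding c_def using P.m_closed D_Bij right_translation_Bij by (simp add: BijGroup_sel(1))

lemma c_apply: "x \<in> carrier N \<Longrightarrow> c x = x [^]\<^bsub>N\<^esub> a \<otimes>\<^bsub>N\<^esub> inv\<^bsub>N\<^esub> \<eta>"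
  unfolding c_def using D_Bij right_translation_Bij
  by (simp add: BijGroup_sel compose_eq D_apply right_translation_def)

lemma c_pow:
  assumes "x \<in> carrier N"
  shows "(c ^^ k) x = x [^]\<^bsub>N\<^esub> (a ^ k) \<otimes>\<^bsub>N\<^esub> (inv\<^bsub>N\<^esub> \<eta>) [^]\<^bsub>N\<^esub> (\<Sum>j<k. a ^ j)"
proof (induction k)
  case 0
  then show ?case using assms by simp
next
  case (Suc k)
  let ?S = "\<Sum>j<k. a ^ j"
  have S: "(\<Sum>j<Suc k. a ^ j) = ?S * a + 1"
    by (simp only: sum.lessThan_Suc_shift) (simp add: sum_distrib_left mult.commute)
  have "(c ^^ Suc k) x = (x [^]\<^bsub>N\<^esub> (a ^ k) \<otimes>\<^bsub>N\<^esub> (inv\<^bsub>N\<^esub> \<eta>) [^]\<^bsub>N\<^esub> ?S) [^]\<^bsub>N\<^esub> a \<otimes>\<^bsub>N\<^esub> inv\<^bsub>N\<^esub> \<eta>"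
    using Suc assms N.eta by (simp add: c_apply)
  also have "\<dots> = x [^]\<^bsub>N\<^esub> (a ^ k * a) \<otimes>\<^bsub>N\<^esub> ((inv\<^bsub>N\<^esub> \<eta>) [^]\<^bsub>N\<^esub> (?S * a) \<otimes>\<^bsub>N\<^esub> (inv\<^bsub>N\<^esub> \<eta>) [^]\<^bsub>N\<^esub> (1::nat))"
    using assms N.eta by (simp add: N.nat_pow_distrib N.nat_pow_pow N.m_assoc)
  also have "\<dots> = x [^]\<^bsub>N\<^esub> (a ^ Suc k) \<otimes>\<^bsub>N\<^esub> (inv\<^bsub>N\<^esub> \<eta>) [^]\<^bsub>N\<^esub> (\<Sum>j<Suc k. a ^ j)"
    using N.eta by (simp only: S N.nat_pow_mult N.inv_closed power_Suc mult.commute)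
  finally show ?case .
qed

lemma q_dvd_sum: "q dvd (\<Sum>j<k. a ^ j) \<longleftrightarrow> q dvd k"
  using prime_power_dvd_geometric_sum[OF p a] by (simp add: q)

lemma N_pow_dvd: "q dvd k \<Longrightarrow> x \<in> carrier N \<Longrightarrow> x [^]\<^bsub>N\<^esub> (k::nat) = \<one>\<^bsub>N\<^esub>"
  using pow_multiple_order[OF N.cyclic_generator_axioms] .

lemma a_pos: "a \<ge> 1"
  using a prime_gt_1_nat[OF p(1)] by (cases "a = 0") (auto simp: cong_def)

text \<open>The \<open>q\<close>-th iterate of the affine map has as translation part \<eta>^-1
  raised to a geometric sum of length q, which q divides. Moreover a^q - 1 is a - 1 times that sum,
  so the linear part is trivial too.\<close>

lemma c_order: "c [^]\<^bsub>P\<^esub> q = \<one>\<^bsub>P\<^esub>"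
proof (rule Bij_ext[of _ "carrier N"])
  show "c [^]\<^bsub>P\<^esub> q \<in> Bij (carrier N)" using P.nat_pow_closed[of c q] c_Bij by (simp add: BijGroup_sel)
  show "\<one>\<^bsub>P\<^esub> \<in> Bij (carrier N)" using P.one_closed by (simp add: BijGroup_sel)
  fix x assume x: "x \<in> carrier N"
  have geo: "a ^ k = 1 + (\<Sum>j<k. a ^ j) * (a - 1)" for k
  proof (induction k)
    case (Suc k)
    obtain a' where a': "a = Suc a'" using a_pos by (cases a) auto
    show ?case using Suc by (simp add: a' algebra_simps)
  qed simp
  have S: "q dvd (\<Sum>j<q. a ^ j)" using q_dvd_sum by simp
  have "x [^]\<^bsub>N\<^esub> (a ^ q) = x [^]\<^bsub>N\<^esub> (1::nat) \<otimes>\<^bsub>N\<^esub> x [^]\<^bsub>N\<^esub> ((\<Sum>j<q. a ^ j) * (a - 1))"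
    using x by (subst geo) (simp only: N.nat_pow_mult)
  also have "\<dots> = x" using x S N_pow_dvd[of "(\<Sum>j<q. a ^ j) * (a - 1)" x] by simp
  finally have "(c ^^ q) x = x"
    using c_pow[OF x, of q] N_pow_dvd[OF S, of "inv\<^bsub>N\<^esub> \<eta>"] x N.eta by simp
  then show "(c [^]\<^bsub>P\<^esub> q) x = \<one>\<^bsub>P\<^esub> x" using BijGroup_pow[OF c_Bij x] x by (simp add: BijGroup_sel)
qed

lemma beta: "beta \<in> hom G P" "beta \<sigma> = c"
proof -
  have "\<exists>!\<beta>. \<beta> \<in> hom G P \<and> \<beta> \<in> extensional (carrier G) \<and> \<beta> \<sigma> = c"
    using c_Bij c_order by (intro G.hom_generator_unique) (auto simp: BijGroup_sel P.is_group)
  from theI'[OF this] show "beta \<in> hom G P" "beta \<sigma> = c"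
    by (simp_all add: beta_def beta_hom_def Let_def c_def D_def)
qed

lemma beta_Bij: "g \<in> carrier G \<Longrightarrow> beta g \<in> Bij (carrier N)"
  using beta(1) by (auto simp: hom_def BijGroup_sel)

lemma b_closed: "g \<in> carrier G \<Longrightarrow> b g \<in> carrier N"
  using beta_Bij Bij_imp_funcset by (fastforce simp: b_def b_map_def)

lemma b_sigma:
  assumes g: "g \<in> carrier G"
  shows "b (\<sigma> \<otimes>\<^bsub>G\<^esub> g) = c (b g)"
proof -
  have "beta (\<sigma> \<otimes>\<^bsub>G\<^esub> g) = c \<otimes>\<^bsub>P\<^esub> beta g" using beta g G.eta by (simp add: hom_def)
  then show ?thesis
    using c_Bij beta_Bij[OF g] by (simp add: b_def b_map_def BijGroup_sel compose_eq)
qed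

lemma b_pow: "b (\<sigma> [^]\<^bsub>G\<^esub> k) = (inv\<^bsub>N\<^esub> \<eta>) [^]\<^bsub>N\<^esub> (\<Sum>j<k. a ^ j)" for k :: nat
proof -
  interpret h: group_hom G P beta
    using beta(1) by unfold_locales
  have "beta (\<sigma> [^]\<^bsub>G\<^esub> k) = c [^]\<^bsub>P\<^esub> k" using beta(2) G.eta by (simp add: h.hom_nat_pow)
  then have "b (\<sigma> [^]\<^bsub>G\<^esub> k) = (c ^^ k) \<one>\<^bsub>N\<^esub>" using BijGroup_pow[OF c_Bij] by (simp add: b_def b_map_def)
  then show ?thesis using c_pow N.eta by simp
qed

text \<open>With S(k) = 1 + a + ... + a^(k-1), the image of \<sigma>^k is \<eta>^-1 raised to S(k).
  For k \<le> l one has S(l) - S(k) = a^k S(l - k) with \<open>a\<close> prime to \<open>p\<close>,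
  so equal images force q to divide S(l - k) and hence l - k.\<close>

lemma b_bij: "bij_betw b (carrier G) (carrier N)"
proof -
  have *: "[k = l] (mod q)"
    if eq: "(inv\<^bsub>N\<^esub> \<eta>) [^]\<^bsub>N\<^esub> (\<Sum>j<k. a ^ j) = (inv\<^bsub>N\<^esub> \<eta>) [^]\<^bsub>N\<^esub> (\<Sum>j<l. a ^ j)" and le: "k \<le> l" for k l
  proof -
    let ?S = "\<lambda>k. \<Sum>j<k. a ^ j"
    have "inv\<^bsub>N\<^esub> (\<eta> [^]\<^bsub>N\<^esub> ?S k) = inv\<^bsub>N\<^esub> (\<eta> [^]\<^bsub>N\<^esub> ?S l)" using eq N.eta by (simp add: N.nat_pow_inv)
    then have "\<eta> [^]\<^bsub>N\<^esub> ?S k = \<eta> [^]\<^bsub>N\<^esub> ?S l" using N.eta by (metis N.inv_inv N.nat_pow_closed)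
    then have "[?S k = ?S l] (mod q)" using N.pow_eq_iff by blast
    moreover have "?S l = ?S k + a ^ k * ?S (l - k)"
    proof -
      have "?S l = ?S k + (\<Sum>j\<in>{k..<l}. a ^ j)"
        using le by (simp add: lessThan_atLeast0 sum.atLeastLessThan_concat)
      also have "(\<Sum>j\<in>{k..<l}. a ^ j) = (\<Sum>j<l - k. a ^ (j + k))"
        using sum.shift_bounds_nat_ivl[of "\<lambda>j. a ^ j" 0 k "l - k"] le by (simp add: lessThan_atLeast0)
      also have "\<dots> = a ^ k * ?S (l - k)" by (simp add: power_add sum_distrib_left mult.commute)
      finally show ?thesis .
    qed
    ultimately have "q dvd a ^ k * ?S (l - k)"
      by (metis cong_add_lcancel_0_nat cong_sym cong_0_iff)
    moreover have "coprime q (a ^ k)"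
    proof -
      have "coprime p a" using a by (metis cong_imp_coprime coprime_1_left coprime_commute cong_sym)
      then show ?thesis by (simp add: q)
    qed
    ultimately have "q dvd l - k" using q_dvd_sum by (simp add: coprime_dvd_mult_right_iff)
    then show ?thesis using le by (metis cong_altdef_nat cong_sym)
  qed
  have "inj_on b (carrier G)"
  proof (rule inj_onI)
    fix x y assume xy: "x \<in> carrier G" "y \<in> carrier G" "b x = b y"
    then obtain k l :: nat where kl: "x = \<sigma> [^]\<^bsub>G\<^esub> k" "y = \<sigma> [^]\<^bsub>G\<^esub> l" using G.elemE by metis
    then have "[k = l] (mod q)"
      using xy(3) *[of k l] *[of l k] unfolding kl b_pow by (metis cong_sym nat_le_linear)
    then show "x = y" using kl G.pow_eq_iff by simp
  qed
  moreover have "card (carrier G) = card (carrier N)"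
    using G.card_N N.card_N by (simp add: order_def)
  ultimately have "b ` carrier G = carrier N"
    using b_closed N.finite_N by (intro card_subset_eq) (auto simp: card_image)
  then show ?thesis using \<open>inj_on b (carrier G)\<close> by (simp add: bij_betw_def)
qed

lemma al_apply: "g \<in> carrier G \<Longrightarrow> al \<nu> g = inv_into (carrier G) b (\<nu> \<otimes>\<^bsub>N\<^esub> b g)"
  by (simp add: al_def alpha_map_def left_regular_def b_closed flip: b_def)

lemma al_closed: "\<lbrakk>\<nu> \<in> carrier N; g \<in> carrier G\<rbrakk> \<Longrightarrow> al \<nu> g \<in> carrier G"
  using b_bij b_closed by (simp add: al_apply bij_betw_def inv_into_into)

lemma b_al: "\<lbrakk>\<nu> \<in> carrier N; g \<in> carrier G\<rbrakk> \<Longrightarrow> b (al \<nu> g) = \<nu> \<otimes>\<^bsub>N\<^esub> b g"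
  using b_bij b_closed by (simp add: al_apply bij_betw_def f_inv_into_f)

lemma b_eqI: "\<lbrakk>g \<in> carrier G; h \<in> carrier G; b g = b h\<rbrakk> \<Longrightarrow> g = h"
  using b_bij by (auto simp: bij_betw_def inj_on_def)

lemma al_Bij:
  assumes \<nu>: "\<nu> \<in> carrier N"
  shows "al \<nu> \<in> Bij (carrier G)"
proof -
  have "inj_on (al \<nu>) (carrier G)"
  proof (rule inj_onI)
    fix g h assume *: "g \<in> carrier G" "h \<in> carrier G" "al \<nu> g = al \<nu> h"
    then have "\<nu> \<otimes>\<^bsub>N\<^esub> b g = \<nu> \<otimes>\<^bsub>N\<^esub> b h" using b_al \<nu> by metis
    then show "g = h" using * \<nu> b_closed b_eqI by simp
  qed
  moreover from this have "al \<nu> ` carrier G = carrier G"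
    using G.finite_N al_closed[OF \<nu>] by (intro endo_inj_surj) auto
  ultimately show ?thesis by (simp add: Bij_def bij_betw_def al_def alpha_map_def)
qed

lemma al_mult:
  assumes "\<nu> \<in> carrier N" "\<mu> \<in> carrier N"
  shows "al (\<nu> \<otimes>\<^bsub>N\<^esub> \<mu>) = al \<nu> \<otimes>\<^bsub>PG\<^esub> al \<mu>"
proof (rule Bij_ext[of _ "carrier G"])
  show "al \<nu> \<otimes>\<^bsub>PG\<^esub> al \<mu> \<in> Bij (carrier G)"
    using PG.m_closed[of "al \<nu>" "al \<mu>"] al_Bij assms by (simp add: BijGroup_sel(1))
  fix g assume g: "g \<in> carrier G"
  have "al (\<nu> \<otimes>\<^bsub>N\<^esub> \<mu>) g = al \<nu> (al \<mu> g)"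
    using g assms by (intro b_eqI) (simp_all add: al_closed b_al b_closed N.m_assoc)
  then show "al (\<nu> \<otimes>\<^bsub>N\<^esub> \<mu>) g = (al \<nu> \<otimes>\<^bsub>PG\<^esub> al \<mu>) g"
    using g assms al_Bij by (simp add: BijGroup_sel compose_eq)
qed (use al_Bij assms in auto)

lemma al_inj: "inj_on al (carrier N)"
proof (rule inj_onI)
  fix \<nu> \<mu> assume *: "\<nu> \<in> carrier N" "\<mu> \<in> carrier N" "al \<nu> = al \<mu>"
  have "\<nu> \<otimes>\<^bsub>N\<^esub> b \<one>\<^bsub>G\<^esub> = \<mu> \<otimes>\<^bsub>N\<^esub> b \<one>\<^bsub>G\<^esub>" using * b_al G.one_closed by metis
  then show "\<nu> = \<mu>" using * b_closed by simp
qed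

abbreviation "M \<equiv> PG\<lparr>carrier := al ` carrier N\<rparr>"

lemma al_hom: "group_hom N PG al"
  using al_Bij al_mult by unfold_locales (auto simp: hom_def BijGroup_sel(1))

lemma group_M: "group M"
  using PG.subgroup_imp_group group_hom.img_is_subgroup[OF al_hom] by simp

lemma al_iso: "al \<in> iso N M"
  using al_mult al_inj by (auto simp: iso_def hom_def bij_betw_def)

section \<open>Conjugation of the regular subgroup by left translations\<close>

lemma left_regular_Bij: "g \<in> carrier G \<Longrightarrow> left_regular G g \<in> Bij (carrier G)"
proof -
  assume g: "g \<in> carrier G"
  have "inj_on (left_regular G g) (carrier G)"
    by (rule inj_onI) (simp add: left_regular_def g)
  moreover from this have "left_regular G g ` carrier G = carrier G"
    using G.finite_N by (intro endo_inj_surj) (auto simp: left_regular_def g)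
  ultimately show ?thesis by (simp add: Bij_def bij_betw_def left_regular_def)
qed

text \<open>Under \<open>b\<close>, left translation by \<sigma> becomes the affine map
  \<open>c\<close>, and c(\<nu> x) = \<nu>^a c(x): conjugation by \<open>c\<close> turns translation
  by \<nu> into translation by \<nu>^a.\<close>

lemma conj_action_al:
  assumes \<nu>: "\<nu> \<in> carrier N"
  shows "conj_action G \<sigma> (al \<nu>) = al ((\<delta> ^^ s) \<nu>)"
proof -
  note lr = left_regular_Bij[OF G.eta]
  have D\<nu>: "(\<delta> ^^ s) \<nu> \<in> carrier N" "(\<delta> ^^ s) \<nu> = \<nu> [^]\<^bsub>N\<^esub> a" using delta_pow \<nu> by simp_all
  have "left_regular G \<sigma> \<otimes>\<^bsub>PG\<^esub> al \<nu> = al ((\<delta> ^^ s) \<nu>) \<otimes>\<^bsub>PG\<^esub> left_regular G \<sigma>"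
  proof (rule Bij_ext[of _ "carrier G"])
    fix g assume g: "g \<in> carrier G"
    have "\<sigma> \<otimes>\<^bsub>G\<^esub> al \<nu> g = al ((\<delta> ^^ s) \<nu>) (\<sigma> \<otimes>\<^bsub>G\<^esub> g)"
    proof (rule b_eqI)
      have "b (\<sigma> \<otimes>\<^bsub>G\<^esub> al \<nu> g) = (\<nu> \<otimes>\<^bsub>N\<^esub> b g) [^]\<^bsub>N\<^esub> a \<otimes>\<^bsub>N\<^esub> inv\<^bsub>N\<^esub> \<eta>"
        using g \<nu> by (simp add: b_sigma al_closed b_al c_apply b_closed)
      also have "\<dots> = (\<nu> [^]\<^bsub>N\<^esub> a) \<otimes>\<^bsub>N\<^esub> (b g [^]\<^bsub>N\<^esub> a \<otimes>\<^bsub>N\<^esub> inv\<^bsub>N\<^esub> \<eta>)"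
        using g \<nu> b_closed N.eta by (simp add: N.nat_pow_distrib N.m_assoc)
      also have "\<dots> = b (al ((\<delta> ^^ s) \<nu>) (\<sigma> \<otimes>\<^bsub>G\<^esub> g))"
        using g D\<nu> G.eta by (simp add: b_al b_sigma c_apply b_closed)
      finally show "b (\<sigma> \<otimes>\<^bsub>G\<^esub> al \<nu> g) = b (al ((\<delta> ^^ s) \<nu>) (\<sigma> \<otimes>\<^bsub>G\<^esub> g))" .
    qed (use g \<nu> D\<nu>(1) G.eta al_closed in auto)
    then show "(left_regular G \<sigma> \<otimes>\<^bsub>PG\<^esub> al \<nu>) g = (al ((\<delta> ^^ s) \<nu>) \<otimes>\<^bsub>PG\<^esub> left_regular G \<sigma>) g"
      using g lr al_Bij[OF \<nu>] al_Bij[OF D\<nu>(1)] al_closed[OF \<nu>] G.eta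
      by (simp add: BijGroup_sel compose_eq left_regular_def)
  qed (use PG.m_closed lr al_Bij[OF \<nu>] al_Bij[OF D\<nu>(1)] in \<open>auto simp: BijGroup_sel(1)\<close>)
  moreover have "left_regular G \<sigma> \<in> carrier PG" "al ((\<delta> ^^ s) \<nu>) \<in> carrier PG"
    using lr al_Bij[OF D\<nu>(1)] by (simp_all add: BijGroup_sel(1))
  ultimately show ?thesis
    unfolding conj_action_def Let_def by (simp add: PG.m_assoc)
qed

lemma left_regular_mult:
  assumes "g \<in> carrier G" "h \<in> carrier G"
  shows "left_regular G (g \<otimes>\<^bsub>G\<^esub> h) = left_regular G g \<otimes>\<^bsub>PG\<^esub> left_regular G h"
proof (rule Bij_ext[of _ "carrier G"])
  show "left_regular G g \<otimes>\<^bsub>PG\<^esub> left_regular G h \<in> Bij (carrier G)"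
    using PG.m_closed[of "left_regular G g" "left_regular G h"] left_regular_Bij assms
    by (simp add: BijGroup_sel(1))
  fix x assume "x \<in> carrier G"
  then show "left_regular G (g \<otimes>\<^bsub>G\<^esub> h) x = (left_regular G g \<otimes>\<^bsub>PG\<^esub> left_regular G h) x"
    using assms left_regular_Bij
    by (simp add: BijGroup_sel compose_eq) (simp add: left_regular_def G.m_assoc)
qed (use assms left_regular_Bij in auto)

lemma left_regular_hom: "group_hom G PG (left_regular G)"
  using left_regular_mult left_regular_Bij by unfold_locales (auto simp: hom_def BijGroup_sel(1))

lemma left_regular_PG: "g \<in> carrier G \<Longrightarrow> left_regular G g \<in> carrier PG"
  using left_regular_Bij by (simp add: BijGroup_sel(1))

lemma conj_action_closed: "\<lbrakk>g \<in> carrier G; x \<in> carrier PG\<rbrakk> \<Longrightarrow> conj_action G g x \<in> carrier PG"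
  unfolding conj_action_def Let_def using left_regular_PG by simp

lemma conj_action_mult:
  assumes "g \<in> carrier G" "h \<in> carrier G" "x \<in> carrier PG"
  shows "conj_action G (g \<otimes>\<^bsub>G\<^esub> h) x = conj_action G g (conj_action G h x)"
  unfolding conj_action_def Let_def using assms left_regular_PG
  by (simp add: left_regular_mult PG.inv_mult_group PG.m_assoc)

lemma conj_action_one: "x \<in> carrier PG \<Longrightarrow> conj_action G \<one>\<^bsub>G\<^esub> x = x"
  unfolding conj_action_def Let_def using group_hom.hom_one[OF left_regular_hom] by simp

lemma conj_action_hom:
  assumes "g \<in> carrier G" "x \<in> carrier PG" "y \<in> carrier PG"
  shows "conj_action G g (x \<otimes>\<^bsub>PG\<^esub> y) = conj_action G g x \<otimes>\<^bsub>PG\<^esub> conj_action G g y"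
proof -
  let ?l = "left_regular G g"
  have "?l \<otimes>\<^bsub>PG\<^esub> x \<otimes>\<^bsub>PG\<^esub> inv\<^bsub>PG\<^esub> ?l \<otimes>\<^bsub>PG\<^esub> (?l \<otimes>\<^bsub>PG\<^esub> y \<otimes>\<^bsub>PG\<^esub> inv\<^bsub>PG\<^esub> ?l) =
      ?l \<otimes>\<^bsub>PG\<^esub> x \<otimes>\<^bsub>PG\<^esub> ((inv\<^bsub>PG\<^esub> ?l \<otimes>\<^bsub>PG\<^esub> ?l) \<otimes>\<^bsub>PG\<^esub> (y \<otimes>\<^bsub>PG\<^esub> inv\<^bsub>PG\<^esub> ?l))"
    using assms left_regular_PG by (simp only: PG.m_assoc PG.m_closed PG.inv_closed)
  then show ?thesis
    unfolding conj_action_def Let_def using assms left_regular_PG by (simp add: PG.m_assoc)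
qed

lemma conj_action_pow:
  assumes "x \<in> carrier PG"
  shows "conj_action G (\<sigma> [^]\<^bsub>G\<^esub> (k::nat)) x = (conj_action G \<sigma> ^^ k) x"
  using assms
proof (induction k arbitrary: x)
  case (Suc k)
  then show ?case
    using conj_action_mult[of "\<sigma> [^]\<^bsub>G\<^esub> k" \<sigma> x] conj_action_closed[of \<sigma> x] G.eta
    by (simp add: funpow_swap1)
qed (simp add: conj_action_one)

lemma al_PG: "\<nu> \<in> carrier N \<Longrightarrow> al \<nu> \<in> carrier PG"
  using al_Bij by (simp add: BijGroup_sel(1))

lemma delta_pow_closed: "\<nu> \<in> carrier N \<Longrightarrow> (\<delta> ^^ k) \<nu> \<in> carrier N"
  using Bij_imp_funcset[OF delta_Bij] by (rule funpow_closed)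

lemma conj_action_pow_al:
  assumes "\<nu> \<in> carrier N"
  shows "(conj_action G \<sigma> ^^ k) (al \<nu>) = al ((\<delta> ^^ (s * k)) \<nu>)"
  using assms
proof (induction k)
  case (Suc k)
  then show ?case
    using conj_action_al[OF delta_pow_closed[OF assms, of "s * k"]] by (simp add: funpow_add)
qed simp

end

section \<open>The Hopf algebras of a cyclic extension\<close>

lemma galois_group_pow:
  assumes "\<sigma> \<in> carrier (galois_group L K)" "x \<in> carrier L"
  shows "(\<sigma> [^]\<^bsub>galois_group L K\<^esub> (k::nat)) x = (\<sigma> ^^ k) x"
proof -
  interpret P: group "BijGroup (carrier L)" by (rule group_BijGroup)
  have "\<sigma> \<in> Bij (carrier L)" using assms by (simp add: galois_group_def)
  moreover have "\<sigma> [^]\<^bsub>galois_group L K\<^esub> k = \<sigma> [^]\<^bsub>BijGroup (carrier L)\<^esub> k"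
    unfolding galois_group_def by (rule P.nat_pow_consistent[symmetric])
  ultimately show ?thesis using BijGroup_pow assms(2) by metis
qed

text \<open>The degree is the least positive exponent for which the power of \<sigma> is the
  identity on \<open>L\<close>, so it is the order of \<sigma> and of the group generated by
  it.\<close>

lemma galois_group_cyclic_generator:
  assumes gal: "galois_extension L K" and \<sigma>: "\<sigma> \<in> carrier (galois_group L K)"
    and gen: "generate (galois_group L K) {\<sigma>} = carrier (galois_group L K)"
    and dim: "ring.dimension L d K (carrier L)"
  shows "cyclic_generator (galois_group L K) \<sigma> d"
proof -
  let ?G = "galois_group L K"
  interpret G: group ?G using group_galois_group[OF gal] .
  interpret field_endo L \<sigma> using galois_group_cyclic(1)[OF gal \<sigma> gen] .
  note F = fixed_carrier_of_dimension[OF galois_group_cyclic(2)[OF gal \<sigma> gen] dim]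
  have B: "g \<in> Bij (carrier L)" if "g \<in> carrier ?G" for g using that by (simp add: galois_group_def)
  have one: "\<one>\<^bsub>?G\<^esub> = (\<lambda>x\<in>carrier L. x)" by (simp add: galois_group_def BijGroup_sel)
  have pow_one_iff: "\<sigma> [^]\<^bsub>?G\<^esub> k = \<one>\<^bsub>?G\<^esub> \<longleftrightarrow> (\<forall>x\<in>carrier L. (\<sigma> ^^ k) x = x)" for k :: nat
  proof
    assume "\<sigma> [^]\<^bsub>?G\<^esub> k = \<one>\<^bsub>?G\<^esub>"
    then show "\<forall>x\<in>carrier L. (\<sigma> ^^ k) x = x" using galois_group_pow[OF \<sigma>, of _ k] one by simp
  next
    assume *: "\<forall>x\<in>carrier L. (\<sigma> ^^ k) x = x"
    show "\<sigma> [^]\<^bsub>?G\<^esub> k = \<one>\<^bsub>?G\<^esub>"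
      using * galois_group_pow[OF \<sigma>, of _ k] one \<sigma> G.one_closed
      by (intro Bij_ext[OF B B]) simp_all
  qed
  have d1: "\<sigma> [^]\<^bsub>?G\<^esub> d = \<one>\<^bsub>?G\<^esub>" using F(2) pow_one_iff by (auto simp: fixed_def)
  then have dvd: "G.ord \<sigma> dvd d" using G.pow_eq_id[OF \<sigma>] by simp
  then have "0 < G.ord \<sigma>" "G.ord \<sigma> \<le> d" using F(1) by (auto intro: dvd_imp_le Nat.gr0I)
  moreover have "\<forall>x\<in>carrier L. (\<sigma> ^^ G.ord \<sigma>) x = x" using pow_one_iff G.pow_ord_eq_1[OF \<sigma>] by blast
  ultimately have "G.ord \<sigma> = d" using F(3)[of "G.ord \<sigma>"] by force
  then have "order ?G = d" using G.generate_pow_card[OF \<sigma>] gen by (simp add: order_def)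
  then show ?thesis
    by (intro cyclic_generator.intro cyclic_generator_axioms.intro G.is_group \<sigma> gen F(1))
qed

text \<open>This connects the definitions with the abstract setting: invariance under the whole
  Galois group amounts to invariance under its generator, which is the condition defining
  \<open>V\<close> for the twist by conjugation with \<lambda>(\<sigma>).\<close>

lemma H_alg_twisted_group:
  fixes L :: "('l, 'x) ring_scheme"
  assumes gal: "galois_extension L K" and \<sigma>: "\<sigma> \<in> carrier (galois_group L K)"
    and gen: "generate (galois_group L K) {\<sigma>} = carrier (galois_group L K)"
    and dim: "ring.dimension L q K (carrier L)"
    and tw: "regular_twist (galois_group L K) \<sigma> N \<eta> q p n a \<delta> s"
  defines "G \<equiv> galois_group L K"
  defines "M \<equiv> (BijGroup (carrier G))\<lparr>carrier := regular_twist.al G \<sigma> N \<eta> \<delta> s ` carrier N\<rparr>"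
  shows "twisted_group L \<sigma> M (conj_action G \<sigma>) q K"
    and "H_alg L K \<sigma> N \<eta> \<delta> s = fixed_hopf L K (group_algebra L M)
      (semilinear_functions.V L \<sigma> (carrier M) (conj_action G \<sigma>))"
proof -
  interpret T: regular_twist G \<sigma> N \<eta> q p n a \<delta> s using tw by (simp add: G_def)
  have M: "M = T.M" by (simp add: M_def)
  let ?\<psi> = "conj_action G \<sigma>"
  let ?Z = "T.al ` carrier N"
  have ZM: "carrier M = ?Z" by (simp add: M)
  interpret F: field_endo L \<sigma> using galois_group_cyclic(1)[OF gal \<sigma> gen] .
  note K = galois_group_cyclic(2)[OF gal \<sigma> gen]
  note Fx = F.fixed_carrier_of_dimension[OF K dim]
  have Z_PG: "x \<in> carrier T.PG" if "x \<in> ?Z" for x using that T.al_PG by blast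
  have psi_Z: "?\<psi> x \<in> ?Z" if "x \<in> ?Z" for x
    using that T.conj_action_al T.delta_pow_closed by auto
  have psi_q: "(?\<psi> ^^ q) x = x" if "x \<in> ?Z" for x
  proof -
    have "\<sigma> [^]\<^bsub>G\<^esub> q = \<one>\<^bsub>G\<^esub>" using pow_multiple_order[OF T.G.cyclic_generator_axioms] T.G.eta by simp
    then show ?thesis using T.conj_action_pow[OF Z_PG[OF that], of q] T.conj_action_one[OF Z_PG[OF that]] by simp
  qed
  show tg: "twisted_group L \<sigma> M ?\<psi> q K"
  proof (intro twisted_group.intro semilinear_functions.intro F.field_endo_axioms
      semilinear_functions_axioms.intro twisted_group_axioms.intro)
    show "finite (carrier M)" using T.N.finite_N by (simp add: ZM)
    show "?\<psi> \<in> carrier M \<rightarrow> carrier M" using psi_Z by (simp add: ZM)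
    show "(?\<psi> ^^ q) x = x" if "x \<in> carrier M" for x using psi_q that by (simp add: ZM)
    show "group M" using T.group_M M by simp
    show "?\<psi> (x \<otimes>\<^bsub>M\<^esub> y) = ?\<psi> x \<otimes>\<^bsub>M\<^esub> ?\<psi> y" if "x \<in> carrier M" "y \<in> carrier M" for x y
      using T.conj_action_hom[OF T.G.eta Z_PG Z_PG] that by (simp add: M)
  qed (use Fx K in auto)
  interpret W: twisted_group L \<sigma> M ?\<psi> q K by (rule tg)
  let ?A = "group_algebra L M"
  have V: "{f \<in> carrier ?A. \<forall>g\<in>carrier G. galois_action L K ?Z g f = f} = W.V"
  proof (intro equalityI subsetI)
    fix f assume "f \<in> {f \<in> carrier ?A. \<forall>g\<in>carrier G. galois_action L K ?Z g f = f}"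
    then have fA: "f \<in> carrier ?A" and fixed: "galois_action L K ?Z \<sigma> f = f" using T.G.eta by auto
    have f: "f \<in> carrier M \<rightarrow>\<^sub>E carrier L" using fA by (simp add: group_algebra_sel)
    show "f \<in> W.V"
    proof (rule W.V_I)
      show "f \<in> extensional (carrier M)" using f by (simp add: PiE_def)
      show "f x \<in> carrier L" if "x \<in> carrier M" for x using f that by auto
      fix x assume "x \<in> carrier M"
      then have x: "x \<in> ?Z" by (simp add: ZM)
      have "conj_action G (inv\<^bsub>G\<^esub> \<sigma>) (?\<psi> x) = x"
        using T.conj_action_mult[of "inv\<^bsub>G\<^esub> \<sigma>" \<sigma> x] Z_PG[OF x] T.G.eta T.conj_action_one by simp
      moreover have "galois_action L K ?Z \<sigma> f (?\<psi> x) = \<sigma> (f (conj_action G (inv\<^bsub>G\<^esub> \<sigma>) (?\<psi> x)))"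
        using psi_Z[OF x] by (simp add: galois_action_def Let_def flip: G_def)
      ultimately show "f (?\<psi> x) = \<sigma> (f x)" using fixed by simp
    qed
  next
    fix f assume f: "f \<in> W.V"
    have "galois_action L K ?Z g f = f" if g: "g \<in> carrier G" for g
    proof (rule extensionalityI[of _ ?Z])
      show "f \<in> extensional ?Z" using W.V_ext[OF f] by (simp add: ZM)
      fix y assume y: "y \<in> ?Z"
      obtain k :: nat where k: "g = \<sigma> [^]\<^bsub>G\<^esub> k" using T.G.elemE g by metis
      \<comment> \<open>Both \<open>g\<close> and its inverse are written as powers of \<sigma> with
        natural exponents, so that no inverse of the conjugation map is needed.\<close>
      obtain l :: nat where l: "inv\<^bsub>G\<^esub> g = \<sigma> [^]\<^bsub>G\<^esub> l" using T.G.elemE g by (metis T.G.inv_closed)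
      define x where "x = conj_action G (inv\<^bsub>G\<^esub> g) y"
      have "x = (?\<psi> ^^ l) y" unfolding x_def l using T.conj_action_pow[OF Z_PG[OF y]] .
      then have x: "x \<in> ?Z" using W.psi_pow_closed y by (simp add: ZM)
      have "(?\<psi> ^^ k) x = y"
        using T.conj_action_pow[OF Z_PG[OF x], of k] T.conj_action_mult[of g "inv\<^bsub>G\<^esub> g" y]
          Z_PG[OF y] g T.conj_action_one by (simp add: k x_def)
      then have "f y = (\<sigma> ^^ k) (f x)" using W.V_pow[OF f, of x k] x by (simp add: ZM)
      also have "\<dots> = g (f x)"
        using galois_group_pow[OF \<sigma>, of "f x" k] W.V_closed[OF f] x k by (simp add: ZM G_def)
      finally show "galois_action L K ?Z g f y = f y"
        using y by (simp add: galois_action_def Let_def x_def flip: G_def)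
    qed (simp add: galois_action_def Let_def)
    then show "f \<in> {f \<in> carrier ?A. \<forall>g\<in>carrier G. galois_action L K ?Z g f = f}"
      using W.V_A[OF f] by simp
  qed
  have "H_alg L K \<sigma> N \<eta> \<delta> s = descended_hopf L K ?Z"
    by (simp add: H_alg_def Let_def T.al_def T.beta_def flip: G_def)
  also have "\<dots> = fixed_hopf L K ?A {f \<in> carrier ?A. \<forall>g\<in>carrier G. galois_action L K ?Z g f = f}"
    by (simp add: descended_hopf_def fixed_hopf_def Let_def M flip: G_def)
  finally show "H_alg L K \<sigma> N \<eta> \<delta> s = fixed_hopf L K ?A W.V" by (simp only: V)
qed

theorem theorem4p2:
  fixes L :: "'l ring" and K E :: "'l set" and \<sigma> :: "'l \<Rightarrow> 'l"
    and N :: "'n monoid" and \<eta> :: 'n and \<gamma> \<delta> :: "'n \<Rightarrow> 'n"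
    and p n r s i :: nat
  assumes "Factorial_Ring.prime p" and "odd p" and "n \<ge> 1"
    and "galois_extension L K"
    and "ring.dimension L (p ^ n) K (carrier L)"
    and "\<sigma> \<in> carrier (galois_group L K)"
    and "generate (galois_group L K) {\<sigma>} = carrier (galois_group L K)"
    and "group N" and "Coset.order N = p ^ n"
    and "\<eta> \<in> carrier N" and "generate N {\<eta>} = carrier N"
    and "\<gamma> \<in> carrier (AutoGroup N)"
    and "generate (AutoGroup N) {\<gamma>} = carrier (AutoGroup N)"
    and "\<delta> = \<gamma> [^]\<^bsub>AutoGroup N\<^esub> (p - 1)"
    and "r < p ^ (n - 1)" and "s < p ^ (n - 1)" and "i \<le> n"
    and "subfield E L" and "K \<subseteq> E" and "ring.dimension L (p ^ i) K E"
  shows "hopf_isomorphic (L\<lparr>carrier := E\<rparr>)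
           (base_change (L\<lparr>carrier := K\<rparr>) (L\<lparr>carrier := E\<rparr>) (H_alg L K \<sigma> N \<eta> \<delta> r))
           (base_change (L\<lparr>carrier := K\<rparr>) (L\<lparr>carrier := E\<rparr>) (H_alg L K \<sigma> N \<eta> \<delta> s))
         \<longleftrightarrow> i = n \<or> [r = s] (mod p ^ (n - 1 - i))"
proof -
  let ?G = "galois_group L K" and ?q = "p ^ n" and ?e = "p ^ i"
  have p1: "p > 1" using assms(1) prime_gt_1_nat by blast
  interpret F: field_endo L \<sigma> using galois_group_cyclic(1)[OF assms(4,6,7)] .
  note K = galois_group_cyclic(2)[OF assms(4,6,7)]
  note E = F.fixed_subfield_of_dimension[OF K assms(5,18-20)]
  interpret G: cyclic_generator ?G \<sigma> ?q
    using galois_group_cyclic_generator[OF assms(4,6,7,5)] .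
  interpret N: cyclic_generator N \<eta> ?q
    by (rule cyclic_generator.intro[OF assms(8)], rule cyclic_generator_axioms.intro)
      (use assms p1 in auto)
  note \<delta> = N.automorphism_generator_power[OF assms(1,3) refl assms(12-14)]
  obtain d where d: "[d = 1] (mod p)" "\<And>x. x \<in> carrier N \<Longrightarrow> \<delta> x = x [^]\<^bsub>N\<^esub> d" using \<delta>(2) by blast
  have \<delta>_pow: "(\<delta> ^^ k) x = x [^]\<^bsub>N\<^esub> (d ^ k)" if "x \<in> carrier N" for x k
    using that by (induction k) (auto simp: d(2) N.nat_pow_pow mult.commute)
  \<comment> \<open>All powers of \<open>d\<close> remain 1 modulo \<open>p\<close>, as
    \<open>regular_twist\<close> demands, so that the same facts apply to \<open>r\<close> and to
    \<open>s\<close>.\<close>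
  have dk: "[d ^ k = 1] (mod p)" for k using cong_pow[OF d(1), of k] by simp
  have tw: "regular_twist ?G \<sigma> N \<eta> ?q p n (d ^ k) \<delta> k" for k
    by (intro regular_twist.intro regular_twist_axioms.intro G.cyclic_generator_axioms
        N.cyclic_generator_axioms assms(1,2) refl \<delta>(1) \<delta>_pow dk)
  interpret r: regular_twist ?G \<sigma> N \<eta> ?q p n "d ^ r" \<delta> r by (rule tw)
  interpret s: regular_twist ?G \<sigma> N \<eta> ?q p n "d ^ s" \<delta> s by (rule tw)
  note Hr = H_alg_twisted_group[OF assms(4,6,7,5) tw[of r]]
  note Hs = H_alg_twisted_group[OF assms(4,6,7,5) tw[of s]]
  let ?\<psi> = "conj_action ?G \<sigma>"
  have e_dvd: "?e dvd ?q" using assms(17) by (simp add: le_imp_power_dvd)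
  interpret form_pair L \<sigma> r.M ?\<psi> s.M ?\<psi> ?q K ?e E
    by (intro form_pair.intro base_changed.intro Hr(1) Hs(1) base_changed_axioms.intro e_dvd
        E(2)[symmetric] E(3))
  have "hopf_isomorphic (L\<lparr>carrier := E\<rparr>) P.Bh Q.Bh \<longleftrightarrow>
    (\<exists>\<theta>\<in>iso r.M s.M. \<forall>x\<in>carrier r.M. \<theta> ((?\<psi> ^^ ?e) x) = (?\<psi> ^^ ?e) (\<theta> x))"
  proof
    have "card (carrier r.M) = card (carrier s.M)"
      using card_image[OF r.al_inj] card_image[OF s.al_inj] by simp
    then show "hopf_isomorphic (L\<lparr>carrier := E\<rparr>) P.Bh Q.Bh \<Longrightarrow>
      \<exists>\<theta>\<in>iso r.M s.M. \<forall>x\<in>carrier r.M. \<theta> ((?\<psi> ^^ ?e) x) = (?\<psi> ^^ ?e) (\<theta> x)"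
      using iso_if_hopf_isomorphic by blast
  qed (use hopf_isomorphic_if_iso in blast)
  also have "\<dots> \<longleftrightarrow> (\<forall>x\<in>carrier N. (\<delta> ^^ (r * ?e)) x = (\<delta> ^^ (s * ?e)) x)"
  proof
    assume "\<exists>\<theta>\<in>iso r.M s.M. \<forall>x\<in>carrier r.M. \<theta> ((?\<psi> ^^ ?e) x) = (?\<psi> ^^ ?e) (\<theta> x)"
    then obtain \<theta> where \<theta>: "\<theta> \<in> iso r.M s.M"
      and \<theta>\<psi>: "\<And>x. x \<in> carrier r.M \<Longrightarrow> \<theta> ((?\<psi> ^^ ?e) x) = (?\<psi> ^^ ?e) (\<theta> x)" by blast
    \<comment> \<open>The automorphism of \<open>N\<close> that corresponds to \<theta> under the
      identifications of \<open>N\<close> with the two regular subgroups.\<close>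
    define \<tau> where "\<tau> = inv_into (carrier N) s.al \<circ> (\<theta> \<circ> r.al)"
    have \<tau>: "\<tau> \<in> iso N N"
      unfolding \<tau>_def using r.al_iso \<theta> N.iso_set_sym[OF s.al_iso] by (intro iso_set_trans)
    have \<tau>c: "\<tau> x \<in> carrier N" if "x \<in> carrier N" for x using \<tau> that by (auto simp: iso_def hom_def)
    have al\<tau>: "s.al (\<tau> x) = \<theta> (r.al x)" if "x \<in> carrier N" for x
    proof -
      have "\<theta> (r.al x) \<in> s.al ` carrier N" using \<theta> that by (auto simp: iso_def hom_def)
      then show ?thesis by (simp add: \<tau>_def f_inv_into_f)
    qed
    have \<tau>\<delta>: "\<tau> ((\<delta> ^^ (r * ?e)) x) = (\<delta> ^^ (s * ?e)) (\<tau> x)" if x: "x \<in> carrier N" for x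
    proof -
      have "s.al (\<tau> ((\<delta> ^^ (r * ?e)) x)) = \<theta> ((?\<psi> ^^ ?e) (r.al x))"
        using al\<tau>[OF r.delta_pow_closed[OF x]] r.conj_action_pow_al[OF x] by simp
      also have "\<dots> = s.al ((\<delta> ^^ (s * ?e)) (\<tau> x))"
        using \<theta>\<psi> x al\<tau>[OF x] s.conj_action_pow_al[OF \<tau>c[OF x]] by simp
      finally show ?thesis
        using s.al_inj \<tau>c r.delta_pow_closed x by (auto simp: inj_on_def)
    qed
    have \<tau>hom: "group_hom N N \<tau>"
      using \<tau> N.is_group by (simp add: iso_def group_hom_def group_hom_axioms_def)
    show "\<forall>x\<in>carrier N. (\<delta> ^^ (r * ?e)) x = (\<delta> ^^ (s * ?e)) x"
    proof
      fix y assume "y \<in> carrier N"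
      then obtain x where x: "x \<in> carrier N" "y = \<tau> x" using \<tau> by (auto simp: iso_def bij_betw_def)
      \<comment> \<open>Powers of \<delta> are power maps, and these commute with every
        endomorphism; in this form the commutativity of Aut(N) is used.\<close>
      have "\<tau> ((\<delta> ^^ (r * ?e)) x) = (\<delta> ^^ (r * ?e)) (\<tau> x)"
        using x \<tau>c \<delta>_pow group_hom.hom_nat_pow[OF \<tau>hom] by simp
      then show "(\<delta> ^^ (r * ?e)) y = (\<delta> ^^ (s * ?e)) y" using \<tau>\<delta> x by simp
    qed
  next
    assume eq: "\<forall>x\<in>carrier N. (\<delta> ^^ (r * ?e)) x = (\<delta> ^^ (s * ?e)) x"
    \<comment> \<open>When the two twists coincide on \<open>N\<close>, the identity of
      \<open>N\<close>, read between the two regular subgroups, intertwines them.\<close>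
    define \<theta> where "\<theta> = s.al \<circ> inv_into (carrier N) r.al"
    have "\<theta> \<in> iso r.M s.M"
      unfolding \<theta>_def using s.al_iso N.iso_set_sym[OF r.al_iso] by (intro iso_set_trans)
    moreover have \<theta>al: "\<theta> (r.al x) = s.al x" if "x \<in> carrier N" for x
      using r.al_inj that by (simp add: \<theta>_def)
    moreover have "\<theta> ((?\<psi> ^^ ?e) (r.al x)) = (?\<psi> ^^ ?e) (\<theta> (r.al x))" if x: "x \<in> carrier N" for x
      using x eq by (simp add: \<theta>al r.conj_action_pow_al s.conj_action_pow_al r.delta_pow_closed)
    ultimately show "\<exists>\<theta>\<in>iso r.M s.M. \<forall>x\<in>carrier r.M. \<theta> ((?\<psi> ^^ ?e) x) = (?\<psi> ^^ ?e) (\<theta> x)"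
      by (intro bexI[of _ \<theta>]) auto
  qed
  also have "\<dots> \<longleftrightarrow> [r * ?e = s * ?e] (mod p ^ (n - 1))" by (rule \<delta>(3))
  also have "\<dots> \<longleftrightarrow> i = n \<or> [r = s] (mod p ^ (n - 1 - i))"
  proof (cases "i = n")
    case True
    \<comment> \<open>For i = n the modulus already divides p^i, so both sides of the congruence
      vanish.\<close>
    then have "p ^ (n - 1) dvd ?e" by (simp add: le_imp_power_dvd)
    then have "[r * ?e = 0] (mod p ^ (n - 1))" "[s * ?e = 0] (mod p ^ (n - 1))"
      by (simp_all add: cong_0_iff)
    then show ?thesis using True cong_trans cong_sym by blast
  next
    case False
    \<comment> \<open>Now i \<le> n - 1, so the difference n - 1 - i is not truncated and p^i
      cancels from both sides and the modulus.\<close>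
    then have "p ^ (n - 1) = p ^ (n - 1 - i) * ?e"
      using assms(17) by (simp flip: power_add)
    then show ?thesis using False p1 by (simp add: cong_def mod_mult_mult2)
  qed
  finally show ?thesis using Hr(2) Hs(2) by simp
qed

end
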